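(* The geodesic equation on $Q$ for the metric $G$ is, in its Hamiltonian formulation, the first-order system on $T^*Q$ defined by $$\begin{cases}\dot q=\eta(q)\,p\\[2pt] \dot p=-\frac12\int_x^1\eta(q)p^2\,dy+\begin{bmatrix}1&\varphi\end{bmatrix}H_2^{-1}\begin{bmatrix}a\\ b+c\end{bmatrix}\end{cases}$$ where the coefficients $a,b,c$ depend on $p,q$ and are given by $$a=\frac12\int_0^1x\,p^2\circ\varphi^{-1}\,dx,\qquad b=\frac32\int_0^1\Big(\int_0^xp\circ\varphi^{-1}\,dy\Big)^2dx,\qquad c=\frac14\int_0^1x^2\,p^2\circ\varphi^{-1}\,dx .$$
   Context: For $q\in L^2([0,1])$, $\eta(q)(x)=\exp(\int_0^xq(u)\,du)$ and $\varphi=\varphi(q)$, $\varphi(q)(x)=\int_0^x\eta(q)(y)\,dy$. $Q=\{q\in L^2([0,1]):\int_0^1q\,dx=0,\ \int_0^1\eta(q)\,dx=1\}$ is a Hilbert submanifold of $L^2([0,1])$ with tangent space $T_qQ=\{X\in L^2([0,1]):\int_0^1X\,dx=0,\ \int_0^1X\varphi\,dx=0\}$ and Riemannian metric $G(q)(X,X)=\int_0^1X^2/\eta(q)\,dx$. The cotangent space is identified (through the $L^2$ pairing, with $p=\dot q/\eta(q)$ the momentum) with $T_q^*Q=\{p\in L^2([0,1]):\int_0^1p\,\eta(q)\,dx=0,\ \int_0^1p\,\varphi\,\eta(q)\,dx=0\}$. $H_2=\begin{bmatrix}1&1/2\\1/2&1/3\end{bmatrix}$. *)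

theory Defs
  imports "HOL-Analysis.Analysis"
begin

section \<open>The Hilbert space of square integrable functions on the unit interval\<close>

abbreviation unit_lborel :: "real measure" where
  "unit_lborel \<equiv> restrict_space lborel {0..1}"

definition square_integrable :: "(real \<Rightarrow> real) \<Rightarrow> bool" where
  "square_integrable f \<longleftrightarrow>
     f \<in> borel_measurable unit_lborel \<and> integrable unit_lborel (\<lambda>x. (f x)\<^sup>2)"

definition L2_rel :: "(real \<Rightarrow> real) \<Rightarrow> (real \<Rightarrow> real) \<Rightarrow> bool" where
  "L2_rel f g \<longleftrightarrow>
     square_integrable f \<and> square_integrable g \<and> (AE x in unit_lborel. f x = g x)"

lemma square_integrable_zero: "square_integrable (\<lambda>x. 0)"
  by (simp add: square_integrable_def)

lemma square_integrable_mult: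
  assumes "square_integrable f" "square_integrable g"
  shows "integrable unit_lborel (\<lambda>x. f x * g x)"
proof (rule Bochner_Integration.integrable_bound)
  show "integrable unit_lborel (\<lambda>x. (f x)\<^sup>2 + (g x)\<^sup>2)"
    using assms by (auto simp: square_integrable_def)
  show "(\<lambda>x. f x * g x) \<in> borel_measurable unit_lborel"
    using assms by (auto simp: square_integrable_def)
  have "norm (u * v) \<le> norm (u\<^sup>2 + v\<^sup>2)" for u v :: real
  proof -
    have "2 * (\<bar>u\<bar> * \<bar>v\<bar>) \<le> u\<^sup>2 + v\<^sup>2"
      using sum_squares_bound[of "\<bar>u\<bar>" "\<bar>v\<bar>"] by simp
    moreover have "0 \<le> \<bar>u\<bar> * \<bar>v\<bar>" by simp
    ultimately have "\<bar>u\<bar> * \<bar>v\<bar> \<le> u\<^sup>2 + v\<^sup>2" by linarith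
    then show ?thesis by (simp add: abs_mult)
  qed
  then show "AE x in unit_lborel. norm (f x * g x) \<le> norm ((f x)\<^sup>2 + (g x)\<^sup>2)"
    by simp
qed

lemma square_integrable_add:
  assumes "square_integrable f" "square_integrable g"
  shows "square_integrable (\<lambda>x. f x + g x)"
proof -
  have "integrable unit_lborel (\<lambda>x. (f x)\<^sup>2 + (g x)\<^sup>2 + 2 * (f x * g x))"
    using assms square_integrable_mult[OF assms]
    by (intro Bochner_Integration.integrable_add integrable_mult_right)
      (auto simp: square_integrable_def)
  then show ?thesis
    using assms by (auto simp: square_integrable_def power2_sum mult.assoc)
qed

lemma square_integrable_scale:
  assumes "square_integrable f"
  shows "square_integrable (\<lambda>x. r * f x)"
  using assms by (auto simp: square_integrable_def power_mult_distrib)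

quotient_type L2 = "real \<Rightarrow> real" / partial: L2_rel
  morphisms rep_L2 abs_L2
proof (rule part_equivpI)
  show "\<exists>f. L2_rel f f"
    using square_integrable_zero by (auto simp: L2_rel_def)
  show "symp L2_rel"
    by (rule sympI) (auto simp: L2_rel_def)
  show "transp L2_rel"
  proof (rule transpI)
    fix f g h assume "L2_rel f g" "L2_rel g h"
    then show "L2_rel f h" by (auto simp: L2_rel_def elim!: AE_mp)
  qed
qed

instantiation L2 :: real_inner
begin

lift_definition zero_L2 :: L2 is "\<lambda>x. 0"
  by (simp add: L2_rel_def square_integrable_zero)

lift_definition plus_L2 :: "L2 \<Rightarrow> L2 \<Rightarrow> L2" is "\<lambda>f g x. f x + g x"
  by (auto simp: L2_rel_def square_integrable_add)

lift_definition scaleR_L2 :: "real \<Rightarrow> L2 \<Rightarrow> L2" is "\<lambda>r f x. r * f x"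
  by (auto simp: L2_rel_def square_integrable_scale)

lift_definition inner_L2 :: "L2 \<Rightarrow> L2 \<Rightarrow> real" is
  "\<lambda>f g. LINT x:{0..1}|lborel. f x * g x"
proof -
  fix f f' g g' assume "L2_rel f f'" "L2_rel g g'"
  then have "AE x in unit_lborel. f x * g x = f' x * g' x"
    and "(\<lambda>x. f x * g x) \<in> borel_measurable unit_lborel"
    and "(\<lambda>x. f' x * g' x) \<in> borel_measurable unit_lborel"
    by (auto simp: L2_rel_def square_integrable_def)
  then have "(LINT x|unit_lborel. f x * g x) = (LINT x|unit_lborel. f' x * g' x)"
    by (intro integral_cong_AE)
  then show "(LINT x:{0..1}|lborel. f x * g x) = (LINT x:{0..1}|lborel. f' x * g' x)"
    by (simp add: integral_restrict_space set_lebesgue_integral_def)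
qed

definition "uminus X = (-1) *\<^sub>R X" for X :: L2
definition "X - Y = X + (-1) *\<^sub>R Y" for X Y :: L2
definition "norm X = sqrt (inner X X)" for X :: L2
definition "sgn X = inverse (norm X) *\<^sub>R X" for X :: L2
definition "dist X Y = norm (X - Y)" for X Y :: L2
definition "uniformity = (INF e\<in>{0<..}. principal {(X, Y :: L2). dist X Y < e})"
definition "open U = (\<forall>X\<in>U. eventually (\<lambda>(X', Y). X' = X \<longrightarrow> Y \<in> U) uniformity)"
  for U :: "L2 set"

instance
proof
  fix X Y Z :: L2 and r s :: real
  show "X + Y + Z = X + (Y + Z)"
    by transfer (simp add: L2_rel_def square_integrable_add add.assoc)
  show "X + Y = Y + X"
    by transfer (simp add: L2_rel_def square_integrable_add add.commute)
  show "0 + X = X"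
    by transfer (simp add: L2_rel_def)
  show "- X + X = 0"
    unfolding uminus_L2_def
    by transfer (simp add: L2_rel_def square_integrable_zero)
  show "X - Y = X + - Y"
    by (simp add: uminus_L2_def minus_L2_def)
  show "r *\<^sub>R (X + Y) = r *\<^sub>R X + r *\<^sub>R Y"
    by transfer (auto simp: L2_rel_def distrib_left
        intro!: square_integrable_add square_integrable_scale)
  show "(r + s) *\<^sub>R X = r *\<^sub>R X + s *\<^sub>R X"
    by transfer (auto simp: L2_rel_def distrib_right
        intro!: square_integrable_add square_integrable_scale)
  show "r *\<^sub>R s *\<^sub>R X = (r * s) *\<^sub>R X"
    by transfer (simp add: L2_rel_def mult.assoc square_integrable_scale)
  show "1 *\<^sub>R X = X"
    by transfer (simp add: L2_rel_def)
  show "dist X Y = norm (X - Y)" by (rule dist_L2_def)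
  show "sgn X = inverse (norm X) *\<^sub>R X" by (rule sgn_L2_def)
  show "norm X = sqrt (inner X X)" by (rule norm_L2_def)
  show "uniformity = (INF e\<in>{0<..}. principal {(X, Y :: L2). dist X Y < e})"
    by (rule uniformity_L2_def)
  show "open U = (\<forall>X\<in>U. eventually (\<lambda>(X', Y). X' = X \<longrightarrow> Y \<in> U) uniformity)"
    for U :: "L2 set"
    by (rule open_L2_def)
  show "inner X Y = inner Y X"
    by transfer (simp add: mult.commute)
  show "inner (X + Y) Z = inner X Z + inner Y Z"
  proof transfer
    fix f g h assume "L2_rel f f" "L2_rel g g" "L2_rel h h"
    then have *: "integrable unit_lborel (\<lambda>x. f x * h x)" "integrable unit_lborel (\<lambda>x. g x * h x)"
      by (auto simp: L2_rel_def intro: square_integrable_mult)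
    have "(LINT x|unit_lborel. (f x + g x) * h x) =
        (LINT x|unit_lborel. f x * h x) + (LINT x|unit_lborel. g x * h x)"
      using * by (simp add: distrib_right)
    then show "(LINT x:{0..1}|lborel. (f x + g x) * h x) =
        (LINT x:{0..1}|lborel. f x * h x) + (LINT x:{0..1}|lborel. g x * h x)"
      by (simp add: integral_restrict_space set_lebesgue_integral_def)
  qed
  show "inner (r *\<^sub>R X) Y = r * inner X Y"
    by transfer (simp add: mult.assoc)
  show "0 \<le> inner X X"
    by transfer (auto simp: set_lebesgue_integral_def intro!: integral_nonneg_AE)
  show "inner X X = 0 \<longleftrightarrow> X = 0"
  proof transfer
    fix f assume "L2_rel f f"
    then have f: "square_integrable f" by (simp add: L2_rel_def)
    have "(LINT x:{0..1}|lborel. f x * f x) = (LINT x|unit_lborel. (f x)\<^sup>2)"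
      by (simp add: integral_restrict_space set_lebesgue_integral_def power2_eq_square)
    also have "\<dots> = 0 \<longleftrightarrow> (AE x in unit_lborel. (f x)\<^sup>2 = 0)"
      using f by (intro integral_nonneg_eq_0_iff_AE) (auto simp: square_integrable_def)
    also have "\<dots> \<longleftrightarrow> L2_rel f (\<lambda>x. 0)"
      using f square_integrable_zero by (simp add: L2_rel_def)
    finally show "(LINT x:{0..1}|lborel. f x * f x) = 0 \<longleftrightarrow> L2_rel f (\<lambda>x. 0)" .
  qed
qed

end

section \<open>The Riemannian manifold\<close>

text \<open>
  \<open>rep_L2 q\<close> is some representative of the class \<open>q\<close> and \<open>abs_L2 f\<close> is the class of \<open>f\<close>,
  meaningful for square integrable \<open>f\<close>.  All quantities below are independent of the choice of
  representatives.
\<close>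

definition eta :: "L2 \<Rightarrow> real \<Rightarrow> real" where
  "eta q x = exp (LINT u:{0..x}|lborel. rep_L2 q u)"

definition phi :: "L2 \<Rightarrow> real \<Rightarrow> real" where
  "phi q x = (LINT y:{0..x}|lborel. eta q y)"

definition phi_inv :: "L2 \<Rightarrow> real \<Rightarrow> real" where
  "phi_inv q = the_inv_into {0..1} (phi q)"

definition Q :: "L2 set" where
  "Q = {q. (LINT x:{0..1}|lborel. rep_L2 q x) = 0 \<and> (LINT x:{0..1}|lborel. eta q x) = 1}"

definition tangent_Q :: "L2 \<Rightarrow> L2 set" where
  "tangent_Q q = {X. (LINT x:{0..1}|lborel. rep_L2 X x) = 0 \<and>
                     (LINT x:{0..1}|lborel. rep_L2 X x * phi q x) = 0}"

definition cotangent_Q :: "L2 \<Rightarrow> L2 set" where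
  "cotangent_Q q = {p. (LINT x:{0..1}|lborel. rep_L2 p x * eta q x) = 0 \<and>
                       (LINT x:{0..1}|lborel. rep_L2 p x * phi q x * eta q x) = 0}"

definition metric_G :: "L2 \<Rightarrow> L2 \<Rightarrow> L2 \<Rightarrow> real" where
  "metric_G q X Y = (LINT x:{0..1}|lborel. rep_L2 X x * rep_L2 Y x / eta q x)"

definition momentum :: "L2 \<Rightarrow> L2 \<Rightarrow> L2" where
  "momentum q X = abs_L2 (\<lambda>x. rep_L2 X x / eta q x)"

definition velocity :: "L2 \<Rightarrow> L2 \<Rightarrow> L2" where
  "velocity q p = abs_L2 (\<lambda>x. eta q x * rep_L2 p x)"

section \<open>Geodesics\<close>

definition C2_curve_on :: "real \<Rightarrow> real \<Rightarrow> (real \<Rightarrow> 'a::real_normed_vector) \<Rightarrow> bool" where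
  "C2_curve_on t0 t1 \<gamma> \<longleftrightarrow> (\<exists>\<gamma>' \<gamma>''.
     (\<forall>t\<in>{t0..t1}. (\<gamma> has_vector_derivative \<gamma>' t) (at t within {t0..t1})) \<and>
     (\<forall>t\<in>{t0..t1}. (\<gamma>' has_vector_derivative \<gamma>'' t) (at t within {t0..t1})) \<and>
     continuous_on {t0..t1} \<gamma>'')"

definition energy :: "real \<Rightarrow> real \<Rightarrow> (real \<Rightarrow> L2) \<Rightarrow> real" where
  "energy t0 t1 \<gamma> = 1/2 * (LINT t:{t0..t1}|lborel.
     metric_G (\<gamma> t) (vector_derivative \<gamma> (at t within {t0..t1}))
                     (vector_derivative \<gamma> (at t within {t0..t1})))"

text \<open>
  A variation \<open>c s t\<close> of a curve inside \<open>S\<close> with fixed end points; it is required to be regular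
  enough (continuous first and mixed second partial derivatives) to admit a first variation
  of the energy.
\<close>

definition proper_variation ::
    "'a::real_normed_vector set \<Rightarrow> real \<Rightarrow> real \<Rightarrow> (real \<Rightarrow> 'a) \<Rightarrow> (real \<Rightarrow> real \<Rightarrow> 'a) \<Rightarrow> bool" where
  "proper_variation S t0 t1 \<gamma> c \<longleftrightarrow>
     (\<forall>t\<in>{t0..t1}. c 0 t = \<gamma> t) \<and>
     (\<exists>\<delta>>0.
        (\<forall>s\<in>{-\<delta><..<\<delta>}. c s t0 = \<gamma> t0 \<and> c s t1 = \<gamma> t1) \<and>
        (\<forall>s\<in>{-\<delta><..<\<delta>}. \<forall>t\<in>{t0..t1}. c s t \<in> S) \<and>
        (\<exists>cs ct cst.
           (\<forall>s\<in>{-\<delta><..<\<delta>}. \<forall>t\<in>{t0..t1}.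
              ((\<lambda>s. c s t) has_vector_derivative cs s t) (at s) \<and>
              ((\<lambda>t. c s t) has_vector_derivative ct s t) (at t within {t0..t1}) \<and>
              ((\<lambda>s. ct s t) has_vector_derivative cst s t) (at s) \<and>
              ((\<lambda>t. cs s t) has_vector_derivative cst s t) (at t within {t0..t1})) \<and>
           continuous_on ({-\<delta><..<\<delta>} \<times> {t0..t1}) (\<lambda>(s, t). cs s t) \<and>
           continuous_on ({-\<delta><..<\<delta>} \<times> {t0..t1}) (\<lambda>(s, t). ct s t) \<and>
           continuous_on ({-\<delta><..<\<delta>} \<times> {t0..t1}) (\<lambda>(s, t). cst s t)))"

definition geodesic_on :: "real \<Rightarrow> real \<Rightarrow> (real \<Rightarrow> L2) \<Rightarrow> bool" where
  "geodesic_on t0 t1 q \<longleftrightarrow>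
     C2_curve_on t0 t1 q \<and> (\<forall>t\<in>{t0..t1}. q t \<in> Q) \<and>
     (\<forall>c. proper_variation Q t0 t1 q c \<longrightarrow>
        ((\<lambda>s. energy t0 t1 (c s)) has_real_derivative 0) (at 0))"

section \<open>The Hamiltonian structure of the cotangent bundle\<close>

definition cotangent_bundle :: "(L2 \<times> L2) set" where
  "cotangent_bundle = {(q, p). q \<in> Q \<and> p \<in> cotangent_Q q}"

text \<open>
  The cotangent bundle is the subset of \<open>L2 \<times> L2\<close> cut out by the two equations of \<open>Q\<close> and the two
  equations of \<open>cotangent_Q\<close>; its tangent space is the kernel of their differentials (those
  of the equations of \<open>Q\<close> vanish precisely on \<open>tangent_Q\<close>).
\<close>

definition tangent_cotangent :: "L2 \<Rightarrow> L2 \<Rightarrow> (L2 \<times> L2) set" where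
  "tangent_cotangent q p = {(X, Y). X \<in> tangent_Q q \<and>
     ((\<lambda>s. LINT x:{0..1}|lborel.
         rep_L2 (p + s *\<^sub>R Y) x * eta (q + s *\<^sub>R X) x) has_real_derivative 0) (at 0) \<and>
     ((\<lambda>s. LINT x:{0..1}|lborel.
         rep_L2 (p + s *\<^sub>R Y) x * phi (q + s *\<^sub>R X) x * eta (q + s *\<^sub>R X) x)
       has_real_derivative 0) (at 0)}"

text \<open>
  The Hamiltonian is the kinetic energy of the velocity with momentum \<open>p\<close>.  As covectors act
  through the \<open>L2\<close> pairing, the canonical one-form is \<open>(X, Y) \<mapsto> p \<bullet> X\<close>, and the
  canonical symplectic form (minus its exterior derivative) is the one below.
\<close>

definition hamiltonian :: "L2 \<Rightarrow> L2 \<Rightarrow> real" where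
  "hamiltonian q p = 1/2 * metric_G q (velocity q p) (velocity q p)"

definition symplectic_form :: "L2 \<times> L2 \<Rightarrow> L2 \<times> L2 \<Rightarrow> real" where
  "symplectic_form V W = fst V \<bullet> snd W - fst W \<bullet> snd V"

definition is_hamiltonian_vector :: "L2 \<Rightarrow> L2 \<Rightarrow> L2 \<times> L2 \<Rightarrow> bool" where
  "is_hamiltonian_vector q p V \<longleftrightarrow>
     V \<in> tangent_cotangent q p \<and>
     (\<forall>W\<in>tangent_cotangent q p.
        ((\<lambda>s. hamiltonian (q + s *\<^sub>R fst W) (p + s *\<^sub>R snd W))
           has_real_derivative symplectic_form V W) (at 0))"

section \<open>The first-order system\<close>

definition H2 :: "real^2^2" where
  "H2 = vector [vector [1, 1/2], vector [1/2, 1/3]]"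

definition coeff_a :: "L2 \<Rightarrow> L2 \<Rightarrow> real" where
  "coeff_a q p = 1/2 * (LINT x:{0..1}|lborel. x * (rep_L2 p (phi_inv q x))\<^sup>2)"

definition coeff_b :: "L2 \<Rightarrow> L2 \<Rightarrow> real" where
  "coeff_b q p = 3/2 * (LINT x:{0..1}|lborel.
     (LINT y:{0..x}|lborel. rep_L2 p (phi_inv q y))\<^sup>2)"

definition coeff_c :: "L2 \<Rightarrow> L2 \<Rightarrow> real" where
  "coeff_c q p = 1/4 * (LINT x:{0..1}|lborel. x\<^sup>2 * (rep_L2 p (phi_inv q x))\<^sup>2)"

definition force :: "L2 \<Rightarrow> L2 \<Rightarrow> L2" where
  "force q p = abs_L2 (\<lambda>x.
     - 1/2 * (LINT y:{x..1}|lborel. eta q y * (rep_L2 p y)\<^sup>2) +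
     (vector [1, phi q x] :: real^2) \<bullet>
       (matrix_inv H2 *v vector [coeff_a q p, coeff_b q p + coeff_c q p]))"

definition solves_system_on :: "real \<Rightarrow> real \<Rightarrow> (real \<Rightarrow> L2) \<Rightarrow> (real \<Rightarrow> L2) \<Rightarrow> bool" where
  "solves_system_on t0 t1 q p \<longleftrightarrow>
     (\<forall>t\<in>{t0..t1}. (q t, p t) \<in> cotangent_bundle \<and>
        (q has_vector_derivative velocity (q t) (p t)) (at t within {t0..t1}) \<and>
        (p has_vector_derivative force (q t) (p t)) (at t within {t0..t1}))"

end

theory Submission
  imports Defs
begin

text \<open>
  Multiplication by a continuous function (\<open>act\<close>) and the primitive \<open>\<integral>\<^sub>0\<^sup>x X Y\<close> are bounded
  bilinear maps between \<open>L2\<close> and the Banach algebra of bounded continuous functions.  The maps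
  \<open>\<eta>\<close>, \<open>\<phi>\<close>, the metric and the force are built from them and \<open>exp\<close>, so they are differentiated by the
  product rule, and every integral identity follows from integration by parts for primitives.

  If \<open>(q, p)\<close> lies on the cotangent bundle, the force is \<open>-1/2 \<integral>\<^sub>x\<^sup>1 \<eta> p\<^sup>2\<close> corrected by the
  combination of the normal vectors \<open>1\<close>, \<open>\<phi>\<close> that makes (velocity, force) tangent to the bundle: the
  two tangency conditions are a linear system with matrix \<open>H2\<close> and right hand side \<open>(a, b + c)\<close>.
  For a variation field \<open>X\<close>, tangent to \<open>Q\<close>, the first variation of the energy is
  \<open>\<integral> \<langle>X, force - p'\<rangle> dt\<close>.  Conversely \<open>Y = p' - force\<close> satisfies the equations of the cotangent space,
  so \<open>X = \<eta> Y\<close> is tangent to \<open>Q\<close> and \<open>\<langle>X, Y\<rangle> = \<integral> \<eta> Y\<^sup>2\<close>.  Since \<open>q = \<eta>'/\<eta>\<close> identifies \<open>Q\<close> with an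
  open subset of an affine space of functions \<open>\<eta>\<close>, this \<open>X\<close> is realised at any given time by an affine
  perturbation of \<open>\<eta>\<close>, and stationarity forces \<open>Y = 0\<close>.
\<close>

subsection \<open>The chain rule for primitives of integrable functions\<close>

text \<open>A class in \<open>L2\<close> is only square integrable, so no pointwise derivative is at
  hand; the calculus is therefore that of primitives, and a product of two classes enters only
  through its primitive. The right hand side (a, b + c) has this origin. Pairing -1/2 of the
  integral of \<eta> p^2 over [x, 1] with \<eta> and with \<phi> \<eta> gives -a and -c, the motion
  of the second constraint along the velocity gives -b, and \<open>H2\<close> is the Gram matrix of
  1 and \<phi> for the weight \<eta>, that is, of 1 and y on [0, 1] after y = \<phi>(x). The other
  obstacle is that \<open>Q\<close> is curved: adding a multiple of a tangent vector to q leaves it.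
  In terms of \<eta> the equations are affine, namely \<eta>(0) = \<eta>(1) = 1 and mean 1, so s
  f(t) h may be added to \<eta> when h vanishes at 0 and 1 and has mean 0, as long as the sum stays
  positive. The direction h is frozen in time and matches the wanted tangent vector at one instant
  only; that is enough, since the fundamental lemma of the calculus of variations concludes at each
  instant.\<close>

lemma quadratic_increment_imp_constant:
  fixes D n :: "real \<Rightarrow> real"
  assumes cont: "continuous_on {0..1} n"
    and incr: "\<And>u v. 0 \<le> u \<Longrightarrow> u \<le> v \<Longrightarrow> v \<le> 1 \<Longrightarrow> \<bar>D v - D u\<bar> \<le> C * (n v - n u)\<^sup>2"
    and mono: "\<And>u v. 0 \<le> u \<Longrightarrow> u \<le> v \<Longrightarrow> v \<le> 1 \<Longrightarrow> n u \<le> n v"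
    and C: "0 \<le> C" and x: "x \<in> {0..1}"
  shows "D x = D 0"
proof -
  \<comment> \<open>On a partition so fine that \<open>n\<close> grows by at most \<open>e\<close>
    per cell, each squared increment is at most \<open>e\<close> times the increment, and the
    increments of \<open>n\<close> telescope.\<close>
  have "\<bar>D x - D 0\<bar> \<le> e * (C * (n x - n 0))" if e: "e > 0" for e
  proof -
    have "uniformly_continuous_on {0..1} n"
      using cont by (intro compact_uniformly_continuous) auto
    then obtain d where d: "d > 0"
      "\<And>u v. u \<in> {0..1} \<Longrightarrow> v \<in> {0..1} \<Longrightarrow> dist v u < d \<Longrightarrow> dist (n v) (n u) < e"
      unfolding uniformly_continuous_on_def using e by blast
    obtain N :: nat where N: "1 / real (Suc N) < d"
      using d(1) nat_approx_posE by blast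
    define y where "y i = x * (real i / real (Suc N))" for i
    have y01: "0 \<le> y i" "y i \<le> 1" "y i \<le> y (Suc i)" "y (Suc i) - y i < d" if "i \<le> Suc N" for i
    proof -
      have "real i / real (Suc N) \<le> 1" using that by simp
      then show "0 \<le> y i" "y i \<le> 1"
        using x mult_le_one[of x "real i / real (Suc N)"] unfolding y_def by auto
      show "y i \<le> y (Suc i)" using x unfolding y_def by (intro mult_left_mono divide_right_mono) auto
      have "y (Suc i) - y i = x * (1 / real (Suc N))"
        unfolding y_def by (simp add: add_divide_distrib distrib_left)
      also have "\<dots> \<le> 1 * (1 / real (Suc N))" using x by (intro mult_right_mono) auto
      finally show "y (Suc i) - y i < d" using N by linarith
    qed
    have "\<bar>D (y i) - D 0\<bar> \<le> e * (C * (n (y i) - n 0))" if "i \<le> Suc N" for i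
      using that
    proof (induction i)
      case 0
      then show ?case by (simp add: y_def)
    next
      case (Suc i)
      have i: "i \<le> Suc N" using Suc by simp
      note a = y01[OF i] y01[OF Suc.prems]
      have 1: "n (y i) \<le> n (y (Suc i))" using a by (intro mono) auto
      have "dist (n (y (Suc i))) (n (y i)) < e"
        using a by (intro d(2)) (auto simp: dist_real_def)
      then have 2: "n (y (Suc i)) - n (y i) \<le> e" using 1 by (simp add: dist_real_def)
      have "\<bar>D (y (Suc i)) - D (y i)\<bar> \<le> C * (n (y (Suc i)) - n (y i))\<^sup>2"
        using a by (intro incr) auto
      also have "\<dots> \<le> C * (e * (n (y (Suc i)) - n (y i)))"
        unfolding power2_eq_square using 1 2 C by (intro mult_left_mono mult_right_mono) auto
      finally have "\<bar>D (y (Suc i)) - D (y i)\<bar> \<le> e * (C * (n (y (Suc i)) - n (y i)))"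
        by (simp add: mult_ac)
      then have "\<bar>D (y (Suc i)) - D 0\<bar> \<le> e * (C * (n (y (Suc i)) - n (y i))) + e * (C * (n (y i) - n 0))"
        using Suc.IH i by linarith
      then show ?case by (simp add: algebra_simps)
    qed
    from this[of "Suc N"] show ?thesis by (simp add: y_def)
  qed
  note * = this
  define c where "c = C * (n x - n 0)"
  have c: "0 \<le> c" unfolding c_def using x C by (intro mult_nonneg_nonneg) (auto intro: mono)
  have "\<bar>D x - D 0\<bar> \<le> 0 + e" if "e > 0" for e
  proof -
    \<comment> \<open>Dividing by \<open>c + 1\<close> instead of \<open>c\<close> covers the case
      \<open>c = 0\<close>.\<close>
    have "\<bar>D x - D 0\<bar> \<le> (e / (c + 1)) * c"
      using *[of "e / (c + 1)"] that c unfolding c_def by auto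
    also have "\<dots> \<le> e" using that c by (simp add: field_simps)
    finally show ?thesis by simp
  qed
  then have "\<bar>D x - D 0\<bar> \<le> 0" by (rule field_le_epsilon)
  then show ?thesis by simp
qed

lemma set_integrable_continuous_mult:
  fixes f h :: "real \<Rightarrow> real"
  assumes h: "continuous_on {a..b} h" and f: "set_integrable lborel {a..b} f"
  shows "set_integrable lborel {a..b} (\<lambda>x. h x * f x)"
proof -
  have "bounded (h ` {a..b})"
    using h by (intro compact_imp_bounded compact_continuous_image) auto
  then obtain B where B: "\<And>x. x \<in> {a..b} \<Longrightarrow> norm (h x) \<le> B"
    unfolding bounded_iff by force
  have m: "(\<lambda>x. indicator {a..b} x *\<^sub>R h x) \<in> borel_measurable lborel"
    using borel_measurable_continuous_on_indicator[OF _ h] by simp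
  have "integrable lborel (\<lambda>x. (indicator {a..b} x *\<^sub>R h x) * (indicator {a..b} x *\<^sub>R f x))"
  proof (rule Bochner_Integration.integrable_bound)
    show "integrable lborel (\<lambda>x. B * (indicator {a..b} x *\<^sub>R f x))"
      using f unfolding set_integrable_def by simp
    show "(\<lambda>x. (indicator {a..b} x *\<^sub>R h x) * (indicator {a..b} x *\<^sub>R f x)) \<in> borel_measurable lborel"
      using m f unfolding set_integrable_def
      by (intro borel_measurable_times) (auto dest: borel_measurable_integrable)
    have "norm (indicator {a..b} x *\<^sub>R h x * indicator {a..b} x *\<^sub>R f x)
        \<le> norm (B * indicator {a..b} x *\<^sub>R f x)" for x
      using B[of x] by (auto simp: abs_mult indicator_def intro!: mult_right_mono)
    then show "AE x in lborel. norm (indicator {a..b} x *\<^sub>R h x * indicator {a..b} x *\<^sub>R f x)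
        \<le> norm (B * indicator {a..b} x *\<^sub>R f x)" by simp
  qed
  moreover have "(\<lambda>x. (indicator {a..b} x *\<^sub>R h x) * (indicator {a..b} x *\<^sub>R f x)) =
    (\<lambda>x. indicator {a..b} x *\<^sub>R (h x * f x))" by (auto simp: indicator_def)
  ultimately show ?thesis unfolding set_integrable_def by simp
qed

text \<open>As \<open>f\<close> is only integrable, the fundamental theorem of calculus is not available; instead
  the difference of the two sides has increments quadratic in those of \<open>\<integral>\<bar>f\<bar>\<close>, hence is constant.\<close>

lemma chain_rule_primitive:
  fixes f \<Phi> :: "real \<Rightarrow> real"
  assumes f: "set_integrable lborel {0..1} f"
    and d1: "\<And>y. (\<Phi> has_real_derivative \<Phi>' y) (at y)"
    and d2: "\<And>y. (\<Phi>' has_real_derivative \<Phi>'' y) (at y)"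
    and c2: "continuous_on UNIV \<Phi>''"
    and x: "x \<in> {0..1}"
  defines "F \<equiv> \<lambda>x. integral {0..x} f"
  shows "\<Phi> (F x) - \<Phi> 0 = integral {0..x} (\<lambda>u. \<Phi>' (F u) * f u)"
proof -
  define n where "n x = integral {0..x} (\<lambda>u. \<bar>f u\<bar>)" for x
  have fi: "f integrable_on {0..1}"
    using f by (rule set_borel_integral_eq_integral)
  have fai: "(\<lambda>u. \<bar>f u\<bar>) integrable_on {0..1}"
    using set_integrable_abs[OF f] by (rule set_borel_integral_eq_integral)
  have Fc: "continuous_on {0..1} F" unfolding F_def by (rule indefinite_integral_continuous_1[OF fi])
  have nc: "continuous_on {0..1} n" unfolding n_def by (rule indefinite_integral_continuous_1[OF fai])
  have c1: "continuous_on UNIV \<Phi>'"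
    using d2 by (intro DERIV_continuous_on) (auto intro: has_field_derivative_at_within)
  have dc: "continuous_on {0..1} (\<lambda>u. \<Phi>' (F u))"
    by (rule continuous_on_compose2[OF c1 Fc]) auto
  define g where "g = (\<lambda>u. \<Phi>' (F u) * f u)"
  have gi: "g integrable_on {0..1}"
    unfolding g_def using set_integrable_continuous_mult[OF dc f] by (rule set_borel_integral_eq_integral)
  have sub: "h integrable_on {u..v}" if "h integrable_on {0..1}" "0 \<le> u" "v \<le> 1"
    for h :: "real \<Rightarrow> real" and u v
    using integrable_on_subinterval[OF that(1)] that by auto
  have diff: "integral {0..v} h - integral {0..u} h = integral {u..v} h"
    if "h integrable_on {0..1}" "0 \<le> u" "u \<le> v" "v \<le> 1" for h :: "real \<Rightarrow> real" and u v
    using Henstock_Kurzweil_Integration.integral_combine[of 0 u v h] sub[OF that(1), of 0 v] that by auto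
  have nm: "\<bar>F v - F u\<bar> \<le> n v - n u" if "0 \<le> u" "u \<le> v" "v \<le> 1" for u v
  proof -
    have "norm (integral {u..v} f) \<le> integral {u..v} (\<lambda>x. \<bar>f x\<bar>)"
      using sub[OF fi that(1,3)] sub[OF fai that(1,3)] by (intro integral_norm_bound_integral) auto
    then show ?thesis unfolding F_def n_def using diff[OF fi that] diff[OF fai that] by simp
  qed
  have mono: "n u \<le> n v" if "0 \<le> u" "u \<le> v" "v \<le> 1" for u v
    using nm[OF that] by linarith
  have "bounded (F ` {0..1})"
    using Fc by (intro compact_imp_bounded compact_continuous_image) auto
  then obtain B where B: "\<And>x. x \<in> {0..1} \<Longrightarrow> \<bar>F x\<bar> \<le> B"
    unfolding bounded_iff by force
  have "bounded (\<Phi>'' ` {-B..B})"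
    using c2 by (intro compact_imp_bounded compact_continuous_image) (auto intro: continuous_on_subset)
  then obtain M where M: "\<And>x. x \<in> {-B..B} \<Longrightarrow> \<bar>\<Phi>'' x\<bar> \<le> M"
    unfolding bounded_iff by force
  have "0 \<le> B" using B[of 0] by auto
  then have M0: "0 \<le> M" using M[of 0] by auto
  have lip: "\<bar>\<Phi>' y - \<Phi>' z\<bar> \<le> M * \<bar>y - z\<bar>" if "y \<in> {-B..B}" "z \<in> {-B..B}" for y z
  proof -
    have "norm (\<Phi>' y - \<Phi>' z) \<le> M * norm (y - z)"
      by (rule field_differentiable_bound[of "{-B..B}" \<Phi>' \<Phi>''])
        (use that M d2 in \<open>auto intro: has_field_derivative_at_within\<close>)
    then show ?thesis by simp
  qed
  have quad: "\<bar>\<Phi> y - \<Phi> z - \<Phi>' z * (y - z)\<bar> \<le> M * (y - z)\<^sup>2" if y: "y \<in> {-B..B}" and z: "z \<in> {-B..B}" for y z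
  proof -
    \<comment> \<open>Mean value inequality for \<Phi> minus its linear part at \<open>z\<close>:
      the derivative of this difference is at most \<open>M * \<bar>y - z\<bar>\<close> on the
      segment.\<close>
    have "norm (\<Phi> y - \<Phi>' z * y - (\<Phi> z - \<Phi>' z * z)) \<le> (M * \<bar>y - z\<bar>) * norm (y - z)"
    proof (rule field_differentiable_bound[of "closed_segment z y" "\<lambda>w. \<Phi> w - \<Phi>' z * w" "\<lambda>w. \<Phi>' w - \<Phi>' z"])
      fix w assume w: "w \<in> closed_segment z y"
      show "((\<lambda>w. \<Phi> w - \<Phi>' z * w) has_field_derivative \<Phi>' w - \<Phi>' z) (at w within closed_segment z y)"
        by (auto intro!: derivative_eq_intros has_field_derivative_at_within[OF d1])
      have wB: "w \<in> {-B..B}" and wz: "\<bar>w - z\<bar> \<le> \<bar>y - z\<bar>"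
        using w y z by (auto simp: closed_segment_eq_real_ivl split: if_splits)
      have "\<bar>\<Phi>' w - \<Phi>' z\<bar> \<le> M * \<bar>w - z\<bar>" by (rule lip[OF wB z])
      also have "\<dots> \<le> M * \<bar>y - z\<bar>" using M0 wz by (intro mult_left_mono) auto
      finally show "norm (\<Phi>' w - \<Phi>' z) \<le> M * \<bar>y - z\<bar>" by simp
    qed auto
    moreover have "\<Phi> y - \<Phi>' z * y - (\<Phi> z - \<Phi>' z * z) = \<Phi> y - \<Phi> z - \<Phi>' z * (y - z)"
      by (simp add: algebra_simps)
    moreover have "(M * \<bar>y - z\<bar>) * norm (y - z) = M * (y - z)\<^sup>2"
      by (simp add: power2_eq_square mult.assoc flip: abs_mult)
    ultimately show ?thesis by (metis real_norm_def)
  qed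
  define D where "D x = \<Phi> (F x) - integral {0..x} g" for x
  have "D x = D 0"
  \<comment> \<open>One \<open>M\<close> bounds the Taylor remainder of \<Phi>, the other the error
    of freezing \<open>\<Phi>' (F w)\<close> at \<open>w = u\<close> under the integral.\<close>
  proof (rule quadratic_increment_imp_constant[where n = n and C = "2 * M"])
    show "continuous_on {0..1} n" by fact
    show "n u \<le> n v" if "0 \<le> u" "u \<le> v" "v \<le> 1" for u v by (rule mono[OF that])
    show "0 \<le> 2 * M" using M0 by simp
    show "x \<in> {0..1}" by fact
    fix u v :: real assume uv: "0 \<le> u" "u \<le> v" "v \<le> 1"
    have FB: "F w \<in> {-B..B}" if "u \<le> w" "w \<le> v" for w using B[of w] that uv by auto
    have "\<bar>\<Phi> (F v) - \<Phi> (F u) - \<Phi>' (F u) * (F v - F u)\<bar> \<le> M * (F v - F u)\<^sup>2"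
      using uv by (intro quad FB) auto
    also have "\<dots> \<le> M * (n v - n u)\<^sup>2"
      using nm[OF uv] M0 by (intro mult_left_mono abs_le_square_iff[THEN iffD1]) auto
    finally have 1: "\<bar>\<Phi> (F v) - \<Phi> (F u) - \<Phi>' (F u) * (F v - F u)\<bar> \<le> M * (n v - n u)\<^sup>2" .
    have fuv: "f integrable_on {u..v}" and fauv: "(\<lambda>x. \<bar>f x\<bar>) integrable_on {u..v}" and guv: "g integrable_on {u..v}"
      using sub fi fai gi uv by auto
    have "integral {u..v} g - \<Phi>' (F u) * (F v - F u) = integral {u..v} (\<lambda>w. g w - \<Phi>' (F u) * f w)"
      using diff[OF fi uv] fuv guv unfolding F_def
      by (simp add: Henstock_Kurzweil_Integration.integral_diff integrable_on_mult_right)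
    also have "norm \<dots> \<le> integral {u..v} (\<lambda>w. M * (n v - n u) * \<bar>f w\<bar>)"
    proof (rule integral_norm_bound_integral)
      show "(\<lambda>w. g w - \<Phi>' (F u) * f w) integrable_on {u..v}"
        using fuv guv by (intro integrable_diff integrable_on_mult_right)
      show "(\<lambda>w. M * (n v - n u) * \<bar>f w\<bar>) integrable_on {u..v}"
        using fauv by (intro integrable_on_mult_right)
      fix w assume w: "w \<in> {u..v}"
      have "\<bar>\<Phi>' (F w) - \<Phi>' (F u)\<bar> \<le> M * \<bar>F w - F u\<bar>"
        using w uv by (intro lip FB) auto
      also have "\<dots> \<le> M * (n v - n u)"
        using nm[of u w] mono[of w v] w uv M0 by (intro mult_left_mono) auto
      finally have "\<bar>\<Phi>' (F w) - \<Phi>' (F u)\<bar> * \<bar>f w\<bar> \<le> M * (n v - n u) * \<bar>f w\<bar>"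
        by (intro mult_right_mono) auto
      then show "norm (g w - \<Phi>' (F u) * f w) \<le> M * (n v - n u) * \<bar>f w\<bar>"
        unfolding g_def by (simp add: abs_mult flip: left_diff_distrib)
    qed
    also have "\<dots> = M * (n v - n u)\<^sup>2"
      using diff[OF fai uv] unfolding n_def by (simp add: power2_eq_square)
    finally have 2: "\<bar>integral {u..v} g - \<Phi>' (F u) * (F v - F u)\<bar> \<le> M * (n v - n u)\<^sup>2" by simp
    have "D v - D u = (\<Phi> (F v) - \<Phi> (F u) - \<Phi>' (F u) * (F v - F u)) - (integral {u..v} g - \<Phi>' (F u) * (F v - F u))"
      unfolding D_def using diff[OF gi uv] by simp
    then show "\<bar>D v - D u\<bar> \<le> 2 * M * (n v - n u)\<^sup>2" using 1 2 by linarith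
  qed
  then show ?thesis unfolding D_def g_def by (simp add: F_def)
qed

subsection \<open>The Banach algebra of bounded continuous functions\<close>

text \<open>Completeness and the algebra structure below make \<open>exp\<close> available on this
  type, as a power series in the sup norm.\<close>

instance bcontfun :: (metric_space, banach) banach ..

instantiation bcontfun :: (topological_space, real_normed_field) "{comm_ring_1, real_normed_algebra_1}"
begin

definition one_bcontfun :: "'a \<Rightarrow>\<^sub>C 'b" where "one_bcontfun = const_bcontfun 1"

definition times_bcontfun :: "('a \<Rightarrow>\<^sub>C 'b) \<Rightarrow> ('a \<Rightarrow>\<^sub>C 'b) \<Rightarrow> 'a \<Rightarrow>\<^sub>C 'b" where
  "times_bcontfun f g = Bcontfun (\<lambda>x. apply_bcontfun f x * apply_bcontfun g x)"

lemma apply_one_bcontfun [simp]: "apply_bcontfun (1 :: 'a \<Rightarrow>\<^sub>C 'b) x = 1"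
  by (simp add: one_bcontfun_def)

lemma apply_times_bcontfun [simp]:
  "apply_bcontfun (f * g :: 'a \<Rightarrow>\<^sub>C 'b) x = apply_bcontfun f x * apply_bcontfun g x"
proof -
  have "(\<lambda>x. apply_bcontfun f x * apply_bcontfun g x) \<in> bcontfun"
    by (rule bcontfun_normI[where b = "norm f * norm g"])
      (auto intro!: continuous_intros mult_mono norm_bounded simp: norm_mult)
  then show ?thesis by (simp add: times_bcontfun_def Bcontfun_inverse)
qed

instance
proof
  fix f g h :: "'a \<Rightarrow>\<^sub>C 'b" and r :: real
  show "norm (f * g) \<le> norm f * norm g"
    by (rule norm_bound) (auto intro!: mult_mono norm_bounded simp: norm_mult)
  show "norm (1 :: 'a \<Rightarrow>\<^sub>C 'b) = 1"
  proof (rule antisym)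
    show "norm (1 :: 'a \<Rightarrow>\<^sub>C 'b) \<le> 1" by (rule norm_bound) simp
    show "1 \<le> norm (1 :: 'a \<Rightarrow>\<^sub>C 'b)"
      using norm_bounded[of "1 :: 'a \<Rightarrow>\<^sub>C 'b" undefined] by simp
  qed
  have "apply_bcontfun (0 :: 'a \<Rightarrow>\<^sub>C 'b) undefined \<noteq> apply_bcontfun 1 undefined" by simp
  then show "(0 :: 'a \<Rightarrow>\<^sub>C 'b) \<noteq> 1" by metis
qed (auto intro!: bcontfun_eqI simp: algebra_simps)

end

lemma apply_power_bcontfun [simp]:
  fixes f :: "'a::topological_space \<Rightarrow>\<^sub>C 'b::real_normed_field"
  shows "apply_bcontfun (f ^ n) x = apply_bcontfun f x ^ n"
  by (induction n) auto

lemma bounded_linear_apply_bcontfun: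
  "bounded_linear (\<lambda>f :: 'a::topological_space \<Rightarrow>\<^sub>C 'b::real_normed_vector. apply_bcontfun f x)"
  by (rule bounded_linear_intro[where K = 1]) (auto intro: norm_bounded)

text \<open>Evaluation at a point is bounded and linear, so it commutes with the exponential
  series.\<close>

lemma apply_exp_bcontfun [simp]:
  fixes f :: "'a::metric_space \<Rightarrow>\<^sub>C real"
  shows "apply_bcontfun (exp f) x = exp (apply_bcontfun f x)"
proof -
  have "apply_bcontfun (\<Sum>n. f ^ n /\<^sub>R fact n) x = (\<Sum>n. apply_bcontfun (f ^ n /\<^sub>R fact n) x)"
    by (intro bounded_linear.suminf[OF bounded_linear_apply_bcontfun] summable_exp_generic)
  then show ?thesis by (simp add: exp_def)
qed

subsection \<open>Multiplication and primitives on \<open>L2\<close>\<close>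

lemma square_integrable_rep: "square_integrable (rep_L2 X)"
  using Quotient3_rep_reflp[OF Quotient3_L2] by (simp add: L2_rel_def)

lemma rep_abs_L2: "square_integrable f \<Longrightarrow> AE x in unit_lborel. rep_L2 (abs_L2 f) x = f x"
  using Quotient3_rep_abs[OF Quotient3_L2, of f] by (simp add: L2_rel_def)

lemma L2_eqI: "AE x in unit_lborel. rep_L2 X x = rep_L2 Y x \<Longrightarrow> X = Y"
  using Quotient3_rel_rep[OF Quotient3_L2, of X Y] by (simp add: L2_rel_def square_integrable_rep)

lemma abs_L2_cong:
  assumes "square_integrable f" "square_integrable g" "AE x in unit_lborel. f x = g x"
  shows "abs_L2 f = abs_L2 g"
  using Quotient3_rel[OF Quotient3_L2, of f g] assms by (simp add: L2_rel_def)

lemma rep_plus_L2: "AE x in unit_lborel. rep_L2 (X + Y) x = rep_L2 X x + rep_L2 Y x"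
  unfolding plus_L2_def by (simp add: rep_abs_L2 square_integrable_add square_integrable_rep)

lemma rep_scaleR_L2: "AE x in unit_lborel. rep_L2 (r *\<^sub>R X) x = r * rep_L2 X x"
  unfolding scaleR_L2_def by (simp add: rep_abs_L2 square_integrable_scale square_integrable_rep)

lemma inner_L2_eq: "inner X Y = (LINT x:{0..1}|lborel. rep_L2 X x * rep_L2 Y x)"
  by (simp add: inner_L2_def)

lemma measurable_bcontfun [measurable]: "apply_bcontfun f \<in> borel_measurable unit_lborel"
  for f :: "real \<Rightarrow>\<^sub>C real"
proof -
  have "apply_bcontfun f \<in> borel_measurable borel"
    by (rule borel_measurable_continuous_onI) simp
  then show ?thesis by (intro measurable_restrict_space1) simp
qed

lemma square_integrable_mult_bcontfun:
  fixes f :: "real \<Rightarrow>\<^sub>C real"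
  assumes "square_integrable g"
  shows "square_integrable (\<lambda>x. apply_bcontfun f x * g x)"
proof -
  have [measurable]: "g \<in> borel_measurable unit_lborel" and i: "integrable unit_lborel (\<lambda>x. (g x)\<^sup>2)"
    using assms by (auto simp: square_integrable_def)
  have "integrable unit_lborel (\<lambda>x. (apply_bcontfun f x * g x)\<^sup>2)"
  proof (rule Bochner_Integration.integrable_bound)
    show "integrable unit_lborel (\<lambda>x. (norm f)\<^sup>2 * (g x)\<^sup>2)" using i by simp
    have "(apply_bcontfun f x)\<^sup>2 \<le> (norm f)\<^sup>2" for x
      using norm_bounded[of f x] by (simp add: abs_le_square_iff[symmetric])
    then show "AE x in unit_lborel. norm ((apply_bcontfun f x * g x)\<^sup>2) \<le> norm ((norm f)\<^sup>2 * (g x)\<^sup>2)"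
      by (auto simp: power_mult_distrib abs_mult intro!: mult_right_mono)
  qed measurable
  then show ?thesis by (simp add: square_integrable_def)
qed

section \<open>Multiplication operators and the constant class\<close>

definition act :: "(real \<Rightarrow>\<^sub>C real) \<Rightarrow> L2 \<Rightarrow> L2" where
  "act f X = abs_L2 (\<lambda>x. apply_bcontfun f x * rep_L2 X x)"

lemma rep_act: "AE x in unit_lborel. rep_L2 (act f X) x = apply_bcontfun f x * rep_L2 X x"
  unfolding act_def by (intro rep_abs_L2 square_integrable_mult_bcontfun square_integrable_rep)

text \<open>This class lets two bilinear operations cover everything: \<open>act f one_L2\<close> is
  the class of a continuous function, and \<open>primitive X one_L2\<close> is the plain primitive
  of a class.\<close>

definition one_L2 :: L2 where "one_L2 = abs_L2 (\<lambda>x. 1)"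

lemma unit_lborel_const: "integrable unit_lborel (\<lambda>x. c :: real)"
  by (subst integrable_restrict_space) (auto simp: integrable_mult_left)

lemma square_integrable_bcontfun: "square_integrable (apply_bcontfun f)" for f :: "real \<Rightarrow>\<^sub>C real"
  using square_integrable_mult_bcontfun[of "\<lambda>x. 1" f]
  by (simp add: square_integrable_def unit_lborel_const)

lemma rep_one_L2: "AE x in unit_lborel. rep_L2 one_L2 x = 1"
  unfolding one_L2_def
  by (rule rep_abs_L2) (simp add: square_integrable_def unit_lborel_const)

lemma rep_act_one: "AE x in unit_lborel. rep_L2 (act f one_L2) x = apply_bcontfun f x"
  using rep_act[of f one_L2] rep_one_L2 by eventually_elim simp

text \<open>An indicator carries equality almost everywhere on the unit interval over to
  subintervals; this is how integrals become independent of the chosen representatives.\<close>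

lemma LINT_unit_cong:
  fixes f g :: "real \<Rightarrow> real"
  assumes "f \<in> borel_measurable unit_lborel" "g \<in> borel_measurable unit_lborel"
    "AE u in unit_lborel. f u = g u" "0 \<le> x" "y \<le> 1"
  shows "(LINT u:{x..y}|lborel. f u) = (LINT u:{x..y}|lborel. g u)"
proof -
  have *: "(LINT u:{x..y}|lborel. h u) = (LINT u|unit_lborel. indicator {x..y} u *\<^sub>R h u)"
    for h :: "real \<Rightarrow> real"
    using assms(4,5) unfolding set_lebesgue_integral_def
    by (subst integral_restrict_space) (auto intro!: Bochner_Integration.integral_cong simp: indicator_def)
  have m: "(indicator {x..y} :: real \<Rightarrow> real) \<in> borel_measurable unit_lborel"
    by (intro measurable_restrict_space1) simp
  show ?thesis unfolding *
    using assms m by (intro integral_cong_AE) auto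
qed

lemma rep_measurable [measurable]: "rep_L2 X \<in> borel_measurable unit_lborel"
  using square_integrable_rep by (simp add: square_integrable_def)

lemma unit_integrable_iff:
  fixes f :: "real \<Rightarrow> real"
  shows "integrable unit_lborel f \<longleftrightarrow> set_integrable lborel {0..1} f"
  unfolding set_integrable_def by (subst integrable_restrict_space) auto

lemma set_integrable_rep_mult: "set_integrable lborel {0..1} (\<lambda>u. rep_L2 X u * rep_L2 Y u)"
  using square_integrable_mult[OF square_integrable_rep square_integrable_rep]
  by (simp add: unit_integrable_iff)

lemma LINT_unit_integral:
  fixes f :: "real \<Rightarrow> real"
  assumes "set_integrable lborel {0..1} f" "0 \<le> x" "y \<le> 1"
  shows "(LINT u:{x..y}|lborel. f u) = integral {x..y} f"
  by (rule set_borel_integral_eq_integral(2), rule set_integrable_subset[OF assms(1)]) (use assms in auto)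

section \<open>Primitives of products of two classes\<close>

definition clip :: "real \<Rightarrow> real" where "clip x = max 0 (min 1 x)"

lemma clip_bounds [simp]: "0 \<le> clip x" "clip x \<le> 1"
  and clip_id: "x \<in> {0..1} \<Longrightarrow> clip x = x" and clip_clip [simp]: "clip (clip x) = clip x"
  by (auto simp: clip_def)

text \<open>A product of two classes is merely integrable and need not be a class again, so the
  primitive takes both factors. \<open>clip\<close> continues it constantly outside the unit
  interval, because the Banach algebra consists of functions on the whole line.\<close>

definition primitive :: "L2 \<Rightarrow> L2 \<Rightarrow> real \<Rightarrow>\<^sub>C real" where
  "primitive X Y = Bcontfun (\<lambda>x. LINT u:{0..clip x}|lborel. rep_L2 X u * rep_L2 Y u)"

lemma primitive_integral:
  "(LINT u:{0..clip x}|lborel. rep_L2 X u * rep_L2 Y u) = integral {0..clip x} (\<lambda>u. rep_L2 X u * rep_L2 Y u)"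
  by (intro LINT_unit_integral set_integrable_rep_mult) auto

lemma apply_primitive:
  "apply_bcontfun (primitive X Y) x = (LINT u:{0..clip x}|lborel. rep_L2 X u * rep_L2 Y u)"
proof -
  define F where "F x = integral {0..x} (\<lambda>u. rep_L2 X u * rep_L2 Y u)" for x
  have c: "continuous_on {0..1} F"
    unfolding F_def
    by (intro indefinite_integral_continuous_1 set_borel_integral_eq_integral(1) set_integrable_rep_mult)
  then have "bounded (F ` {0..1})" by (intro compact_imp_bounded compact_continuous_image) auto
  then obtain B where B: "\<And>x. x \<in> {0..1} \<Longrightarrow> norm (F x) \<le> B"
    unfolding bounded_iff by force
  have "(\<lambda>x. F (clip x)) \<in> bcontfun"
  proof (rule bcontfun_normI[where b = B])
    have "continuous_on UNIV clip" unfolding clip_def by (intro continuous_intros)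
    then show "continuous_on UNIV (\<lambda>x. F (clip x))"
      by (rule continuous_on_compose2[OF c]) auto
    show "norm (F (clip x)) \<le> B" for x by (rule B) auto
  qed
  then show ?thesis
    by (simp add: primitive_def primitive_integral F_def Bcontfun_inverse)
qed

lemma apply_primitive_cong:
  assumes "AE x in unit_lborel. rep_L2 X x * rep_L2 Y x = f x" "f \<in> borel_measurable unit_lborel"
  shows "apply_bcontfun (primitive X Y) x = (LINT u:{0..clip x}|lborel. f u)"
  unfolding apply_primitive using assms by (intro LINT_unit_cong) auto

lemma primitive_clip: "apply_bcontfun (primitive X Y) (clip x) = apply_bcontfun (primitive X Y) x"
  by (simp add: apply_primitive)

lemma primitive_0 [simp]: "apply_bcontfun (primitive X Y) 0 = 0"
  by (simp add: primitive_integral apply_primitive, simp add: clip_def)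

lemma primitive_1: "apply_bcontfun (primitive X Y) 1 = inner X Y"
  by (simp add: apply_primitive inner_L2_eq clip_def)

lemma primitive_commute: "primitive X Y = primitive Y X"
  by (rule bcontfun_eqI) (simp add: apply_primitive mult.commute)

lemma primitive_add: "primitive (X + X') Y = primitive X Y + primitive X' Y"
proof (rule bcontfun_eqI)
  fix x
  have "AE u in unit_lborel. rep_L2 (X + X') u * rep_L2 Y u = rep_L2 X u * rep_L2 Y u + rep_L2 X' u * rep_L2 Y u"
    using rep_plus_L2[of X X'] by eventually_elim (simp add: algebra_simps)
  then have "apply_bcontfun (primitive (X + X') Y) x =
      (LINT u:{0..clip x}|lborel. rep_L2 X u * rep_L2 Y u + rep_L2 X' u * rep_L2 Y u)"
    by (rule apply_primitive_cong) measurable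
  also have "\<dots> = (LINT u:{0..clip x}|lborel. rep_L2 X u * rep_L2 Y u) + (LINT u:{0..clip x}|lborel. rep_L2 X' u * rep_L2 Y u)"
    by (intro set_integral_add; rule set_integrable_subset[OF set_integrable_rep_mult]) auto
  finally show "apply_bcontfun (primitive (X + X') Y) x = apply_bcontfun (primitive X Y + primitive X' Y) x"
    by (simp add: apply_primitive)
qed

lemma primitive_scaleR: "primitive (r *\<^sub>R X) Y = r *\<^sub>R primitive X Y"
proof (rule bcontfun_eqI)
  fix x
  have "AE u in unit_lborel. rep_L2 (r *\<^sub>R X) u * rep_L2 Y u = r * (rep_L2 X u * rep_L2 Y u)"
    using rep_scaleR_L2[of r X] by eventually_elim (simp add: algebra_simps)
  then have "apply_bcontfun (primitive (r *\<^sub>R X) Y) x = (LINT u:{0..clip x}|lborel. r * (rep_L2 X u * rep_L2 Y u))"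
    by (rule apply_primitive_cong) measurable
  then show "apply_bcontfun (primitive (r *\<^sub>R X) Y) x = apply_bcontfun (r *\<^sub>R primitive X Y) x"
    by (simp add: apply_primitive)
qed

text \<open>Every value is bounded by the integral of the absolute value of the product over the
  whole interval. This is an inner product of the classes \<open>A X\<close> and \<open>A Y\<close>
  of absolute values, which have the norms of \<open>X\<close> and \<open>Y\<close>, so
  Cauchy-Schwarz applies.\<close>

lemma norm_primitive: "norm (primitive X Y) \<le> norm X * norm Y"
proof (rule norm_bound)
  fix x
  define A where "A Z = abs_L2 (\<lambda>x. \<bar>rep_L2 Z x\<bar>)" for Z
  have sA: "square_integrable (\<lambda>x. \<bar>rep_L2 Z x\<bar>)" for Z
    using square_integrable_rep[of Z] by (simp add: square_integrable_def)
  have A: "AE x in unit_lborel. rep_L2 (A Z) x = \<bar>rep_L2 Z x\<bar>" for Z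
    unfolding A_def by (rule rep_abs_L2[OF sA])
  have iA: "inner (A Z) (A W) = (LINT u:{0..1}|lborel. \<bar>rep_L2 Z u * rep_L2 W u\<bar>)" for Z W
  proof -
    have "AE x in unit_lborel. rep_L2 (A Z) x * rep_L2 (A W) x = \<bar>rep_L2 Z x * rep_L2 W x\<bar>"
      using A[of Z] A[of W] by eventually_elim (simp add: abs_mult)
    then show ?thesis unfolding inner_L2_eq by (intro LINT_unit_cong) auto
  qed
  have nA: "norm (A Z) = norm Z" for Z
    using iA[of Z Z] by (simp add: norm_eq_sqrt_inner inner_L2_eq)
  let ?f = "\<lambda>u. rep_L2 X u * rep_L2 Y u"
  have i: "?f integrable_on {0..1}" "(\<lambda>u. \<bar>?f u\<bar>) integrable_on {0..1}"
    using set_integrable_rep_mult[of X Y] set_integrable_abs[OF set_integrable_rep_mult[of X Y]]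
    by (auto dest: set_borel_integral_eq_integral(1))
  have "norm (apply_bcontfun (primitive X Y) x) = norm (integral {0..clip x} ?f)"
    by (simp add: apply_primitive primitive_integral)
  also have "\<dots> \<le> integral {0..clip x} (\<lambda>u. \<bar>?f u\<bar>)"
    by (rule integral_norm_bound_integral[OF integrable_on_subinterval[OF i(1)]
        integrable_on_subinterval[OF i(2)]]) auto
  also have "\<dots> \<le> integral {0..1} (\<lambda>u. \<bar>?f u\<bar>)"
    by (rule integral_subset_le[OF _ integrable_on_subinterval[OF i(2)] i(2)]) auto
  also have "\<dots> = inner (A X) (A Y)"
    unfolding iA by (rule LINT_unit_integral[symmetric]) (auto intro: set_integrable_abs set_integrable_rep_mult)
  also have "\<dots> \<le> norm X * norm Y"
    using norm_cauchy_schwarz[of "A X" "A Y"] by (simp add: nA)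
  finally show "norm (apply_bcontfun (primitive X Y) x) \<le> norm X * norm Y" .
qed

lemma bounded_bilinear_primitive: "bounded_bilinear primitive"
proof
  show "\<exists>K. \<forall>X Y. norm (primitive X Y) \<le> norm X * norm Y * K"
    using norm_primitive by (intro exI[of _ 1]) auto
qed (metis primitive_add primitive_commute primitive_scaleR)+

interpretation primitive: bounded_bilinear primitive by (rule bounded_bilinear_primitive)

section \<open>Multiplication as a bounded bilinear, symmetric action\<close>

lemma act_add_right: "act f (X + Y) = act f X + act f Y"
  by (rule L2_eqI, use rep_act[of f "X + Y"] rep_act[of f X] rep_act[of f Y] rep_plus_L2[of X Y]
      rep_plus_L2[of "act f X" "act f Y"] in eventually_elim) (simp add: algebra_simps)

lemma act_add_left: "act (f + g) X = act f X + act g X"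
  by (rule L2_eqI, use rep_act[of "f + g" X] rep_act[of f X] rep_act[of g X]
      rep_plus_L2[of "act f X" "act g X"] in eventually_elim) (simp add: algebra_simps)

lemma act_scaleR_right: "act f (r *\<^sub>R X) = r *\<^sub>R act f X"
  by (rule L2_eqI, use rep_act[of f "r *\<^sub>R X"] rep_act[of f X] rep_scaleR_L2[of r X]
      rep_scaleR_L2[of r "act f X"] in eventually_elim) (simp add: algebra_simps)

lemma act_scaleR_left: "act (r *\<^sub>R f) X = r *\<^sub>R act f X"
  by (rule L2_eqI, use rep_act[of "r *\<^sub>R f" X] rep_act[of f X]
      rep_scaleR_L2[of r "act f X"] in eventually_elim) (simp add: algebra_simps)

lemma act_act: "act f (act g X) = act (f * g) X"
  by (rule L2_eqI, use rep_act[of "f * g" X] rep_act[of f "act g X"] rep_act[of g X] in eventually_elim)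
    (simp add: algebra_simps)

lemma act_one [simp]: "act 1 X = X"
  by (rule L2_eqI, use rep_act[of 1 X] in eventually_elim) simp

lemma primitive_act_right: "primitive X (act f Y) = primitive (act f X) Y"
proof (rule bcontfun_eqI)
  fix x
  have "AE u in unit_lborel. rep_L2 X u * rep_L2 (act f Y) u = apply_bcontfun f u * rep_L2 X u * rep_L2 Y u"
    "AE u in unit_lborel. rep_L2 (act f X) u * rep_L2 Y u = apply_bcontfun f u * rep_L2 X u * rep_L2 Y u"
    by (use rep_act[of f Y] in eventually_elim, simp) (use rep_act[of f X] in eventually_elim, simp)
  from this[THEN apply_primitive_cong]
  show "apply_bcontfun (primitive X (act f Y)) x = apply_bcontfun (primitive (act f X) Y) x"
    by simp
qed

lemma inner_act_right: "inner X (act f Y) = inner (act f X) Y"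
  by (metis primitive_1 primitive_act_right)

lemma norm_act: "norm (act f X) \<le> norm f * norm X"
proof -
  have "inner (act f X) (act f X) = (LINT u:{0..1}|lborel. (apply_bcontfun f u * rep_L2 X u)\<^sup>2)"
  proof -
    have "AE u in unit_lborel. rep_L2 (act f X) u * rep_L2 (act f X) u = (apply_bcontfun f u * rep_L2 X u)\<^sup>2"
      using rep_act[of f X] by eventually_elim (simp add: power2_eq_square)
    then show ?thesis unfolding inner_L2_eq by (intro LINT_unit_cong) auto
  qed
  also have "\<dots> \<le> (LINT u:{0..1}|lborel. (norm f)\<^sup>2 * (rep_L2 X u)\<^sup>2)"
  proof (rule set_integral_mono)
    show "set_integrable lborel {0..1} (\<lambda>u. (apply_bcontfun f u * rep_L2 X u)\<^sup>2)"
      using square_integrable_mult_bcontfun[OF square_integrable_rep, of f X]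
      by (simp add: square_integrable_def flip: unit_integrable_iff)
    show "set_integrable lborel {0..1} (\<lambda>u. (norm f)\<^sup>2 * (rep_L2 X u)\<^sup>2)"
      using square_integrable_rep[of X]
      by (simp add: square_integrable_def flip: unit_integrable_iff)
    show "(apply_bcontfun f u * rep_L2 X u)\<^sup>2 \<le> (norm f)\<^sup>2 * (rep_L2 X u)\<^sup>2" for u
      using norm_bounded[of f u]
      by (auto simp: power_mult_distrib abs_le_square_iff[symmetric] intro!: mult_right_mono)
  qed
  also have "\<dots> = (norm f)\<^sup>2 * inner X X"
    by (simp add: inner_L2_eq power2_eq_square)
  finally have "(norm (act f X))\<^sup>2 \<le> (norm f * norm X)\<^sup>2"
    by (simp add: power_mult_distrib power2_norm_eq_inner)
  then show ?thesis by (rule power2_le_imp_le) simp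
qed

lemma bounded_bilinear_act: "bounded_bilinear act"
proof
  show "\<exists>K. \<forall>f X. norm (act f X) \<le> norm f * norm X * K"
    using norm_act by (intro exI[of _ 1]) auto
qed (simp_all add: act_add_left act_add_right act_scaleR_left act_scaleR_right)

interpretation act: bounded_bilinear act by (rule bounded_bilinear_act)

section \<open>Product rule and exponential for primitives\<close>

lemma set_integrable_apply_primitive_mult:
  "set_integrable lborel {0..1} (\<lambda>u. apply_bcontfun f u * (rep_L2 X u * rep_L2 Y u))"
  by (intro set_integrable_continuous_mult set_integrable_rep_mult) auto

lemma apply_primitive_act:
  "apply_bcontfun (primitive (act f X) Y) x = integral {0..clip x} (\<lambda>u. apply_bcontfun f u * (rep_L2 X u * rep_L2 Y u))"
proof -
  have "AE u in unit_lborel. rep_L2 (act f X) u * rep_L2 Y u = apply_bcontfun f u * (rep_L2 X u * rep_L2 Y u)"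
    using rep_act[of f X] by eventually_elim simp
  then have "apply_bcontfun (primitive (act f X) Y) x = (LINT u:{0..clip x}|lborel. apply_bcontfun f u * (rep_L2 X u * rep_L2 Y u))"
    by (rule apply_primitive_cong) measurable
  then show ?thesis
    using set_integrable_apply_primitive_mult by (simp add: LINT_unit_integral)
qed

text \<open>The chain rule concerns a single primitive, so it is applied to the squares of the
  primitives of \<open>?a\<close>, \<open>?b\<close> and \<open>?a + ?b\<close>; polarisation
  isolates the mixed product.\<close>

lemma primitive_times_primitive:
  "primitive X Y * primitive Z W = primitive (act (primitive Z W) X) Y + primitive (act (primitive X Y) Z) W"
proof (rule bcontfun_eqI)
  fix x
  let ?a = "\<lambda>u. rep_L2 X u * rep_L2 Y u" and ?b = "\<lambda>u. rep_L2 Z u * rep_L2 W u"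
  let ?F = "\<lambda>f x. integral {0..x} f"
  have F: "?F ?a u = apply_bcontfun (primitive X Y) u" "?F ?b u = apply_bcontfun (primitive Z W) u"
    if "u \<in> {0..1}" for u
    using that by (simp_all add: apply_primitive clip_id LINT_unit_integral[OF set_integrable_rep_mult])
  have a: "set_integrable lborel {0..1} ?a" and b: "set_integrable lborel {0..1} ?b"
    by (rule set_integrable_rep_mult)+
  note ab = set_integral_add(1)[OF a b]
  have int: "f integrable_on {0..y}" if "set_integrable lborel {0..1} f" "y \<in> {0..1}" for f :: "real \<Rightarrow> real" and y
    using integrable_on_subinterval[OF set_borel_integral_eq_integral(1)[OF that(1)]] that(2) by auto
  define y where "y = clip x"
  have y: "y \<in> {0..1}" by (simp add: y_def)
  have sq: "(?F f y)\<^sup>2 = ?F (\<lambda>u. 2 * ?F f u * f u) y"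
    if "set_integrable lborel {0..1} f" for f :: "real \<Rightarrow> real"
  proof -
    have "((\<lambda>y. y\<^sup>2) has_real_derivative 2 * y) (at y)" for y :: real
      by (auto intro!: derivative_eq_intros)
    from chain_rule_primitive[OF that this, of "\<lambda>_. 2" y] y show ?thesis
      by (auto intro!: derivative_eq_intros)
  qed
  have Fab: "?F (\<lambda>u. ?a u + ?b u) u = ?F ?a u + ?F ?b u" if "u \<in> {0..1}" for u
    using int[OF a that] int[OF b that] by (rule Henstock_Kurzweil_Integration.integral_add)
  have Fm: "?F (\<lambda>u. 2 * ?F f u * g u) y = 2 * ?F (\<lambda>u. apply_bcontfun h u * g u) y"
    if "\<And>u. u \<in> {0..1} \<Longrightarrow> ?F f u = apply_bcontfun h u" for f g :: "real \<Rightarrow> real" and h :: "real \<Rightarrow>\<^sub>C real"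
  proof -
    have "?F (\<lambda>u. 2 * ?F f u * g u) y = ?F (\<lambda>u. 2 * (apply_bcontfun h u * g u)) y"
      using that y by (intro Henstock_Kurzweil_Integration.integral_cong) auto
    then show ?thesis by simp
  qed
  have hi: "(\<lambda>u. apply_bcontfun h u * g u) integrable_on {0..y}" if "set_integrable lborel {0..1} g"
    for h :: "real \<Rightarrow>\<^sub>C real" and g
    by (intro int[OF _ y] set_integrable_continuous_mult that) auto
  have FF: "?F (\<lambda>u. apply_bcontfun (h + k) u * (?a u + ?b u)) y =
    ?F (\<lambda>u. apply_bcontfun h u * ?a u) y + ?F (\<lambda>u. apply_bcontfun k u * ?a u) y +
    (?F (\<lambda>u. apply_bcontfun h u * ?b u) y + ?F (\<lambda>u. apply_bcontfun k u * ?b u) y)" for h k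
    using hi[OF a] hi[OF b]
    by (simp add: distrib_left distrib_right Henstock_Kurzweil_Integration.integral_add integrable_add)
  let ?h = "primitive X Y" and ?k = "primitive Z W"
  have "(apply_bcontfun ?h y)\<^sup>2 = 2 * ?F (\<lambda>u. apply_bcontfun ?h u * ?a u) y"
    using sq[OF a] Fm[OF F(1)] F(1)[OF y] by simp
  moreover have "(apply_bcontfun ?k y)\<^sup>2 = 2 * ?F (\<lambda>u. apply_bcontfun ?k u * ?b u) y"
    using sq[OF b] Fm[OF F(2)] F(2)[OF y] by simp
  moreover have "(apply_bcontfun ?h y + apply_bcontfun ?k y)\<^sup>2 = 2 * ?F (\<lambda>u. apply_bcontfun (?h + ?k) u * (?a u + ?b u)) y"
  proof -
    have "?F (\<lambda>u. ?a u + ?b u) u = apply_bcontfun (?h + ?k) u" if "u \<in> {0..1}" for u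
      using Fab[OF that] F[OF that] by simp
    from Fm[OF this] sq[OF ab] this[OF y] show ?thesis by simp
  qed
  ultimately have "apply_bcontfun ?h y * apply_bcontfun ?k y =
      ?F (\<lambda>u. apply_bcontfun ?k u * ?a u) y + ?F (\<lambda>u. apply_bcontfun ?h u * ?b u) y"
    unfolding FF by (simp add: power2_eq_square algebra_simps)
  then show "apply_bcontfun (?h * ?k) x = apply_bcontfun (primitive (act ?k X) Y + primitive (act ?h Z) W) x"
    by (simp add: apply_primitive_act primitive_clip y_def)
qed

text \<open>This is the chain rule for \<open>exp\<close>. For \<open>X = q\<close> and
  \<open>Y = one_L2\<close> it is the integrated form of \<eta>' = \<eta> q with \<eta>(0) =
  1.\<close>

lemma exp_primitive: "exp (primitive X Y) = 1 + primitive (act (exp (primitive X Y)) X) Y"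
proof (rule bcontfun_eqI)
  fix x
  let ?a = "\<lambda>u. rep_L2 X u * rep_L2 Y u"
  define y where "y = clip x"
  have y: "y \<in> {0..1}" by (simp add: y_def)
  have F: "integral {0..u} ?a = apply_bcontfun (primitive X Y) u" if "u \<in> {0..1}" for u
    using that by (simp_all add: apply_primitive clip_id LINT_unit_integral[OF set_integrable_rep_mult])
  have "exp (integral {0..y} ?a) - exp 0 = integral {0..y} (\<lambda>u. exp (integral {0..u} ?a) * ?a u)"
    by (rule chain_rule_primitive[where \<Phi>'' = exp])
      (use y set_integrable_rep_mult in \<open>auto intro: continuous_intros derivative_eq_intros\<close>)
  also have "\<dots> = integral {0..y} (\<lambda>u. apply_bcontfun (exp (primitive X Y)) u * ?a u)"
    using y by (intro Henstock_Kurzweil_Integration.integral_cong) (auto simp: F)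
  also have "\<dots> = apply_bcontfun (primitive (act (exp (primitive X Y)) X) Y) x"
    by (simp add: apply_primitive_act y_def)
  finally show "apply_bcontfun (exp (primitive X Y)) x = apply_bcontfun (1 + primitive (act (exp (primitive X Y)) X) Y) x"
    by (simp add: F[OF y]) (simp add: y_def primitive_clip)
qed

subsection \<open>Differentiation of curves\<close>

text \<open>Reduces differentiability on the function algebra to a quadratic remainder estimate,
  which for the sup norm can be checked point by point.\<close>

lemma has_derivative_quadratic_remainder:
  fixes F :: "'a::real_normed_vector \<Rightarrow> 'b::real_normed_vector"
  assumes "bounded_linear D" "r > 0"
    and rem: "\<And>h. norm h < r \<Longrightarrow> norm (F (x + h) - F x - D h) \<le> C * (norm h)\<^sup>2"
  shows "(F has_derivative D) (at x)"
proof (rule has_derivativeI_sandwich[OF \<open>r > 0\<close> assms(1), where H = "\<lambda>y. C * norm (y - x)"])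
  fix y assume y: "y \<noteq> x" "dist y x < r"
  then have "norm (F y - F x - D (y - x)) \<le> C * norm (y - x) * norm (y - x)"
    using rem[of "y - x"] by (simp add: dist_norm power2_eq_square mult_ac)
  then show "norm (F y - F x - D (y - x)) / norm (y - x) \<le> C * norm (y - x)"
    using y(1) by (simp add: divide_le_eq)
next
  have "((\<lambda>y. C * norm (y - x)) \<longlongrightarrow> C * norm (x - x)) (at x)"
    by (intro tendsto_intros)
  then show "((\<lambda>y. C * norm (y - x)) \<longlongrightarrow> 0) (at x)" by simp
qed

lemma abs_exp_minus_one_minus_le: "\<bar>exp h - 1 - h\<bar> \<le> h\<^sup>2" if "\<bar>h\<bar> \<le> 1" for h :: real
proof (cases "0 \<le> h")
  case True
  then have "exp h \<le> 1 + h + h\<^sup>2" using exp_bound[of h] that by auto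
  then show ?thesis using exp_ge_add_one_self[of h] zero_le_power2[of h] by linarith
next
  case False
  define k where "k = - h"
  have k: "0 < k" "k \<le> 1" using False that by (auto simp: k_def)
  \<comment> \<open>This factorisation makes \<open>1 - k + k\<^sup>2\<close> an upper bound of
    \<open>1 / (1 + k)\<close>, which in turn dominates \<open>exp (- k)\<close>.\<close>
  have "(1 - k + k\<^sup>2) * (1 + k) = 1 + k ^ 3" by (simp add: algebra_simps power2_eq_square power3_eq_cube)
  then have "1 \<le> (1 - k + k\<^sup>2) * (1 + k)" using k by simp
  also have "\<dots> \<le> (1 - k + k\<^sup>2) * exp k"
    using k exp_ge_add_one_self[of k] by (intro mult_left_mono) auto
  finally have "exp (- k) \<le> 1 - k + k\<^sup>2"
    by (simp add: exp_minus field_simps)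
  then have "exp h \<le> 1 + h + h\<^sup>2" by (simp add: k_def)
  then show ?thesis using exp_ge_add_one_self[of h] zero_le_power2[of h] by linarith
qed

text \<open>For \<open>norm h < 1\<close> the scalar estimate holds at every point, and multiplying
  by the value of \<open>exp f\<close> gives a remainder uniform in the point.\<close>

lemma has_derivative_exp_bcontfun:
  fixes f :: "real \<Rightarrow>\<^sub>C real"
  shows "(exp has_derivative (\<lambda>h. exp f * h)) (at f)"
proof (rule has_derivative_quadratic_remainder[where r = 1 and C = "norm (exp f)"])
  show "bounded_linear (\<lambda>h. exp f * h)" by (rule bounded_linear_mult_right)
  fix h :: "real \<Rightarrow>\<^sub>C real" assume h: "norm h < 1"
  show "norm (exp (f + h) - exp f - exp f * h) \<le> norm (exp f) * (norm h)\<^sup>2"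
  proof (rule norm_bound)
    fix x
    have hx: "\<bar>apply_bcontfun h x\<bar> \<le> norm h" using norm_bounded[of h x] by simp
    then have "\<bar>exp (apply_bcontfun h x) - 1 - apply_bcontfun h x\<bar> \<le> (apply_bcontfun h x)\<^sup>2"
      using h by (intro abs_exp_minus_one_minus_le) simp
    also have "\<dots> \<le> (norm h)\<^sup>2" using hx by (simp add: abs_le_square_iff[symmetric])
    finally have "\<bar>apply_bcontfun (exp f) x\<bar> * \<bar>exp (apply_bcontfun h x) - 1 - apply_bcontfun h x\<bar>
        \<le> norm (exp f) * (norm h)\<^sup>2"
      using norm_bounded[of "exp f" x] by (intro mult_mono) (simp_all only: real_norm_def abs_ge_zero norm_ge_zero)
    moreover have "apply_bcontfun (exp (f + h) - exp f - exp f * h) x =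
        apply_bcontfun (exp f) x * (exp (apply_bcontfun h x) - 1 - apply_bcontfun h x)"
      by (simp add: exp_add algebra_simps)
    ultimately show "norm (apply_bcontfun (exp (f + h) - exp f - exp f * h) x) \<le> norm (exp f) * (norm h)\<^sup>2"
      by (simp only: real_norm_def abs_mult)
  qed
qed simp

text \<open>Meaningful for functions bounded below by some \<open>m > 0\<close>; such a bound makes
  the pointwise inverse continuous and bounded, and it accompanies \<open>recip\<close>
  throughout.\<close>

definition recip :: "(real \<Rightarrow>\<^sub>C real) \<Rightarrow> real \<Rightarrow>\<^sub>C real" where
  "recip f = Bcontfun (\<lambda>x. inverse (apply_bcontfun f x))"

lemma apply_recip:
  assumes "m > 0" "\<And>x. m \<le> apply_bcontfun f x"
  shows "apply_bcontfun (recip f) x = inverse (apply_bcontfun f x)"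
proof -
  have "(\<lambda>x. inverse (apply_bcontfun f x)) \<in> bcontfun"
  proof (rule bcontfun_normI[where b = "inverse m"])
    have "apply_bcontfun f x \<noteq> 0" for x using assms(1) assms(2)[of x] by auto
    then show "continuous_on UNIV (\<lambda>x. inverse (apply_bcontfun f x))"
      by (intro continuous_intros) auto
    show "norm (inverse (apply_bcontfun f x)) \<le> inverse m" for x
      using assms(1) assms(2)[of x] by (simp add: le_imp_inverse_le)
  qed
  then show ?thesis by (simp add: recip_def Bcontfun_inverse)
qed

lemma has_derivative_recip:
  assumes m: "m > 0" "\<And>x. m \<le> apply_bcontfun f x"
  shows "(recip has_derivative (\<lambda>h. - (recip f * recip f * h))) (at f)"
\<comment> \<open>At a point with values \<open>a\<close> of \<open>f\<close> and \<open>b\<close>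
  of \<open>h\<close> the remainder is \<open>b\<^sup>2 / (a\<^sup>2 * (a + b))\<close>. A
  perturbation below \<open>m / 2\<close> keeps \<open>a + b\<close> above \<open>m / 2\<close>,
  whence the constant.\<close>
proof (rule has_derivative_quadratic_remainder[where r = "m / 2" and C = "2 / m ^ 3"])
  show "bounded_linear (\<lambda>h. - (recip f * recip f * h))"
    by (intro bounded_linear_minus bounded_linear_mult_right)
  show "m / 2 > 0" using m by simp
  fix h :: "real \<Rightarrow>\<^sub>C real" assume h: "norm h < m / 2"
  show "norm (recip (f + h) - recip f - - (recip f * recip f * h)) \<le> 2 / m ^ 3 * (norm h)\<^sup>2"
  proof (rule norm_bound)
    fix x
    define a b where "a = apply_bcontfun f x" and "b = apply_bcontfun h x"
    have hx: "\<bar>apply_bcontfun h x\<bar> \<le> norm h" for x using norm_bounded[of h x] by simp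
    then have b: "\<bar>b\<bar> \<le> norm h" unfolding b_def by blast
    have lower: "m / 2 \<le> apply_bcontfun (f + h) x" for x using hx[of x] m(2)[of x] h by auto
    have a: "m \<le> a" "m / 2 \<le> a + b" using m(2)[of x] lower[of x] by (auto simp: a_def b_def)
    have nz: "a \<noteq> 0" "a + b \<noteq> 0" using a m by auto
    have "apply_bcontfun (recip (f + h) - recip f - - (recip f * recip f * h)) x
      = inverse (a + b) - inverse a + inverse a * inverse a * b"
      using apply_recip[OF m] apply_recip[of "m / 2" "f + h", OF _ lower] m by (simp add: a_def b_def)
    also have "\<dots> = b\<^sup>2 / (a\<^sup>2 * (a + b))"
    proof -
      define u v where "u = inverse a" and "v = inverse (a + b)"
      have "a * u = 1" "(a + b) * v = 1" using nz by (simp_all add: u_def v_def)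
      then have "v - u + u * u * b = b\<^sup>2 * (u\<^sup>2 * v)" by algebra
      then show ?thesis by (simp add: u_def v_def divide_inverse power_inverse)
    qed
    finally have eq: "apply_bcontfun (recip (f + h) - recip f - - (recip f * recip f * h)) x = b\<^sup>2 / (a\<^sup>2 * (a + b))" .
    have "\<bar>b\<^sup>2 / (a\<^sup>2 * (a + b))\<bar> = b\<^sup>2 / (a\<^sup>2 * (a + b))" using a m by (simp add: abs_mult)
    also have "\<dots> \<le> (norm h)\<^sup>2 / (m\<^sup>2 * (m / 2))"
    proof (rule frac_le)
      show "b\<^sup>2 \<le> (norm h)\<^sup>2" using b by (simp add: abs_le_square_iff[symmetric])
      show "m\<^sup>2 * (m / 2) \<le> a\<^sup>2 * (a + b)" using a m by (intro mult_mono power_mono) auto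
    qed (use m in auto)
    also have "\<dots> = 2 / m ^ 3 * (norm h)\<^sup>2" by (simp add: power2_eq_square power3_eq_cube)
    finally show "norm (apply_bcontfun (recip (f + h) - recip f - - (recip f * recip f * h)) x)
      \<le> 2 / m ^ 3 * (norm h)\<^sup>2" by (simp only: eq real_norm_def)
  qed
qed

lemma has_vector_derivative_compose:
  assumes "(F has_derivative D) (at (g t))" "(g has_vector_derivative g') (at t within S)"
  shows "((\<lambda>t. F (g t)) has_vector_derivative D g') (at t within S)"
proof -
  have "((\<lambda>t. F (g t)) has_derivative (\<lambda>h. D (h *\<^sub>R g'))) (at t within S)"
    using has_derivative_compose[OF assms(2)[unfolded has_vector_derivative_def] assms(1)] .
  then show ?thesis
    unfolding has_vector_derivative_def
    using has_derivative_linear[OF assms(1)] by (simp add: linear_scale)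
qed

lemmas has_vector_derivative_exp_bcontfun = has_vector_derivative_compose[OF has_derivative_exp_bcontfun]

lemma continuous_on_exp_bcontfun:
  fixes f :: "'a::topological_space \<Rightarrow> real \<Rightarrow>\<^sub>C real"
  assumes "continuous_on S f"
  shows "continuous_on S (\<lambda>x. exp (f x))"
proof -
  have "continuous_on UNIV (exp :: (real \<Rightarrow>\<^sub>C real) \<Rightarrow> _)"
    using has_derivative_continuous[OF has_derivative_exp_bcontfun]
    by (auto intro: continuous_at_imp_continuous_on)
  from continuous_on_compose2[OF this assms] show ?thesis by simp
qed

lemma exp_half_square: "exp f = exp ((1/2) *\<^sub>R f) * exp ((1/2) *\<^sub>R f)" for f :: "real \<Rightarrow>\<^sub>C real"
  by (rule bcontfun_eqI) (simp flip: exp_add)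

lemma act_exp_cancel [simp]: "act (exp f) (act (exp (- f)) X) = X" "act (exp (- f)) (act (exp f) X) = X"
  using exp_minus_inverse[of f] by (simp_all add: act_act mult.commute[of "exp (- f)"])

text \<open>The weight \<open>exp f\<close> is the square of \<open>exp g\<close> with
  \<open>g = f / 2\<close>, so the form is the squared norm of \<open>act (exp g) X\<close>, and
  multiplication by \<open>exp (- g)\<close> recovers \<open>X\<close>. This is the positivity
  behind every uniqueness argument below.\<close>

lemma inner_act_exp_eq_0:
  assumes "inner (act (exp f) X) X = 0"
  shows "X = 0"
proof -
  define g where "g = (1/2) *\<^sub>R f"
  have "inner (act (exp g) X) (act (exp g) X) = inner (act (exp f) X) X"
    by (simp add: inner_act_right act_act exp_half_square[of f] g_def)
  then have "act (exp g) X = 0" using assms by simp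
  then have "act (exp (- g)) (act (exp g) X) = 0" by (simp add: act.zero_right)
  then show ?thesis by simp
qed

subsection \<open>The manifold in terms of \<open>act\<close> and \<open>primitive\<close>\<close>

abbreviation cls :: "(real \<Rightarrow>\<^sub>C real) \<Rightarrow> L2" where "cls f \<equiv> act f one_L2"
abbreviation prim :: "L2 \<Rightarrow> real \<Rightarrow>\<^sub>C real" where "prim X \<equiv> primitive X one_L2"

text \<open>\<open>Eta\<close> and \<open>Phi\<close> agree with \<open>eta\<close> and
  \<open>phi\<close> on the unit interval and take values in a Banach space, so they can be
  differentiated in \<open>q\<close>. \<open>Eta\<close> is moreover positive on the whole
  line.\<close>

definition Eta :: "L2 \<Rightarrow> real \<Rightarrow>\<^sub>C real" where "Eta q = exp (prim q)"
definition Phi :: "L2 \<Rightarrow> real \<Rightarrow>\<^sub>C real" where "Phi q = prim (cls (Eta q))"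

lemma eta_eq: "x \<in> {0..1} \<Longrightarrow> eta q x = apply_bcontfun (Eta q) x"
proof -
  assume x: "x \<in> {0..1}"
  have "AE u in unit_lborel. rep_L2 q u * rep_L2 one_L2 u = rep_L2 q u"
    using rep_one_L2 by eventually_elim simp
  then have "apply_bcontfun (prim q) x = (LINT u:{0..clip x}|lborel. rep_L2 q u)"
    by (rule apply_primitive_cong) measurable
  then show ?thesis using x by (simp add: eta_def Eta_def clip_id)
qed

lemma prim_cls: "x \<in> {0..1} \<Longrightarrow> apply_bcontfun (prim (cls f)) x = (LINT u:{0..x}|lborel. apply_bcontfun f u)"
proof -
  assume x: "x \<in> {0..1}"
  have "AE u in unit_lborel. rep_L2 (cls f) u * rep_L2 one_L2 u = apply_bcontfun f u"
    using rep_one_L2 rep_act_one[of f] by eventually_elim simp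
  then have "apply_bcontfun (prim (cls f)) x = (LINT u:{0..clip x}|lborel. apply_bcontfun f u)"
    by (rule apply_primitive_cong) measurable
  then show ?thesis using x by (simp add: clip_id)
qed

lemma LINT_eta: "x \<in> {0..1} \<Longrightarrow> (LINT y:{0..x}|lborel. eta q y) = (LINT y:{0..x}|lborel. apply_bcontfun (Eta q) y)"
  by (rule set_lebesgue_integral_cong) (auto simp: eta_eq)

lemma phi_eq: "x \<in> {0..1} \<Longrightarrow> phi q x = apply_bcontfun (Phi q) x"
  by (simp add: phi_def Phi_def prim_cls LINT_eta)

text \<open>Two kinds of equality meet here: \<open>eta\<close> and \<open>phi\<close> agree with
  their continuous versions at every point of the interval, representatives of products only almost
  everywhere.\<close>

lemma LINT_inner:
  assumes "AE x in unit_lborel. rep_L2 X x * rep_L2 Y x = g x" "g \<in> borel_measurable unit_lborel"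
    and "\<And>x. x \<in> {0..1} \<Longrightarrow> f x = g x"
  shows "(LINT x:{0..1}|lborel. f x) = inner X Y"
proof -
  have "(LINT x:{0..1}|lborel. f x) = (LINT x:{0..1}|lborel. g x)"
    by (rule set_lebesgue_integral_cong) (use assms(3) in auto)
  also have "\<dots> = inner X Y"
    unfolding inner_L2_eq using assms(1,2) by (intro LINT_unit_cong) auto
  finally show ?thesis .
qed

lemma LINT_rep: "(LINT x:{0..1}|lborel. rep_L2 X x) = inner X one_L2"
  by (rule LINT_inner[where g = "rep_L2 X"], use rep_one_L2 in eventually_elim) auto

lemma LINT_rep_mult:
  assumes "\<And>x. x \<in> {0..1} \<Longrightarrow> g x = apply_bcontfun f x"
  shows "(LINT x:{0..1}|lborel. rep_L2 X x * g x) = inner X (cls f)"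
  by (rule LINT_inner[where g = "\<lambda>x. rep_L2 X x * apply_bcontfun f x"], use rep_act_one[of f] in eventually_elim)
    (auto simp: assms)

lemma LINT_rep_mult_mult:
  assumes "\<And>x. x \<in> {0..1} \<Longrightarrow> g x = apply_bcontfun f x * (rep_L2 X x * rep_L2 Y x)"
  shows "(LINT x:{0..1}|lborel. g x) = inner (act f X) Y"
  by (rule LINT_inner[where g = "\<lambda>x. apply_bcontfun f x * (rep_L2 X x * rep_L2 Y x)"], use rep_act[of f X] in eventually_elim)
    (auto simp: assms)

lemma LINT_cls:
  assumes "\<And>x. x \<in> {0..1} \<Longrightarrow> g x = apply_bcontfun f x"
  shows "(LINT x:{0..1}|lborel. g x) = inner (cls f) one_L2"
  by (rule LINT_inner[where g = "apply_bcontfun f"], use rep_act_one[of f] rep_one_L2 in eventually_elim)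
    (auto simp: assms)

lemma Q_iff: "q \<in> Q \<longleftrightarrow> inner q one_L2 = 0 \<and> inner (cls (Eta q)) one_L2 = 1"
  unfolding Q_def using LINT_cls[of "eta q" "Eta q"] by (simp add: LINT_rep eta_eq)

lemma tangent_Q_iff: "X \<in> tangent_Q q \<longleftrightarrow> inner X one_L2 = 0 \<and> inner X (cls (Phi q)) = 0"
  unfolding tangent_Q_def using LINT_rep_mult[of "phi q" "Phi q" X] by (simp add: LINT_rep phi_eq)

lemma LINT_cotangent:
  "(LINT x:{0..1}|lborel. rep_L2 p x * eta q x) = inner p (cls (Eta q))"
  "(LINT x:{0..1}|lborel. rep_L2 p x * phi q x * eta q x) = inner p (cls (Phi q * Eta q))"
  using LINT_rep_mult[of "eta q" "Eta q" p] LINT_rep_mult[of "\<lambda>x. phi q x * eta q x" "Phi q * Eta q" p]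
  by (simp_all add: phi_eq eta_eq mult.assoc)

lemma cotangent_Q_iff:
  "p \<in> cotangent_Q q \<longleftrightarrow> inner p (cls (Eta q)) = 0 \<and> inner p (cls (Phi q * Eta q)) = 0"
  by (simp add: cotangent_Q_def LINT_cotangent)

lemma metric_G_eq: "metric_G q X Y = inner (act (exp (- prim q)) X) Y"
  unfolding metric_G_def
  by (rule LINT_rep_mult_mult) (simp add: eta_eq Eta_def exp_minus field_simps)

lemma abs_L2_cong_on:
  assumes eq: "\<And>x. x \<in> {0..1} \<Longrightarrow> g x = h x" and h: "square_integrable h"
  shows "abs_L2 g = abs_L2 h"
proof -
  have eq': "g x = h x" if "x \<in> space unit_lborel" for x
    using eq that by (simp add: space_restrict_space)
  have "g \<in> borel_measurable unit_lborel \<longleftrightarrow> h \<in> borel_measurable unit_lborel"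
    by (rule measurable_cong) (rule eq')
  moreover have "integrable unit_lborel (\<lambda>x. (g x)\<^sup>2) \<longleftrightarrow> integrable unit_lborel (\<lambda>x. (h x)\<^sup>2)"
    by (rule Bochner_Integration.integrable_cong) (simp_all add: eq')
  ultimately show ?thesis
    by (intro abs_L2_cong) (use h eq' in \<open>auto simp: square_integrable_def intro!: AE_I2\<close>)
qed

lemma abs_L2_act:
  assumes "\<And>x. x \<in> {0..1} \<Longrightarrow> g x = apply_bcontfun f x * rep_L2 X x"
  shows "abs_L2 g = act f X"
  unfolding act_def
  by (rule abs_L2_cong_on[OF assms square_integrable_mult_bcontfun[OF square_integrable_rep]])

lemma abs_L2_cls:
  assumes "\<And>x. x \<in> {0..1} \<Longrightarrow> g x = apply_bcontfun f x"
  shows "abs_L2 g = cls f"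
proof -
  have "abs_L2 g = abs_L2 (apply_bcontfun f)"
    by (rule abs_L2_cong_on[OF assms square_integrable_bcontfun])
  also have "\<dots> = cls f"
    unfolding act_def
    by (rule abs_L2_cong[OF square_integrable_bcontfun square_integrable_mult_bcontfun[OF square_integrable_rep]],
        use rep_one_L2 in eventually_elim) simp
  finally show ?thesis .
qed

lemma momentum_eq: "momentum q X = act (exp (- prim q)) X"
  unfolding momentum_def by (rule abs_L2_act) (simp add: eta_eq Eta_def exp_minus field_simps)

lemma velocity_eq: "velocity q p = act (Eta q) p"
  unfolding velocity_def by (rule abs_L2_act) (simp add: eta_eq)

lemma hamiltonian_eq: "hamiltonian q p = 1/2 * inner (act (Eta q) p) p"
  by (simp add: hamiltonian_def metric_G_eq velocity_eq Eta_def inner_commute)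

lemma apply_Eta_pos: "apply_bcontfun (Eta q) x > 0"
  by (simp add: Eta_def)

lemma Eta_eq: "Eta q = 1 + prim (act (Eta q) q)"
  unfolding Eta_def by (rule exp_primitive)

subsection \<open>Change of variables\<close>

lemma Phi_bounds: "q \<in> Q \<Longrightarrow> apply_bcontfun (Phi q) 1 = 1" "apply_bcontfun (Phi q) 0 = 0"
  by (simp_all add: Phi_def primitive_1 Q_iff)

text \<open>Substitution asks for two-sided derivatives of the inverse also at 0 and 1. Since
  \<open>Eta q\<close> is continuous and positive on the whole line, \<phi> extends to a strictly
  increasing \<open>G\<close> on [-1, 2], whose inverse \<psi> is differentiable at both end
  points.\<close>

lemma phi_inverse_extension:
  assumes q: "q \<in> Q"
  shows "\<exists>\<psi>. (\<forall>y\<in>{0..1}. \<psi> y \<in> {0..1} \<and> phi q (\<psi> y) = y \<and> phi_inv q y = \<psi> y \<and>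
      (\<psi> has_real_derivative inverse (eta q (\<psi> y))) (at y)) \<and> \<psi> 0 = 0 \<and> \<psi> 1 = 1"
proof -
  let ?e = "apply_bcontfun (Eta q)"
  define G where "G x = integral {-1..x} ?e - integral {-1..0} ?e" for x
  have int: "?e integrable_on {a..b}" for a b
    by (rule integrable_continuous_real) simp
  have G': "(G has_real_derivative ?e x) (at x within {-1..2})" if "x \<in> {-1..2}" for x
  proof -
    have "((\<lambda>x. integral {-1..x} ?e) has_vector_derivative ?e x) (at x within {-1..2})"
      using that by (intro integral_has_vector_derivative) auto
    then have "((\<lambda>x. integral {-1..x} ?e) has_real_derivative ?e x) (at x within {-1..2})"
      by (simp add: has_real_derivative_iff_has_vector_derivative)
    then show ?thesis unfolding G_def by (auto intro!: derivative_eq_intros)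
  qed
  have Gd: "(G has_real_derivative ?e x) (at x)" if "-1 < x" "x < 2" for x
    using G'[of x] that by (simp add: at_within_Icc_at)
  have Gc: "continuous_on {-1..2} G"
    by (rule DERIV_continuous_on[OF G'])
  have mono: "G u < G v" if "-1 \<le> u" "u < v" "v \<le> 2" for u v
  proof (rule DERIV_pos_imp_increasing_open[OF that(2)])
    show "continuous_on {u..v} G" by (rule continuous_on_subset[OF Gc]) (use that in auto)
    show "\<exists>y. (G has_real_derivative y) (at x) \<and> 0 < y" if "u < x" "x < v" for x
      using Gd[of x] apply_Eta_pos that \<open>-1 \<le> u\<close> \<open>v \<le> 2\<close> by force
  qed
  have Gphi: "G x = phi q x" if x: "x \<in> {0..1}" for x
  proof -
    have "G x = integral {0..x} ?e"
      unfolding G_def using Henstock_Kurzweil_Integration.integral_combine[of "-1" 0 x ?e] int x by auto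
    also have "\<dots> = (LINT u:{0..x}|lborel. ?e u)"
      by (rule set_borel_integral_eq_integral(2)[symmetric], rule borel_integrable_atLeastAtMost') simp
    also have "\<dots> = phi q x" using x by (simp add: phi_eq Phi_def prim_cls)
    finally show ?thesis .
  qed
  have G01: "G 0 = 0" "G 1 = 1"
    using Gphi[of 0] Gphi[of 1] Phi_bounds(1)[OF q] Phi_bounds(2)[of q] by (simp_all add: phi_eq)
  have inj: "inj_on G {-1..2}"
    using mono by (intro linorder_inj_onI) force+
  define \<psi> where "\<psi> = the_inv_into {-1..2} G"
  have \<psi>G: "\<psi> (G x) = x" if "x \<in> {-1..2}" for x
    unfolding \<psi>_def by (rule the_inv_into_f_f[OF inj that])
  have G\<psi>: "G (\<psi> y) = y \<and> -1 \<le> \<psi> y \<and> \<psi> y \<le> 2" if y: "G (-1) \<le> y" "y \<le> G 2" for y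
  proof -
    obtain x where "-1 \<le> x" "x \<le> 2" "G x = y"
      using IVT'[of G "-1" y 2] y Gc by auto
    then show ?thesis using \<psi>G[of x] by auto
  qed
  have ends: "G (-1) < 0" "1 < G 2" using mono[of "-1" 0] mono[of 1 2] G01 by auto
  have \<psi>01: "\<psi> y \<in> {0..1}" if y: "y \<in> {0..1}" for y
  proof -
    obtain x where "0 \<le> x" "x \<le> 1" "G x = y"
      using IVT'[of G 0 y 1] y G01 continuous_on_subset[OF Gc, of "{0..1}"] by auto
    then show ?thesis using \<psi>G[of x] by auto
  qed
  have phi\<psi>: "phi q (\<psi> y) = y" if y: "y \<in> {0..1}" for y
    using G\<psi>[of y] ends y Gphi[OF \<psi>01[OF y]] by auto
  show ?thesis
  proof (intro exI[of _ \<psi>] conjI ballI)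
    show "\<psi> 0 = 0" "\<psi> 1 = 1" using \<psi>G[of 0] \<psi>G[of 1] G01 by auto
    show "\<psi> y \<in> {0..1}" "phi q (\<psi> y) = y" if "y \<in> {0..1}" for y
      using \<psi>01 phi\<psi> that by blast+
    have inj': "inj_on (phi q) {0..1}"
      using inj_on_subset[OF inj, of "{0..1}"] Gphi inj_on_cong[of "{0..1}" G "phi q"] by auto
    show "phi_inv q y = \<psi> y" if y: "y \<in> {0..1}" for y
      unfolding phi_inv_def using the_inv_into_f_f[OF inj' \<psi>01[OF y]] phi\<psi>[OF y] by simp
    show "(\<psi> has_real_derivative inverse (eta q (\<psi> y))) (at y)" if y: "y \<in> {0..1}" for y
    proof -
      have \<psi>y: "\<psi> y \<in> {0..1}" by (rule \<psi>01[OF y])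
      have "isCont \<psi> (G (\<psi> y))"
      \<comment> \<open>The interval [-1/2, 3/2] contains [0, 1] in its interior and lies inside the
        open interval on which \<open>G\<close> is known to be differentiable.\<close>
      proof (rule isCont_inverse_function2[where a = "-1/2" and b = "3/2" and f = G and g = \<psi>])
        show "-1/2 < \<psi> y" "\<psi> y < 3/2" using \<psi>y by auto
        show "\<psi> (G z) = z" if "-1/2 \<le> z" "z \<le> 3/2" for z using \<psi>G[of z] that by simp
        show "isCont G z" if "-1/2 \<le> z" "z \<le> 3/2" for z
          using Gd[of z] that by (intro DERIV_isCont) auto
      qed
      then have "isCont \<psi> y" using G\<psi>[of y] ends y by simp
      then have "(\<psi> has_real_derivative inverse (?e (\<psi> y))) (at y)"
        using \<psi>y apply_Eta_pos[of q "\<psi> y"] ends y G\<psi>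
        by (intro DERIV_inverse_function[of G _ _ _ "G (-1)" "G 2"] Gd) auto
      then show ?thesis using \<psi>y by (simp add: eta_eq)
    qed
  qed
qed

text \<open>Substitution \<open>x = phi_inv q y\<close>, whose derivative is \<open>1 / eta\<close>.
  The condition on \<open>g\<close> has the Jacobian multiplied out, so that the callers need no
  division.\<close>

lemma LINT_phi_inv:
  assumes q: "q \<in> Q" and f: "set_integrable lborel {0..1} f" and z: "z \<in> {0..1}"
    and g: "\<And>y. y \<in> {0..1} \<Longrightarrow> g y * eta q (phi_inv q y) = f (phi_inv q y)"
  shows "(LINT y:{0..z}|lborel. g y) = (LINT x:{0..phi_inv q z}|lborel. f x)"
proof -
  obtain \<psi> where
    \<psi>: "\<forall>y\<in>{0..1}. \<psi> y \<in> {0..1} \<and> phi q (\<psi> y) = y \<and> phi_inv q y = \<psi> y \<and>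
      (\<psi> has_real_derivative inverse (eta q (\<psi> y))) (at y)" "\<psi> 0 = 0"
    using phi_inverse_extension[OF q] by (elim exE conjE)
  then have d: "(\<psi> has_real_derivative inverse (eta q (\<psi> y))) (at y)" if "y \<in> {0..1}" for y
    using that by blast
  have sub: "{\<psi> 0..\<psi> z} \<subseteq> {0..1}" using bspec[OF \<psi>(1) z] \<psi>(2) by auto
  have \<psi>c: "continuous_on {0..1} \<psi>"
    by (rule DERIV_continuous_on[OF has_field_derivative_at_within[OF d]])
  have "apply_bcontfun (Eta q) y \<noteq> 0" for y using apply_Eta_pos[of q y] by simp
  then have "continuous_on {0..1} (\<lambda>y. inverse (apply_bcontfun (Eta q) (\<psi> y)))"
    by (intro continuous_on_inverse continuous_on_compose2[OF continuous_on_apply_bcontfun \<psi>c, of UNIV]) auto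
  then have c: "continuous_on {0..1} (\<lambda>y. inverse (eta q (\<psi> y)))"
    by (rule continuous_on_eq) (use \<psi>(1) in \<open>simp add: eta_eq\<close>)
  have pos: "eta q (\<psi> y) > 0" for y by (simp add: eta_def)
  have "(LBINT x. f x * indicator {\<psi> 0..\<psi> z} x) = (LBINT x. f (\<psi> x) * inverse (eta q (\<psi> x)) * indicator {0..z} x)"
  proof (rule integral_substitution(2))
    show "set_integrable lborel {\<psi> 0..\<psi> z} f" by (rule set_integrable_subset[OF f _ sub]) auto
    show "continuous_on {0..z} (\<lambda>x. inverse (eta q (\<psi> x)))" by (rule continuous_on_subset[OF c]) (use z in auto)
  qed (use d z pos in \<open>auto simp: less_imp_le\<close>)
  moreover have "(LBINT x. f (\<psi> x) * inverse (eta q (\<psi> x)) * indicator {0..z} x) = (LINT y:{0..z}|lborel. g y)"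
    unfolding set_lebesgue_integral_def
  proof (rule Bochner_Integration.integral_cong[OF refl])
    fix y
    show "f (\<psi> y) * inverse (eta q (\<psi> y)) * indicator {0..z} y = indicator {0..z} y *\<^sub>R g y"
      using g[of y] \<psi>(1)[THEN bspec, of y] pos[of y] z by (auto simp: indicator_def field_simps)
  qed
  ultimately show ?thesis
    using bspec[OF \<psi>(1) z] \<psi>(2) by (simp add: set_lebesgue_integral_def mult.commute)
qed

lemma phi_inv_mem:
  assumes "q \<in> Q" "y \<in> {0..1}"
  shows "phi_inv q y \<in> {0..1}" "phi q (phi_inv q y) = y"
  using phi_inverse_extension[OF assms(1)] assms(2) by auto

lemma apply_Phi_phi_inv: "q \<in> Q \<Longrightarrow> y \<in> {0..1} \<Longrightarrow> apply_bcontfun (Phi q) (phi_inv q y) = y"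
  using phi_inv_mem[of q y] by (simp add: phi_eq)

lemma phi_inv_1: "q \<in> Q \<Longrightarrow> phi_inv q 1 = 1"
  using phi_inverse_extension[of q] by auto

lemma LINT_phi_inv_inner:
  assumes q: "q \<in> Q"
    and g: "\<And>y. y \<in> {0..1} \<Longrightarrow> g y * eta q (phi_inv q y) =
      apply_bcontfun f (phi_inv q y) * (rep_L2 X (phi_inv q y) * rep_L2 Y (phi_inv q y))"
  shows "(LINT y:{0..1}|lborel. g y) = inner (act f X) Y"
proof -
  have "(LINT y:{0..1}|lborel. g y) = (LINT x:{0..phi_inv q 1}|lborel. apply_bcontfun f x * (rep_L2 X x * rep_L2 Y x))"
    by (rule LINT_phi_inv[OF q set_integrable_apply_primitive_mult _ g]) auto
  then show ?thesis using LINT_rep_mult_mult[of "\<lambda>x. apply_bcontfun f x * (rep_L2 X x * rep_L2 Y x)" f X Y]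
    by (simp add: phi_inv_1[OF q])
qed

text \<open>Under y = \<phi>(x) the variable becomes \<phi> and dy becomes \<eta> dx. What results
  is built from \<open>act\<close> and \<open>inner\<close>, without the inverse of \<phi>, so it
  can be integrated by parts and depends visibly continuously on \<open>q\<close> and
  \<open>p\<close>.\<close>

lemma coeff_a_eq:
  assumes q: "q \<in> Q"
  shows "coeff_a q p = 1/2 * inner (act (Phi q * Eta q) p) p"
proof -
  have "(LINT y:{0..1}|lborel. y * (rep_L2 p (phi_inv q y))\<^sup>2) = inner (act (Phi q * Eta q) p) p"
    by (rule LINT_phi_inv_inner[OF q])
      (simp add: apply_Phi_phi_inv[OF q] eta_eq phi_inv_mem(1)[OF q] power2_eq_square del: atLeastAtMost_iff)
  then show ?thesis by (simp add: coeff_a_def)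
qed

lemma coeff_c_eq:
  assumes q: "q \<in> Q"
  shows "coeff_c q p = 1/4 * inner (act (Phi q * Phi q * Eta q) p) p"
proof -
  have "(LINT y:{0..1}|lborel. y\<^sup>2 * (rep_L2 p (phi_inv q y))\<^sup>2) = inner (act (Phi q * Phi q * Eta q) p) p"
    by (rule LINT_phi_inv_inner[OF q])
      (simp add: apply_Phi_phi_inv[OF q] eta_eq phi_inv_mem(1)[OF q] power2_eq_square del: atLeastAtMost_iff)
  then show ?thesis by (simp add: coeff_c_def)
qed

text \<open>The substitution is used twice: the inner integral becomes the primitive
  \<open>U\<close> of \<eta> p at the point \<open>phi_inv q x\<close>, and the outer one turns into
  the integral of U^2 \<eta>.\<close>

lemma coeff_b_eq:
  fixes q p
  assumes q: "q \<in> Q"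
  defines "U \<equiv> prim (act (Eta q) p)"
  shows "coeff_b q p = 3/2 * inner (cls (U * U * Eta q)) one_L2"
proof -
  have U: "(LINT y:{0..x}|lborel. rep_L2 p (phi_inv q y)) = apply_bcontfun U (phi_inv q x)" if x: "x \<in> {0..1}" for x
  proof -
    have f: "set_integrable lborel {0..1} (\<lambda>u. apply_bcontfun (Eta q) u * rep_L2 p u)"
      using square_integrable_mult[OF square_integrable_bcontfun square_integrable_rep]
      by (simp add: unit_integrable_iff)
    have "(LINT y:{0..x}|lborel. rep_L2 p (phi_inv q y)) =
        (LINT u:{0..phi_inv q x}|lborel. apply_bcontfun (Eta q) u * rep_L2 p u)"
      by (rule LINT_phi_inv[OF q f x]) (simp add: eta_eq phi_inv_mem(1)[OF q] del: atLeastAtMost_iff)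
    also have "\<dots> = apply_bcontfun U (phi_inv q x)"
    proof -
      have "AE u in unit_lborel. rep_L2 (act (Eta q) p) u * rep_L2 one_L2 u = apply_bcontfun (Eta q) u * rep_L2 p u"
        using rep_act[of "Eta q" p] rep_one_L2 by eventually_elim simp
      from apply_primitive_cong[OF this, of "phi_inv q x"] show ?thesis
        by (simp add: U_def clip_id[OF phi_inv_mem(1)[OF q x]])
    qed
    finally show ?thesis .
  qed
  have "(LINT x:{0..1}|lborel. (LINT y:{0..x}|lborel. rep_L2 p (phi_inv q y))\<^sup>2) =
    (LINT x:{0..1}|lborel. (apply_bcontfun U (phi_inv q x))\<^sup>2)"
    by (rule set_lebesgue_integral_cong) (auto simp: U)
  also have "\<dots> = (LINT u:{0..phi_inv q 1}|lborel. apply_bcontfun (U * U * Eta q) u)"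
  proof (rule LINT_phi_inv[OF q])
    show "set_integrable lborel {0..1} (apply_bcontfun (U * U * Eta q))"
      by (rule borel_integrable_atLeastAtMost') (rule continuous_on_apply_bcontfun)
  qed (simp_all add: eta_eq phi_inv_mem(1)[OF q] power2_eq_square del: atLeastAtMost_iff, simp)
  also have "\<dots> = inner (cls (U * U * Eta q)) one_L2"
    unfolding phi_inv_1[OF q] by (rule LINT_cls) simp
  finally show ?thesis by (simp add: coeff_b_def)
qed

text \<open>The primitive of \<eta> p^2 from 0, whereas the force integrates from x to 1. The two
  add up to the constant \<open>inner (act (Eta q) p) p\<close>, which \<open>force_eq\<close>
  absorbs into the coefficient of \<open>one_L2\<close>.\<close>

definition pot :: "L2 \<Rightarrow> L2 \<Rightarrow> real \<Rightarrow>\<^sub>C real" where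
  "pot q p = primitive (act (Eta q) p) p"

lemma H2_solution:
  fixes a b :: real
  defines "z \<equiv> matrix_inv H2 *v vector [a, b]"
  shows "z $ 1 = 4 * a - 6 * b" "z $ 2 = 12 * b - 6 * a"
proof -
  \<comment> \<open>The explicit inverse of \<open>H2\<close>, which has determinant 1/12. As
    \<open>matrix_inv\<close> is a choice, \<open>M\<close> serves as witness and is then identified
    with it by uniqueness of inverses.\<close>
  define M :: "real^2^2" where "M = vector [vector [4, -6], vector [-6, 12]]"
  have "H2 ** M = mat 1" "M ** H2 = mat 1"
    by (simp_all add: H2_def M_def matrix_matrix_mult_def vec_eq_iff mat_def forall_2 sum_2)
  then have "H2 ** matrix_inv H2 = mat 1 \<and> matrix_inv H2 ** H2 = mat 1"
    unfolding matrix_inv_def by (intro someI[of "\<lambda>A. H2 ** A = mat 1 \<and> A ** H2 = mat 1" M] conjI)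
  then have "matrix_inv H2 = M"
    using \<open>H2 ** M = mat 1\<close> by (metis matrix_mul_assoc matrix_mul_lid matrix_mul_rid)
  then show "z $ 1 = 4 * a - 6 * b" "z $ 2 = 12 * b - 6 * a"
    unfolding z_def by (simp_all add: M_def matrix_vector_mult_def sum_2)
qed

text \<open>\<open>force1\<close> and \<open>force2\<close> are the two components of the inverse of
  \<open>H2\<close> applied to (a, b + c), that is, the multipliers of 1 and \<phi> in the
  force.\<close>

definition force1 :: "L2 \<Rightarrow> L2 \<Rightarrow> real" where
  "force1 q p = 4 * coeff_a q p - 6 * (coeff_b q p + coeff_c q p)"
definition force2 :: "L2 \<Rightarrow> L2 \<Rightarrow> real" where
  "force2 q p = 12 * (coeff_b q p + coeff_c q p) - 6 * coeff_a q p"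

lemma force_eq:
  "force q p = (1/2) *\<^sub>R cls (pot q p) + (force1 q p - 1/2 * inner (act (Eta q) p) p) *\<^sub>R one_L2 + force2 q p *\<^sub>R cls (Phi q)"
proof -
  define f where "f = (1/2) *\<^sub>R pot q p + (force1 q p - 1/2 * inner (act (Eta q) p) p) *\<^sub>R 1 + force2 q p *\<^sub>R Phi q"
  have eq: "- 1 / 2 * (LINT y:{x..1}|lborel. eta q y * (rep_L2 p y)\<^sup>2) +
      (vector [1, phi q x] :: real^2) \<bullet> (matrix_inv H2 *v vector [coeff_a q p, coeff_b q p + coeff_c q p]) =
      apply_bcontfun f x" if x: "x \<in> {0..1}" for x
  proof -
    have i: "integral {0..u} (\<lambda>y. apply_bcontfun (Eta q) y * (rep_L2 p y * rep_L2 p y)) = apply_bcontfun (pot q p) u"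
      if "u \<in> {0..1}" for u
      unfolding pot_def apply_primitive_act by (simp add: clip_id[OF that])
    have "(LINT y:{x..1}|lborel. eta q y * (rep_L2 p y)\<^sup>2) = (LINT y:{x..1}|lborel. apply_bcontfun (Eta q) y * (rep_L2 p y * rep_L2 p y))"
      by (rule set_lebesgue_integral_cong) (use x in \<open>auto simp: eta_eq power2_eq_square\<close>)
    also have "\<dots> = integral {x..1} (\<lambda>y. apply_bcontfun (Eta q) y * (rep_L2 p y * rep_L2 p y))"
      using x by (intro LINT_unit_integral set_integrable_apply_primitive_mult) auto
    also have "\<dots> = apply_bcontfun (pot q p) 1 - apply_bcontfun (pot q p) x"
      using Henstock_Kurzweil_Integration.integral_combine[of 0 x 1 "\<lambda>y. apply_bcontfun (Eta q) y * (rep_L2 p y * rep_L2 p y)"]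
        set_borel_integral_eq_integral(1)[OF set_integrable_apply_primitive_mult[of "Eta q" p p]] x i[of 1] i[of x]
      by auto
    also have "apply_bcontfun (pot q p) 1 = inner (act (Eta q) p) p" by (simp add: pot_def primitive_1)
    finally show ?thesis
      using x by (simp add: f_def inner_vec_def sum_2 H2_solution force1_def force2_def phi_eq algebra_simps)
  qed
  have "force q p = cls f"
    unfolding force_def by (rule abs_L2_cls) (rule eq)
  then show ?thesis
    by (simp add: f_def act.add_left act.scaleR_left)
qed

subsection \<open>The Hamiltonian vector field\<close>

lemma integration_by_parts:
  "inner X Y * inner Z W = inner (act (primitive Z W) X) Y + inner (act (primitive X Y) Z) W"
  using arg_cong[OF primitive_times_primitive, of "\<lambda>f. apply_bcontfun f 1" X Y Z W]
  by (simp add: primitive_1)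

lemmas inner_act_normalize = inner_act_right act_act mult_ac

lemma inner_act_left_commute: "inner (act f X) Y = inner (act f Y) X"
  by (metis inner_act_right inner_commute)

lemma has_vector_derivative_Eta:
  assumes "(\<gamma> has_vector_derivative X) (at t within S)"
  shows "((\<lambda>t. Eta (\<gamma> t)) has_vector_derivative Eta (\<gamma> t) * prim X) (at t within S)"
  unfolding Eta_def
  by (intro has_vector_derivative_exp_bcontfun bounded_linear.has_vector_derivative[OF primitive.bounded_linear_left] assms)

lemma has_vector_derivative_cls:
  assumes "(g has_vector_derivative g') (at t within S)"
  shows "((\<lambda>t. act (g t) X) has_vector_derivative act g' X) (at t within S)"
  by (intro bounded_linear.has_vector_derivative[OF act.bounded_linear_left] assms)

lemma has_vector_derivative_Phi:
  assumes "(\<gamma> has_vector_derivative X) (at t within S)"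
  shows "((\<lambda>t. Phi (\<gamma> t)) has_vector_derivative prim (cls (Eta (\<gamma> t) * prim X))) (at t within S)"
  unfolding Phi_def
  by (intro bounded_linear.has_vector_derivative[OF primitive.bounded_linear_left]
      has_vector_derivative_cls has_vector_derivative_Eta assms)

lemma has_vector_derivative_inner:
  assumes "(f has_vector_derivative f') (at t within S)" "(g has_vector_derivative g') (at t within S)"
  shows "((\<lambda>t. inner (f t) (g t)) has_vector_derivative inner (f t) g' + inner f' (g t)) (at t within S)"
  by (rule bounded_bilinear.has_vector_derivative[OF bounded_bilinear_inner assms])

text \<open>\<open>d_constraint1\<close> and \<open>d_constraint2\<close> are the derivatives of the
  two equations of \<open>cotangent_Q\<close> at \<open>(q, p)\<close> in the direction
  \<open>(X, Y)\<close>. They use that \<open>Eta\<close> moves by \<open>Eta q * prim X\<close> and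
  \<open>Phi\<close> by the primitive of this.\<close>

definition d_constraint1 :: "L2 \<Rightarrow> L2 \<Rightarrow> L2 \<Rightarrow> L2 \<Rightarrow> real" where
  "d_constraint1 q p X Y = inner Y (cls (Eta q)) + inner p (cls (Eta q * prim X))"

definition d_constraint2 :: "L2 \<Rightarrow> L2 \<Rightarrow> L2 \<Rightarrow> L2 \<Rightarrow> real" where
  "d_constraint2 q p X Y = inner Y (cls (Phi q * Eta q)) +
     inner p (cls (prim (cls (Eta q * prim X)) * Eta q + Phi q * (Eta q * prim X)))"

lemma has_vector_derivative_constraints:
  assumes q: "(q has_vector_derivative X) (at t within S)" and p: "(p has_vector_derivative Y) (at t within S)"
  shows "((\<lambda>t. inner (p t) (cls (Eta (q t)))) has_vector_derivative d_constraint1 (q t) (p t) X Y) (at t within S)"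
    "((\<lambda>t. inner (p t) (cls (Phi (q t) * Eta (q t)))) has_vector_derivative d_constraint2 (q t) (p t) X Y) (at t within S)"
proof -
  show "((\<lambda>t. inner (p t) (cls (Eta (q t)))) has_vector_derivative d_constraint1 (q t) (p t) X Y) (at t within S)"
    using has_vector_derivative_inner[OF p has_vector_derivative_cls[OF has_vector_derivative_Eta[OF q], of one_L2]]
    by (simp add: d_constraint1_def add.commute)
  show "((\<lambda>t. inner (p t) (cls (Phi (q t) * Eta (q t)))) has_vector_derivative d_constraint2 (q t) (p t) X Y) (at t within S)"
    using has_vector_derivative_inner[OF p has_vector_derivative_cls[OF has_vector_derivative_mult[OF
      has_vector_derivative_Phi[OF q] has_vector_derivative_Eta[OF q]], of one_L2]]
    by (simp add: d_constraint2_def add.commute)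
qed

lemma has_vector_derivative_line: "((\<lambda>s. a + s *\<^sub>R b) has_vector_derivative b) (at s within S)"
  for b :: "'a::real_normed_vector"
  by (auto intro!: derivative_eq_intros simp: has_vector_derivative_def)

text \<open>The derivatives along the line exist for every direction, so requiring them to be 0
  amounts to two linear equations.\<close>

lemma tangent_cotangent_iff:
  "(X, Y) \<in> tangent_cotangent q p \<longleftrightarrow> X \<in> tangent_Q q \<and> d_constraint1 q p X Y = 0 \<and> d_constraint2 q p X Y = 0"
proof -
  have iff: "(f has_real_derivative 0) (at 0) \<longleftrightarrow> D = 0" if "(f has_real_derivative D) (at 0)" for f D
    using that by (metis DERIV_unique)
  note c = has_vector_derivative_constraints[OF has_vector_derivative_line[of q X 0 UNIV] has_vector_derivative_line[of p Y 0 UNIV]]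
  have "((\<lambda>s. inner (p + s *\<^sub>R Y) (cls (Eta (q + s *\<^sub>R X)))) has_real_derivative d_constraint1 q p X Y) (at 0)"
    "((\<lambda>s. inner (p + s *\<^sub>R Y) (cls (Phi (q + s *\<^sub>R X) * Eta (q + s *\<^sub>R X)))) has_real_derivative d_constraint2 q p X Y) (at 0)"
    using c by (simp_all only: has_real_derivative_iff_has_vector_derivative scaleR_zero_left add_0_right)
  then show ?thesis
    unfolding tangent_cotangent_def LINT_cotangent by (simp only: iff mem_Collect_eq case_prod_conv)
qed

text \<open>Since \<phi>' = \<eta> and \<phi> runs from 0 to 1, these are the integrals of 1, y and
  y^2 over [0, 1]: the entries of \<open>H2\<close>. Integration by parts yields them without
  substitution.\<close>

lemma moments_Eta:
  assumes "q \<in> Q"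
  shows "inner one_L2 (cls (Eta q)) = 1" "inner (cls (Phi q)) (cls (Eta q)) = 1/2"
    "inner one_L2 (cls (Phi q * Eta q)) = 1/2" "inner (cls (Phi q)) (cls (Phi q * Eta q)) = 1/3"
    "primitive (cls (Phi q * Eta q)) one_L2 = (1/2) *\<^sub>R (Phi q * Phi q)"
proof -
  show 0: "inner one_L2 (cls (Eta q)) = 1" using assms by (simp add: Q_iff inner_commute)
  have 1: "inner (cls (Eta q)) one_L2 = 1" using assms by (simp add: Q_iff)
  have F: "primitive (cls (Eta q)) one_L2 = Phi q" by (simp add: Phi_def)
  show half: "inner (cls (Phi q)) (cls (Eta q)) = 1/2" "inner one_L2 (cls (Phi q * Eta q)) = 1/2"
    using integration_by_parts[of "cls (Eta q)" one_L2 "cls (Eta q)" one_L2] 1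
    by (simp_all add: F inner_act_normalize)
  show FF: "primitive (cls (Phi q * Eta q)) one_L2 = (1/2) *\<^sub>R (Phi q * Phi q)"
    using primitive_times_primitive[of "cls (Eta q)" one_L2 "cls (Eta q)" one_L2]
    by (simp add: F act_act flip: scaleR_2)
  show "inner (cls (Phi q)) (cls (Phi q * Eta q)) = 1/3"
    using integration_by_parts[of "cls (Phi q * Eta q)" one_L2 "cls (Eta q)" one_L2] 1 half
    by (simp add: F FF FF[unfolded mult.commute[of "Phi q" "Eta q"]] inner_act_normalize act.scaleR_left)
qed

lemma velocity_tangent_iff: "velocity q p \<in> tangent_Q q \<longleftrightarrow> p \<in> cotangent_Q q"
  by (simp add: tangent_Q_iff cotangent_Q_iff velocity_eq inner_act_normalize)

lemma velocity_momentum: "velocity q (momentum q X) = X"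
  by (simp add: velocity_eq momentum_eq Eta_def)

lemma momentum_cotangent: "X \<in> tangent_Q q \<Longrightarrow> momentum q X \<in> cotangent_Q q"
  by (simp add: velocity_momentum flip: velocity_tangent_iff)

text \<open>Let X = \<eta> p be the velocity and \<open>U\<close> its primitive; \<open>U\<close>
  vanishes at 1 because \<open>p\<close> is a covector. The first constraint moves by the integral
  of U X, half of U(1)^2, hence by 0. In the second, integration by parts turns the two terms into
  -1 and -1/2 times the integral of U^2 \<eta>; this is where the factor 3/2 of
  \<open>coeff_b\<close> comes from.\<close>

lemma d_constraint_velocity:
  assumes q: "q \<in> Q" and p: "p \<in> cotangent_Q q"
  shows "d_constraint1 q p (velocity q p) Y = inner Y (cls (Eta q))"
    "d_constraint2 q p (velocity q p) Y = inner Y (cls (Phi q * Eta q)) - coeff_b q p"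
proof -
  define X where "X = act (Eta q) p"
  define U where "U = prim X"
  have X0: "inner X one_L2 = 0" "inner (act (Phi q) X) one_L2 = 0"
    using p by (simp_all add: cotangent_Q_iff X_def inner_act_normalize)
  have UX: "inner (act U X) one_L2 = 0"
    using integration_by_parts[of X one_L2 X one_L2] X0 by (simp add: U_def)
  have pU: "primitive (act U X) one_L2 = (1/2) *\<^sub>R (U * U)"
    using primitive_times_primitive[of X one_L2 X one_L2] by (simp add: U_def flip: scaleR_2)
  have 1: "inner (act (prim (cls (Eta q * U))) X) one_L2 = - inner (cls (U * U * Eta q)) one_L2"
    using integration_by_parts[of X one_L2 "cls (Eta q * U)" one_L2] X0
    by (simp add: U_def[symmetric] inner_act_normalize)
  have 2: "inner (act (Phi q * U) X) one_L2 = - (1/2) * inner (cls (U * U * Eta q)) one_L2"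
    using integration_by_parts[of "act U X" one_L2 "cls (Eta q)" one_L2] UX
    by (simp add: pU Phi_def[symmetric] inner_act_normalize act.scaleR_left)
  show "d_constraint1 q p (velocity q p) Y = inner Y (cls (Eta q))"
    using UX by (simp add: d_constraint1_def velocity_eq X_def[symmetric] U_def[symmetric])
      (simp add: X_def inner_act_normalize)
  have "inner p (cls (prim (cls (Eta q * U)) * Eta q + Phi q * (Eta q * U))) =
      inner (act (prim (cls (Eta q * U))) X) one_L2 + inner (act (Phi q * U) X) one_L2"
    by (simp add: X_def inner_act_normalize act.add_left inner_add_right)
  then show "d_constraint2 q p (velocity q p) Y = inner Y (cls (Phi q * Eta q)) - coeff_b q p"
    by (simp add: d_constraint2_def velocity_eq X_def[symmetric] U_def[symmetric] 1 2 coeff_b_eq[OF q])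
qed

text \<open>The integral term of the force has moments -a and -c against \<eta> and \<phi> \<eta>,
  while the multipliers contribute a and b + c by the choice of \<open>H2\<close>. What remains is 0
  and b, exactly what cancels the motion of the constraints along the velocity.\<close>

lemma force_moments:
  assumes q: "q \<in> Q"
  shows "inner (force q p) (cls (Eta q)) = 0" "inner (force q p) (cls (Phi q * Eta q)) = coeff_b q p"
proof -
  let ?N = "inner (act (Eta q) p) p"
  have expand: "inner (force q p) Z = 1/2 * inner (cls (pot q p)) Z + (force1 q p - 1/2 * ?N) * inner one_L2 Z +
      force2 q p * inner (cls (Phi q)) Z" for Z
    by (simp only: force_eq inner_add_left inner_scaleR_left)
  have 1: "inner (cls (Eta q)) one_L2 = 1" using q by (simp add: Q_iff)
  have 2: "inner (cls (Phi q * Eta q)) one_L2 = 1/2" using moments_Eta(3)[OF q] by (simp add: inner_commute)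
  have *: "1/2 * P + (4 * a - 6 * (b + c) - 1/2 * N) * 1 + (12 * (b + c) - 6 * a) * (1/2) = 0"
    if "P = N - 2 * a" for P N a b c :: real
    unfolding that by (simp add: algebra_simps)
  have **: "1/2 * P + (4 * a - 6 * (b + c) - 1/2 * N) * (1/2) + (12 * (b + c) - 6 * a) * (1/3) = b"
    if "P = N / 2 - 2 * c" for P N a b c :: real
    unfolding that by (simp add: algebra_simps)
  have "inner (cls (pot q p)) (cls (Eta q)) = ?N - 2 * coeff_a q p"
    using integration_by_parts[of "act (Eta q) p" p "cls (Eta q)" one_L2] 1
    by (simp add: coeff_a_eq[OF q] pot_def Phi_def[symmetric] inner_act_normalize)
  then show "inner (force q p) (cls (Eta q)) = 0"
    unfolding expand moments_Eta[OF q] force1_def force2_def by (rule *)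
  have "inner (cls (pot q p)) (cls (Phi q * Eta q)) = ?N / 2 - 2 * coeff_c q p"
    using integration_by_parts[of "act (Eta q) p" p "cls (Phi q * Eta q)" one_L2, unfolded 2]
    by (simp add: coeff_c_eq[OF q] pot_def moments_Eta(5)[OF q]
        moments_Eta(5)[OF q, unfolded mult.commute[of "Phi q" "Eta q"]] act.scaleR_left inner_act_normalize)
      (simp add: field_simps)
  then show "inner (force q p) (cls (Phi q * Eta q)) = coeff_b q p"
    unfolding expand moments_Eta[OF q] force1_def force2_def by (rule **)
qed

lemma velocity_force_tangent:
  assumes "q \<in> Q" "p \<in> cotangent_Q q"
  shows "(velocity q p, force q p) \<in> tangent_cotangent q p"
  unfolding tangent_cotangent_iff velocity_tangent_iff d_constraint_velocity[OF assms] force_moments[OF assms(1)]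
  using assms by simp

text \<open>The multipliers disappear, because a tangent vector is orthogonal to 1 and \<phi>; in
  the remaining term integration by parts has no boundary term, as \<open>X\<close> has mean 0. The
  right hand side is minus the derivative of the Hamiltonian along \<open>X\<close>.\<close>

lemma inner_tangent_force:
  assumes "X \<in> tangent_Q q"
  shows "inner X (force q p) = - (1/2) * inner (act (Eta q * prim X) p) p"
proof -
  have X: "inner X one_L2 = 0" "inner X (cls (Phi q)) = 0" using assms by (simp_all add: tangent_Q_iff)
  have "inner X (cls (pot q p)) = - inner (act (Eta q * prim X) p) p"
    using integration_by_parts[of "act (Eta q) p" p X one_L2] X
    by (simp add: pot_def inner_act_normalize)
  then show ?thesis by (simp add: force_eq inner_add_right X)
qed

lemma has_real_derivative_hamiltonian:
  "((\<lambda>s. hamiltonian (q + s *\<^sub>R X) (p + s *\<^sub>R Y)) has_real_derivative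
     inner (velocity q p) Y + 1/2 * inner (act (Eta q * prim X) p) p) (at 0)"
proof -
  note q = has_vector_derivative_line[of q X 0 UNIV] and p = has_vector_derivative_line[of p Y 0 UNIV]
  have "((\<lambda>s. inner (act (Eta (q + s *\<^sub>R X)) (p + s *\<^sub>R Y)) (p + s *\<^sub>R Y)) has_vector_derivative
      inner (act (Eta q) p) Y + (inner (act (Eta q) Y + act (Eta q * prim X) p) p)) (at 0)"
    using has_vector_derivative_inner[OF act.has_vector_derivative[OF has_vector_derivative_Eta[OF q] p] p]
    by (simp only: scaleR_zero_left add_0_right)
  moreover have "inner (act (Eta q) p) Y + (inner (act (Eta q) Y + act (Eta q * prim X) p) p) =
      2 * inner (act (Eta q) p) Y + inner (act (Eta q * prim X) p) p"
    using inner_act_left_commute[of "Eta q" Y p] inner_add_left[of "act (Eta q) Y" "act (Eta q * prim X) p" p] by linarith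
  ultimately have d: "((\<lambda>s. inner (act (Eta (q + s *\<^sub>R X)) (p + s *\<^sub>R Y)) (p + s *\<^sub>R Y)) has_real_derivative
      2 * inner (act (Eta q) p) Y + inner (act (Eta q * prim X) p) p) (at 0)"
    by (simp only: has_real_derivative_iff_has_vector_derivative)
  show ?thesis unfolding hamiltonian_eq velocity_eq
    by (rule DERIV_cong[OF DERIV_cmult[OF d, of "1/2"]]) simp
qed

lemma d_constraint_diff:
  "d_constraint1 q p (X - X') (Y - Y') = d_constraint1 q p X Y - d_constraint1 q p X' Y'"
  "d_constraint2 q p (X - X') (Y - Y') = d_constraint2 q p X Y - d_constraint2 q p X' Y'"
proof -
  have 1: "Eta q * prim (X - X') = Eta q * prim X - Eta q * prim X'"
    by (simp only: primitive.diff_left right_diff_distrib)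
  have 2: "prim (cls (Eta q * prim X - Eta q * prim X')) * Eta q + Phi q * (Eta q * prim X - Eta q * prim X') =
      (prim (cls (Eta q * prim X)) * Eta q + Phi q * (Eta q * prim X)) -
      (prim (cls (Eta q * prim X')) * Eta q + Phi q * (Eta q * prim X'))"
    by (simp only: primitive.diff_left act.diff_left right_diff_distrib left_diff_distrib add_diff_add)
  show "d_constraint1 q p (X - X') (Y - Y') = d_constraint1 q p X Y - d_constraint1 q p X' Y'"
    unfolding d_constraint1_def 1 act.diff_left inner_diff_left inner_diff_right by simp
  show "d_constraint2 q p (X - X') (Y - Y') = d_constraint2 q p X Y - d_constraint2 q p X' Y'"
    unfolding d_constraint2_def 1 2 unfolding act.diff_left[of _ _ one_L2] inner_diff_left inner_diff_right by simp
qed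

lemma tangent_Q_diff: "X \<in> tangent_Q q \<Longrightarrow> Y \<in> tangent_Q q \<Longrightarrow> X - Y \<in> tangent_Q q"
  by (simp add: tangent_Q_iff inner_diff_left)

text \<open>Uniqueness is the nondegeneracy of the symplectic form on the tangent space of the
  bundle: the difference (\<open>D1\<close>, \<open>D2\<close>) of two solutions is tangent and
  pairs to zero with every tangent vector, and suitable test vectors show that it vanishes.\<close>

lemma hamiltonian_vector_iff:
  assumes q: "q \<in> Q" and p: "p \<in> cotangent_Q q"
  shows "is_hamiltonian_vector q p V \<longleftrightarrow> V = (velocity q p, force q p)"
proof -
  have dH: "((\<lambda>s. hamiltonian (q + s *\<^sub>R fst W) (p + s *\<^sub>R snd W)) has_real_derivative
      symplectic_form (velocity q p, force q p) W) (at 0)" if "W \<in> tangent_cotangent q p" for W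
  proof -
    have "fst W \<in> tangent_Q q" using that by (simp add: tangent_cotangent_def split_beta)
    from inner_tangent_force[OF this, of p] show ?thesis
      using has_real_derivative_hamiltonian[of q "fst W" p "snd W"] by (simp add: symplectic_form_def)
  qed
  have "V = (velocity q p, force q p)"
    if V: "V \<in> tangent_cotangent q p"
      and w: "\<And>W. W \<in> tangent_cotangent q p \<Longrightarrow> symplectic_form V W = symplectic_form (velocity q p, force q p) W"
  proof -
    define D1 D2 where "D1 = fst V - velocity q p" and "D2 = snd V - force q p"
    have tan: "D1 \<in> tangent_Q q" "d_constraint1 q p D1 D2 = 0" "d_constraint2 q p D1 D2 = 0"
      using velocity_force_tangent[OF q p] V tangent_cotangent_iff[of "fst V" "snd V" q p]
      by (simp_all add: D1_def D2_def d_constraint_diff tangent_cotangent_iff tangent_Q_diff)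
    have zero: "inner D1 Y = inner X D2" if "(X, Y) \<in> tangent_cotangent q p" for X Y
      using w[OF that] by (simp add: symplectic_form_def D1_def D2_def inner_diff_left inner_diff_right)
    \<comment> \<open>A vertical vector is tangent when its second component lies in
      \<open>cotangent_Q\<close>; here it is the momentum of \<open>D1\<close>, so the pairing is
      the squared metric norm of \<open>D1\<close>.\<close>
    have "(0, act (exp (- prim q)) D1) \<in> tangent_cotangent q p"
      using momentum_cotangent[OF tan(1)]
      by (simp add: tangent_cotangent_iff tangent_Q_iff cotangent_Q_iff momentum_eq d_constraint1_def d_constraint2_def
          primitive.zero_left act.zero_left)
    from zero[OF this] have "inner (act (exp (- prim q)) D1) D1 = 0" by (simp add: inner_commute)
    then have D1: "D1 = 0" by (rule inner_act_exp_eq_0)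
    have D2: "D2 \<in> cotangent_Q q"
      using tan(2,3) by (simp add: D1 d_constraint1_def d_constraint2_def primitive.zero_left act.zero_left cotangent_Q_iff)
    define X where "X = velocity q D2"
    have X: "X \<in> tangent_Q q" using D2 by (simp add: X_def velocity_tangent_iff)
    define r1 r2 where "r1 = d_constraint1 q p X 0" and "r2 = d_constraint2 q p X 0"
    \<comment> \<open>\<open>Y\<close> lifts \<open>X\<close> to the tangent space of the bundle.
      Its coefficients are minus the inverse of \<open>H2\<close> applied to the defects
      (\<open>r1\<close>, \<open>r2\<close>). As \<open>D1 = 0\<close>, the pairing does not see
      it.\<close>
    define Y where "Y = (6 * r2 - 4 * r1) *\<^sub>R one_L2 + (6 * r1 - 12 * r2) *\<^sub>R cls (Phi q)"
    have "d_constraint1 q p X Y = inner Y (cls (Eta q)) + r1" "d_constraint2 q p X Y = inner Y (cls (Phi q * Eta q)) + r2"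
      by (simp_all add: d_constraint1_def d_constraint2_def r1_def r2_def)
    then have "(X, Y) \<in> tangent_cotangent q p"
      using X by (simp add: tangent_cotangent_iff Y_def inner_add_left moments_Eta[OF q])
        (simp add: field_simps)
    from zero[OF this] have "inner (act (exp (prim q)) D2) D2 = 0"
      by (simp add: D1 X_def velocity_eq Eta_def)
    then have "D2 = 0" by (rule inner_act_exp_eq_0)
    then show ?thesis using D1 by (simp add: D1_def D2_def prod_eq_iff)
  qed
  moreover have "is_hamiltonian_vector q p V" if "V = (velocity q p, force q p)"
    unfolding is_hamiltonian_vector_def using dH velocity_force_tangent[OF q p] that by simp
  moreover have "symplectic_form V W = symplectic_form (velocity q p, force q p) W"
    if "is_hamiltonian_vector q p V" "W \<in> tangent_cotangent q p" for W
    using that dH[OF that(2)] unfolding is_hamiltonian_vector_def by (blast intro: DERIV_unique)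
  ultimately show ?thesis unfolding is_hamiltonian_vector_def by metis
qed

subsection \<open>Curves in the manifold\<close>

lemma has_vector_derivative_const_on:
  assumes "(f has_vector_derivative D) (at t within S)" "\<And>u. u \<in> S \<Longrightarrow> f u = k" "t \<in> S" "at t within S \<noteq> bot"
  shows "D = 0"
proof -
  have "((\<lambda>_. k) has_vector_derivative D) (at t within S)"
    by (rule has_vector_derivative_transform[OF assms(3) _ assms(1)]) (simp add: assms(2))
  then show ?thesis
    using vector_derivative_unique_within[OF assms(4) _ has_vector_derivative_const] by blast
qed

text \<open>The left side is the derivative of the integral of \<eta> along \<open>X\<close>;
  integration by parts turns it into the second equation of \<open>tangent_Q\<close>, using
  \<phi>(1) = 1 and that \<open>X\<close> has mean 0.\<close>

lemma inner_cls_Eta_prim: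
  assumes "q \<in> Q" "inner X one_L2 = 0"
  shows "inner (cls (Eta q * prim X)) one_L2 = - inner X (cls (Phi q))"
proof -
  have "inner (cls (Eta q)) one_L2 = 1" using assms(1) by (simp add: Q_iff)
  then show ?thesis
    using integration_by_parts[of "cls (Eta q)" one_L2 X one_L2] assms(2)
    by (simp add: Phi_def[symmetric] inner_act_normalize)
qed

lemma tangent_Q_curve:
  assumes d: "(\<gamma> has_vector_derivative X) (at t within S)" and Q: "\<And>u. u \<in> S \<Longrightarrow> \<gamma> u \<in> Q"
    and t: "t \<in> S" "at t within S \<noteq> bot"
  shows "X \<in> tangent_Q (\<gamma> t)"
proof -
  have "inner X one_L2 = 0"
    by (rule has_vector_derivative_const_on[OF bounded_linear.has_vector_derivative[OF bounded_linear_inner_left d] _ t])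
      (use Q in \<open>auto simp: Q_iff\<close>)
  moreover have "inner (cls (Eta (\<gamma> t) * prim X)) one_L2 = 0"
    by (rule has_vector_derivative_const_on[OF bounded_linear.has_vector_derivative[OF bounded_linear_inner_left
        has_vector_derivative_cls[OF has_vector_derivative_Eta[OF d]]] _ t])
      (use Q in \<open>auto simp: Q_iff\<close>)
  ultimately show ?thesis
    using inner_cls_Eta_prim[OF Q[OF t(1)]] by (simp add: tangent_Q_iff)
qed

lemma cotangent_curve:
  assumes q: "(q has_vector_derivative X) (at t within S)" and p: "(p has_vector_derivative Y) (at t within S)"
    and cot: "\<And>u. u \<in> S \<Longrightarrow> p u \<in> cotangent_Q (q u)" and t: "t \<in> S" "at t within S \<noteq> bot"
  shows "d_constraint1 (q t) (p t) X Y = 0" "d_constraint2 (q t) (p t) X Y = 0"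
proof -
  show "d_constraint1 (q t) (p t) X Y = 0"
    by (rule has_vector_derivative_const_on[OF has_vector_derivative_constraints(1)[OF q p] _ t])
      (use cot in \<open>auto simp: cotangent_Q_iff\<close>)
  show "d_constraint2 (q t) (p t) X Y = 0"
    by (rule has_vector_derivative_const_on[OF has_vector_derivative_constraints(2)[OF q p] _ t])
      (use cot in \<open>auto simp: cotangent_Q_iff\<close>)
qed

subsection \<open>Continuity\<close>

lemmas continuous_on_act = bounded_bilinear.continuous_on[OF bounded_bilinear_act]
lemmas continuous_on_primitive = bounded_bilinear.continuous_on[OF bounded_bilinear_primitive]

lemma continuous_on_prim: "continuous_on S q \<Longrightarrow> continuous_on S (\<lambda>t. prim (q t))"
  by (intro continuous_on_primitive continuous_on_const)

lemma continuous_on_cls: "continuous_on S g \<Longrightarrow> continuous_on S (\<lambda>t. act (g t) X)"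
  by (intro continuous_on_act continuous_on_const)

lemma continuous_on_Eta: "continuous_on S q \<Longrightarrow> continuous_on S (\<lambda>t. Eta (q t))"
  unfolding Eta_def by (intro continuous_on_exp_bcontfun continuous_on_prim)

lemma continuous_on_Phi: "continuous_on S q \<Longrightarrow> continuous_on S (\<lambda>t. Phi (q t))"
  unfolding Phi_def by (intro continuous_on_prim continuous_on_cls continuous_on_Eta)

text \<open>The formulas without \<open>phi_inv\<close> make the three coefficients continuous.
  Needed because a geodesic must have a continuous second derivative, which along a solution
  contains the force.\<close>

lemma continuous_on_force:
  fixes q p :: "'a::topological_space \<Rightarrow> L2"
  assumes q: "continuous_on S q" and p: "continuous_on S p" and Q: "\<And>t. t \<in> S \<Longrightarrow> q t \<in> Q"
  shows "continuous_on S (\<lambda>t. force (q t) (p t))"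
proof -
  have "continuous_on S (\<lambda>t. 1/2 * inner (act (Phi (q t) * Eta (q t)) (p t)) (p t))"
    by (intro continuous_on_mult continuous_on_const continuous_on_inner continuous_on_act continuous_on_Eta continuous_on_Phi q p)
  then have a: "continuous_on S (\<lambda>t. coeff_a (q t) (p t))"
    by (rule continuous_on_eq) (simp add: coeff_a_eq Q)
  have "continuous_on S (\<lambda>t. 3/2 * inner (cls (prim (act (Eta (q t)) (p t)) * prim (act (Eta (q t)) (p t)) * Eta (q t))) one_L2)"
    by (intro continuous_on_mult continuous_on_const continuous_on_inner continuous_on_act continuous_on_Eta
        continuous_on_prim q p)
  then have b: "continuous_on S (\<lambda>t. coeff_b (q t) (p t))"
    by (rule continuous_on_eq) (simp add: coeff_b_eq Q)
  have "continuous_on S (\<lambda>t. 1/4 * inner (act (Phi (q t) * Phi (q t) * Eta (q t)) (p t)) (p t))"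
    by (intro continuous_on_mult continuous_on_const continuous_on_inner continuous_on_act continuous_on_Eta continuous_on_Phi q p)
  then have c: "continuous_on S (\<lambda>t. coeff_c (q t) (p t))"
    by (rule continuous_on_eq) (simp add: coeff_c_eq Q)
  show ?thesis
    unfolding force_eq force1_def force2_def pot_def
    by (intro continuous_on_add continuous_on_diff continuous_on_scaleR continuous_on_mult continuous_on_const
        continuous_on_inner continuous_on_act continuous_on_primitive continuous_on_Eta continuous_on_Phi q p a b c)
qed

text \<open>A proper variation has jointly continuous derivatives, but nothing of the kind is asked
  of \<open>c\<close> itself. As \<open>cs\<close> is bounded on the compact rectangle,
  \<open>c\<close> is Lipschitz in \<open>s\<close> uniformly in \<open>t\<close>, and this combines
  with continuity in \<open>t\<close>.\<close>

lemma joint_continuity: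
  fixes c :: "real \<Rightarrow> real \<Rightarrow> 'a::real_normed_vector"
  assumes d: "\<And>s t. s \<in> {a..b} \<Longrightarrow> t \<in> {t0..t1} \<Longrightarrow> ((\<lambda>s. c s t) has_vector_derivative cs s t) (at s within {a..b})"
    and cs: "continuous_on ({a..b} \<times> {t0..t1}) (\<lambda>(s, t). cs s t)"
    and ct: "\<And>s. s \<in> {a..b} \<Longrightarrow> continuous_on {t0..t1} (c s)"
  shows "continuous_on ({a..b} \<times> {t0..t1}) (\<lambda>(s, t). c s t)"
proof -
  have "bounded ((\<lambda>(s, t). cs s t) ` ({a..b} \<times> {t0..t1}))"
    by (intro compact_imp_bounded compact_continuous_image cs compact_Times) auto
  then obtain B where B: "\<And>s t. s \<in> {a..b} \<Longrightarrow> t \<in> {t0..t1} \<Longrightarrow> norm (cs s t) \<le> B"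
    unfolding bounded_iff by force
  have lip: "norm (c s t - c s' t) \<le> B * norm (s - s')"
    if "s \<in> {a..b}" "s' \<in> {a..b}" "t \<in> {t0..t1}" for s s' t
  proof (rule differentiable_bound[of "{a..b}" "\<lambda>s. c s t" "\<lambda>s h. h *\<^sub>R cs s t"])
    show "((\<lambda>s. c s t) has_derivative (\<lambda>h. h *\<^sub>R cs x t)) (at x within {a..b})" if "x \<in> {a..b}" for x
      using d[OF that \<open>t \<in> _\<close>] by (simp add: has_vector_derivative_def)
    show "onorm (\<lambda>h. h *\<^sub>R cs x t) \<le> B" if "x \<in> {a..b}" for x
      using B[OF that \<open>t \<in> _\<close>] order_trans[OF norm_ge_zero B[OF that \<open>t \<in> _\<close>]]
      by (intro onorm_bound) (simp_all add: mult.commute[of B] mult_left_mono)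
  qed (use that in auto)
  show ?thesis
    unfolding continuous_on_eq_continuous_within
  proof (clarify)
    fix s t assume st: "s \<in> {a..b}" "t \<in> {t0..t1}"
    let ?F = "at (s, t) within {a..b} \<times> {t0..t1}"
    have F: "eventually (\<lambda>z. fst z \<in> {a..b} \<and> snd z \<in> {t0..t1}) ?F"
      unfolding eventually_at_filter by (rule always_eventually) auto
    have "((\<lambda>z. c s (snd z)) \<longlongrightarrow> c s t) ?F"
    proof -
      have "continuous_on ({a..b} \<times> {t0..t1}) (\<lambda>z. c s (snd z))"
        by (rule continuous_on_compose2[OF ct[OF st(1)] continuous_on_snd]) auto
      then show ?thesis using st by (auto simp: continuous_on_def)
    qed
    moreover have "((\<lambda>z. fst z) \<longlongrightarrow> s) ?F"
      using tendsto_fst[OF tendsto_ident_at[of "(s, t)" "{a..b} \<times> {t0..t1}"]] by simp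
    ultimately have 1: "((\<lambda>z. B * norm (fst z - s) + norm (c s (snd z) - c s t)) \<longlongrightarrow> B * norm (s - s) + norm (c s t - c s t)) ?F"
      by (intro tendsto_intros)
    have "((\<lambda>z. c (fst z) (snd z) - c s t) \<longlongrightarrow> 0) ?F"
    proof (rule Lim_null_comparison)
      show "\<forall>\<^sub>F z in ?F. norm (c (fst z) (snd z) - c s t) \<le> B * norm (fst z - s) + norm (c s (snd z) - c s t)"
        using F
      proof eventually_elim
        case (elim z)
        then show ?case
          using lip[of "fst z" s "snd z"] st
            norm_triangle_ineq[of "c (fst z) (snd z) - c s (snd z)" "c s (snd z) - c s t"] by simp
      qed
      show "((\<lambda>z. B * norm (fst z - s) + norm (c s (snd z) - c s t)) \<longlongrightarrow> 0) ?F" using 1 by simp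
    qed
    then show "continuous ?F (\<lambda>(s, t). c s t)"
      unfolding continuous_within split_beta fst_conv snd_conv by (rule LIM_zero_cancel)
  qed
qed

subsection \<open>The first variation of the energy\<close>

text \<open>The weight 1/\<eta> moves by -1/\<eta> times the primitive of \<open>X\<close>, and the
  symmetry of multiplication merges the two terms that contain \<open>W\<close>.\<close>

lemma has_vector_derivative_lagrangian:
  assumes q: "(q has_vector_derivative X) (at t within S)" and v: "(v has_vector_derivative W) (at t within S)"
  shows "((\<lambda>t. inner (act (exp (- prim (q t))) (v t)) (v t)) has_vector_derivative
     2 * inner (act (exp (- prim (q t))) (v t)) W - inner (act (exp (- prim (q t)) * prim X) (v t)) (v t)) (at t within S)"
proof -
  have "((\<lambda>t. exp (- prim (q t))) has_vector_derivative exp (- prim (q t)) * - prim X) (at t within S)"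
    by (intro has_vector_derivative_exp_bcontfun has_vector_derivative_minus
        bounded_linear.has_vector_derivative[OF primitive.bounded_linear_left] q)
  from has_vector_derivative_inner[OF act.has_vector_derivative[OF this v] v]
  have *: "((\<lambda>t. inner (act (exp (- prim (q t))) (v t)) (v t)) has_vector_derivative
     inner (act (exp (- prim (q t))) (v t)) W +
     inner (act (exp (- prim (q t))) W + act (exp (- prim (q t)) * - prim X) (v t)) (v t)) (at t within S)" .
  have "inner (act (exp (- prim (q t))) (v t)) W +
     inner (act (exp (- prim (q t))) W + act (exp (- prim (q t)) * - prim X) (v t)) (v t) =
     2 * inner (act (exp (- prim (q t))) (v t)) W - inner (act (exp (- prim (q t)) * prim X) (v t)) (v t)"
    using inner_act_left_commute[of "exp (- prim (q t))" W "v t"]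
    by (simp only: mult_minus_right act.minus_left inner_add_left inner_minus_left)
  with * show ?thesis by (simp only:)
qed

lemma energy_eq:
  assumes t: "t0 < t1" and d: "\<And>t. t \<in> {t0..t1} \<Longrightarrow> (c has_vector_derivative v t) (at t within {t0..t1})"
    and v: "continuous_on {t0..t1} v"
  shows "energy t0 t1 c = 1/2 * integral {t0..t1} (\<lambda>t. inner (act (exp (- prim (c t))) (v t)) (v t))"
proof -
  have c: "continuous_on {t0..t1} c" using d by (rule continuous_on_vector_derivative)
  have vd: "vector_derivative c (at t within {t0..t1}) = v t" if "t \<in> {t0..t1}" for t
    using vector_derivative_within_cbox[of t0 t1 t c "v t"] d[OF that] t that by simp
  have "(LINT t:{t0..t1}|lborel. metric_G (c t) (vector_derivative c (at t within {t0..t1})) (vector_derivative c (at t within {t0..t1})))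
    = (LINT t:{t0..t1}|lborel. inner (act (exp (- prim (c t))) (v t)) (v t))"
    by (rule set_lebesgue_integral_cong) (auto simp: vd metric_G_eq)
  also have "\<dots> = integral {t0..t1} (\<lambda>t. inner (act (exp (- prim (c t))) (v t)) (v t))"
    by (intro set_borel_integral_eq_integral(2) borel_integrable_atLeastAtMost' continuous_on_inner continuous_on_act
        continuous_on_exp_bcontfun continuous_on_minus continuous_on_prim c v)
  finally show ?thesis unfolding energy_def by simp
qed

text \<open>Differentiation under the integral gives a term in the mixed derivative and one in
  \<open>cs\<close>. The former is integrated by parts in time against the momentum; the latter is
  the pairing with the force, because \<open>cs\<close> is tangent to \<open>Q\<close>.\<close>

lemma first_variation:
  fixes c cs ct cst :: "real \<Rightarrow> real \<Rightarrow> L2"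
  assumes t: "t0 < t1" and \<delta>: "\<delta> > 0"
    and ends: "\<And>s. s \<in> {-\<delta><..<\<delta>} \<Longrightarrow> c s t0 = c 0 t0 \<and> c s t1 = c 0 t1"
    and Q: "\<And>s t. s \<in> {-\<delta><..<\<delta>} \<Longrightarrow> t \<in> {t0..t1} \<Longrightarrow> c s t \<in> Q"
    and cs: "\<And>s t. s \<in> {-\<delta><..<\<delta>} \<Longrightarrow> t \<in> {t0..t1} \<Longrightarrow> ((\<lambda>s. c s t) has_vector_derivative cs s t) (at s)"
    and ct: "\<And>s t. s \<in> {-\<delta><..<\<delta>} \<Longrightarrow> t \<in> {t0..t1} \<Longrightarrow> (c s has_vector_derivative ct s t) (at t within {t0..t1})"
    and cts: "\<And>s t. s \<in> {-\<delta><..<\<delta>} \<Longrightarrow> t \<in> {t0..t1} \<Longrightarrow> ((\<lambda>s. ct s t) has_vector_derivative cst s t) (at s)"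
    and cst: "\<And>s t. s \<in> {-\<delta><..<\<delta>} \<Longrightarrow> t \<in> {t0..t1} \<Longrightarrow> (cs s has_vector_derivative cst s t) (at t within {t0..t1})"
    and cs_cont: "continuous_on ({-\<delta><..<\<delta>} \<times> {t0..t1}) (\<lambda>(s, t). cs s t)"
    and ct_cont: "continuous_on ({-\<delta><..<\<delta>} \<times> {t0..t1}) (\<lambda>(s, t). ct s t)"
    and cst_cont: "continuous_on ({-\<delta><..<\<delta>} \<times> {t0..t1}) (\<lambda>(s, t). cst s t)"
    and p: "\<And>t. t \<in> {t0..t1} \<Longrightarrow> p t = momentum (c 0 t) (ct 0 t)"
    and pd: "\<And>t. t \<in> {t0..t1} \<Longrightarrow> (p has_vector_derivative pd t) (at t within {t0..t1})"
  shows "((\<lambda>s. energy t0 t1 (c s)) has_real_derivative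
      integral {t0..t1} (\<lambda>t. inner (cs 0 t) (force (c 0 t) (p t) - pd t))) (at 0)"
proof -
  \<comment> \<open>A closed interval of parameters is required for the joint continuity of
    \<open>c\<close>.\<close>
  define r where "r = \<delta> / 2"
  define U where "U = {-r..r}"
  define T where "T = {t0..t1}"
  have r: "0 < r" and U: "U \<subseteq> {-\<delta><..<\<delta>}" and U0: "0 \<in> U" using \<delta> by (auto simp: r_def U_def)
  have UT: "U \<times> T \<subseteq> {-\<delta><..<\<delta>} \<times> {t0..t1}" using U by (auto simp: T_def)
  have cont: "continuous_on (U \<times> T) (\<lambda>(s, t). cs s t)" "continuous_on (U \<times> T) (\<lambda>(s, t). ct s t)"
    "continuous_on (U \<times> T) (\<lambda>(s, t). cst s t)"
    using continuous_on_subset[OF cs_cont UT] continuous_on_subset[OF ct_cont UT] continuous_on_subset[OF cst_cont UT] by auto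
  have c_cont: "continuous_on (U \<times> T) (\<lambda>(s, t). c s t)"
    unfolding U_def T_def
  proof (rule joint_continuity)
    show "continuous_on ({-r..r} \<times> {t0..t1}) (\<lambda>(s, t). cs s t)" using cont(1) by (simp add: U_def T_def)
    fix s assume "s \<in> {-r..r}"
    then have s: "s \<in> {-\<delta><..<\<delta>}" using U by (auto simp: U_def)
    show "((\<lambda>s. c s t) has_vector_derivative cs s t) (at s within {-r..r})" if "t \<in> {t0..t1}" for t
      using cs[OF s that] by (rule has_vector_derivative_at_within)
    show "continuous_on {t0..t1} (c s)"
      using ct[OF s] by (rule continuous_on_vector_derivative)
  qed
  note C = c_cont[unfolded split_beta] cont[unfolded split_beta]
  have slice: "continuous_on T (\<lambda>t. f s t)" if "continuous_on (U \<times> T) (\<lambda>z. f (fst z) (snd z))" "s \<in> U"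
    for f :: "real \<Rightarrow> real \<Rightarrow> 'b::topological_space" and s
  proof -
    have "continuous_on T (\<lambda>t. (s, t))" by (intro continuous_on_Pair continuous_on_const continuous_on_id)
    from continuous_on_compose2[OF that(1) this] that(2) show ?thesis by auto
  qed
  define L where "L s t = inner (act (exp (- prim (c s t))) (ct s t)) (ct s t)" for s t
  define L' where "L' s t = 2 * inner (act (exp (- prim (c s t))) (ct s t)) (cst s t) -
      inner (act (exp (- prim (c s t)) * prim (cs s t)) (ct s t)) (ct s t)" for s t
  have Lc: "continuous_on (U \<times> T) (\<lambda>z. L (fst z) (snd z))"
    unfolding L_def
    by (intro continuous_on_inner continuous_on_act continuous_on_exp_bcontfun continuous_on_minus continuous_on_prim C)
  have L'c: "continuous_on (U \<times> T) (\<lambda>z. L' (fst z) (snd z))"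
    unfolding L'_def
    by (intro continuous_on_diff continuous_on_mult continuous_on_const continuous_on_inner continuous_on_act
        continuous_on_exp_bcontfun continuous_on_minus continuous_on_prim C)
  have "((\<lambda>s. integral (cbox t0 t1) (L s)) has_field_derivative integral (cbox t0 t1) (L' 0)) (at 0 within U)"
  proof (rule leibniz_rule_field_derivative)
    fix s t assume s: "s \<in> U" and "t \<in> cbox t0 t1"
    then have "s \<in> {-\<delta><..<\<delta>}" "t \<in> {t0..t1}" using U by auto
    note st = this
    have "((\<lambda>s. L s t) has_vector_derivative L' s t) (at s within U)"
      unfolding L_def L'_def
      by (intro has_vector_derivative_lagrangian has_vector_derivative_at_within[OF cs[OF st]]
          has_vector_derivative_at_within[OF cts[OF st]])
    then show "((\<lambda>s. L s t) has_field_derivative L' s t) (at s within U)"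
      by (simp add: has_real_derivative_iff_has_vector_derivative)
  next
    fix s assume "s \<in> U"
    from slice[OF Lc this] show "L s integrable_on cbox t0 t1"
      by (intro integrable_continuous) (simp add: T_def)
  next
    show "continuous_on (U \<times> cbox t0 t1) (\<lambda>(s, t). L' s t)" using L'c by (simp add: T_def split_beta)
    show "convex U" by (simp add: U_def)
  qed fact
  then have "((\<lambda>s. 1/2 * integral {t0..t1} (L s)) has_real_derivative 1/2 * integral {t0..t1} (L' 0)) (at 0 within U)"
    by (intro DERIV_cmult) simp
  moreover have "at 0 within U = at 0"
    using r by (intro at_within_interior) (simp add: U_def)
  ultimately have "((\<lambda>s. 1/2 * integral {t0..t1} (L s)) has_real_derivative 1/2 * integral {t0..t1} (L' 0)) (at 0)"
    by simp
  then have dE: "((\<lambda>s. energy t0 t1 (c s)) has_real_derivative 1/2 * integral {t0..t1} (L' 0)) (at 0)"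
  proof (rule has_field_derivative_transform_within_open[where S = "{-r<..<r}"])
    fix s assume "s \<in> {-r<..<r}"
    then have s: "s \<in> U" "s \<in> {-\<delta><..<\<delta>}" using \<delta> by (auto simp: U_def r_def)
    show "1/2 * integral {t0..t1} (L s) = energy t0 t1 (c s)"
      unfolding L_def using slice[OF C(3) s(1)]
      by (intro energy_eq[OF t ct[OF s(2)], symmetric]) (auto simp: T_def)
  qed (use r in auto)
  have zero: "0 \<in> {-\<delta><..<\<delta>}" using \<delta> by simp
  have nontriv: "at 0 within {-\<delta><..<\<delta>} \<noteq> bot" by (simp only: at_within_open[OF zero open_greaterThanLessThan]) simp
  have e0: "cs 0 a = 0" if "a \<in> {t0..t1}" "\<And>s. s \<in> {-\<delta><..<\<delta>} \<Longrightarrow> c s a = c 0 a" for a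
    by (rule has_vector_derivative_const_on[OF has_vector_derivative_at_within[OF cs[OF zero that(1)]] that(2) zero nontriv])
  have ends0: "cs 0 t0 = 0" "cs 0 t1 = 0"
    by (rule e0, use t in simp, rule ends[THEN conjunct1], assumption)
      (rule e0, use t in simp, rule ends[THEN conjunct2], assumption)
  \<comment> \<open>\<open>?g\<close> is the time derivative of the pairing of the momentum with the
    variation field, which vanishes at both ends.\<close>
  let ?X = "cs 0" and ?g = "\<lambda>t. inner (p t) (cst 0 t) + inner (pd t) (cs 0 t)"
  have "(?g has_integral (inner (p t1) (?X t1) - inner (p t0) (?X t0))) {t0..t1}"
    using t by (intro fundamental_theorem_of_calculus has_vector_derivative_inner pd cst zero) auto
  then have g: "(?g has_integral 0) {t0..t1}" by (simp add: ends0)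
  have "continuous_on {t0..t1} (L' 0)" using slice[OF L'c U0] by (simp add: T_def)
  then have "(L' 0 has_integral integral {t0..t1} (L' 0)) {t0..t1}"
    by (intro integrable_integral integrable_continuous_real)
  from has_integral_diff[OF has_integral_mult_right[OF this, of "1/2"] g]
  have "((\<lambda>t. 1/2 * L' 0 t - ?g t) has_integral 1/2 * integral {t0..t1} (L' 0)) {t0..t1}" by simp
  moreover have "1/2 * L' 0 t - ?g t = inner (cs 0 t) (force (c 0 t) (p t) - pd t)" if tt: "t \<in> {t0..t1}" for t
  proof -
    let ?e = "exp (- prim (c 0 t))"
    have "cs 0 t \<in> tangent_Q (c 0 t)"
    proof (rule tangent_Q_curve[where S = "{-\<delta><..<\<delta>}" and \<gamma> = "\<lambda>s. c s t"])
      show "((\<lambda>s. c s t) has_vector_derivative cs 0 t) (at 0 within {-\<delta><..<\<delta>})"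
        using cs[OF zero tt] by (rule has_vector_derivative_at_within)
      show "at 0 within {-\<delta><..<\<delta>} \<noteq> bot" by (rule nontriv)
    qed (use Q zero tt in auto)
    note F = inner_tangent_force[OF this, of "p t"]
    have e: "act ?e (ct 0 t) = p t" using p[OF tt] by (simp add: momentum_eq)
    have v: "ct 0 t = act (Eta (c 0 t)) (p t)" unfolding e[symmetric] by (simp add: Eta_def)
    \<comment> \<open>One factor of the velocity takes up the weight 1/\<eta> and becomes
      \<open>p\<close>, the other equals \<eta> p, so the term has the weight \<eta> p^2 of
      \<open>inner_tangent_force\<close>.\<close>
    have "inner (act (?e * prim (cs 0 t)) (ct 0 t)) (ct 0 t) = inner (act (prim (cs 0 t)) (act ?e (ct 0 t))) (ct 0 t)"
      by (simp only: act_act mult.commute)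
    also have "\<dots> = inner (act (prim (cs 0 t)) (p t)) (act (Eta (c 0 t)) (p t))"
      by (simp only: e v[symmetric])
    also have "\<dots> = inner (act (Eta (c 0 t) * prim (cs 0 t)) (p t)) (p t)"
      by (simp only: inner_act_right act_act)
    finally have "1/2 * L' 0 t = inner (p t) (cst 0 t) + inner (cs 0 t) (force (c 0 t) (p t))"
      unfolding L'_def e F by simp
    moreover have "inner (pd t) (cs 0 t) = inner (cs 0 t) (pd t)" by (rule inner_commute)
    ultimately show ?thesis unfolding inner_diff_right by linarith
  qed
  ultimately have "((\<lambda>t. inner (cs 0 t) (force (c 0 t) (p t) - pd t)) has_integral 1/2 * integral {t0..t1} (L' 0)) {t0..t1}"
    by (rule has_integral_eq[rotated])
  then have "integral {t0..t1} (\<lambda>t. inner (cs 0 t) (force (c 0 t) (p t) - pd t)) = 1/2 * integral {t0..t1} (L' 0)"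
    by (rule integral_unique)
  with dE show ?thesis by (simp only:)
qed

text \<open>Test functions are continuously differentiable while \<open>m\<close> is only
  continuous, so \<open>w * m\<close> with the weight \<open>w\<close> vanishing at the ends is not
  admissible. A polynomial \<open>P\<close> close to \<open>m\<close> replaces it: testing with
  \<open>w * P\<close> bounds the integral of \<open>w * m\<^sup>2\<close> by \<open>e * K\<close>
  for every \<open>e\<close>.\<close>

lemma fundamental_lemma_variations:
  fixes m :: "real \<Rightarrow> real"
  assumes t: "t0 < t1" and m: "continuous_on {t0..t1} m"
    and test: "\<And>f f'. (\<And>t. (f has_real_derivative f' t) (at t)) \<Longrightarrow> continuous_on UNIV f' \<Longrightarrow> f t0 = 0 \<Longrightarrow> f t1 = 0 \<Longrightarrow>
      integral {t0..t1} (\<lambda>t. f t * m t) = 0"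
    and tt: "t \<in> {t0..t1}"
  shows "m t = 0"
proof -
  define w where "w t = (t - t0) * (t1 - t)" for t
  have w0: "0 \<le> w t" if "t \<in> {t0..t1}" for t using that by (auto simp: w_def)
  have wc: "continuous_on A w" for A unfolding w_def by (intro continuous_intros)
  define K where "K = integral {t0..t1} (\<lambda>t. w t * \<bar>m t\<bar>)"
  define I where "I = integral {t0..t1} (\<lambda>t. w t * (m t)\<^sup>2)"
  have Kc: "continuous_on {t0..t1} (\<lambda>t. w t * \<bar>m t\<bar>)" and Ic: "continuous_on {t0..t1} (\<lambda>t. w t * (m t)\<^sup>2)"
    by (intro continuous_intros wc m)+
  have K0: "0 \<le> K" unfolding K_def using w0 by (intro integral_nonneg integrable_continuous_real Kc) auto
  have bound: "I \<le> e * K" if e: "e > 0" for e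
  proof -
    obtain P where P: "real_polynomial_function P" "\<And>t. t \<in> {t0..t1} \<Longrightarrow> \<bar>m t - P t\<bar> < e"
      using Stone_Weierstrass_real_polynomial_function[of "{t0..t1}" m e] m e by auto
    obtain P' where P': "real_polynomial_function P'" "\<And>t. (P has_real_derivative P' t) (at t)"
      using has_real_derivative_polynomial_function[OF P(1)] by auto
    have Pc: "continuous_on A P" "continuous_on A P'" for A
      using P(1) P'(1) by (auto intro: continuous_on_polymonial_function simp: real_polynomial_function_eq)
    have "integral {t0..t1} (\<lambda>t. w t * P t * m t) = 0"
    proof (rule test)
      show "((\<lambda>t. w t * P t) has_real_derivative (t1 - t - (t - t0)) * P t + w t * P' t) (at t)" for t
        unfolding w_def by (auto intro!: derivative_eq_intros P'(2) simp: algebra_simps)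
      show "continuous_on UNIV (\<lambda>t. (t1 - t - (t - t0)) * P t + w t * P' t)"
        by (intro continuous_intros Pc wc)
    qed (auto simp: w_def)
    then have "I = integral {t0..t1} (\<lambda>t. w t * (m t)\<^sup>2) - integral {t0..t1} (\<lambda>t. w t * P t * m t)"
      by (simp add: I_def)
    also have "\<dots> = integral {t0..t1} (\<lambda>t. w t * (m t)\<^sup>2 - w t * P t * m t)"
      by (intro Henstock_Kurzweil_Integration.integral_diff[symmetric] integrable_continuous_real Ic continuous_on_mult wc m Pc)
    also have "\<dots> \<le> integral {t0..t1} (\<lambda>t. e * (w t * \<bar>m t\<bar>))"
    proof (rule integral_le)
      show "(\<lambda>t. w t * (m t)\<^sup>2 - w t * P t * m t) integrable_on {t0..t1}"
        by (intro integrable_continuous_real continuous_on_diff Ic continuous_on_mult wc m Pc)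
      show "(\<lambda>t. e * (w t * \<bar>m t\<bar>)) integrable_on {t0..t1}"
        by (intro integrable_continuous_real continuous_on_mult_left Kc)
      fix t assume t: "t \<in> {t0..t1}"
      have "w t * (m t)\<^sup>2 - w t * P t * m t = w t * ((m t - P t) * m t)"
        by (simp add: power2_eq_square algebra_simps)
      also have "\<dots> \<le> w t * (e * \<bar>m t\<bar>)"
      proof (rule mult_left_mono[OF _ w0[OF t]])
        have "(m t - P t) * m t \<le> \<bar>m t - P t\<bar> * \<bar>m t\<bar>" by (simp flip: abs_mult)
        also have "\<dots> \<le> e * \<bar>m t\<bar>" using P(2)[OF t] by (intro mult_right_mono) auto
        finally show "(m t - P t) * m t \<le> e * \<bar>m t\<bar>" .
      qed
      finally show "w t * (m t)\<^sup>2 - w t * P t * m t \<le> e * (w t * \<bar>m t\<bar>)" by (simp add: mult_ac)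
    qed
    also have "\<dots> = e * K" by (simp add: K_def)
    finally show ?thesis .
  qed
  have "I \<le> 0 + e" if "e > 0" for e
  proof -
    have "I \<le> e / (K + 1) * K" using bound[of "e / (K + 1)"] that K0 by simp
    also have "\<dots> \<le> e" using that K0 by (simp add: field_simps)
    finally show ?thesis by simp
  qed
  then have "I \<le> 0" by (rule field_le_epsilon)
  moreover have "0 \<le> I" unfolding I_def using w0 by (intro integral_nonneg integrable_continuous_real Ic) auto
  ultimately have "((\<lambda>t. w t * (m t)\<^sup>2) has_integral 0) (cbox t0 t1)"
    using integrable_integral[OF integrable_continuous_real[OF Ic]] by (simp add: I_def)
  then have "w u * (m u)\<^sup>2 = 0" if "u \<in> {t0..t1}" for u
    using that t w0 Ic by (intro has_integral_0_cbox_imp_0[of t0 t1 "\<lambda>t. w t * (m t)\<^sup>2"]) (auto simp: box_real)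
  then have "m u = 0" if "u \<in> {t0<..<t1}" for u
  proof -
    have "w u > 0" using that by (simp add: w_def)
    then show ?thesis using \<open>\<And>u. u \<in> {t0..t1} \<Longrightarrow> w u * (m u)\<^sup>2 = 0\<close>[of u] that by simp
  qed
  \<comment> \<open>The weight vanishes at the ends, so they are reached by continuity from the open
    interval.\<close>
  then show ?thesis
    using continuous_constant_on_closure[of "{t0<..<t1}" m 0 t] m tt t by (simp add: closure_greaterThanLessThan)
qed

subsection \<open>Variations by affine perturbation of \<open>\<eta>\<close>\<close>

lemma recip_mult:
  assumes "m > 0" "\<And>x. m \<le> apply_bcontfun g x"
  shows "recip g * g = 1" "g * recip g = 1"
proof -
  have "apply_bcontfun g x \<noteq> 0" for x using assms(1) assms(2)[of x] by auto
  then show "recip g * g = 1" "g * recip g = 1"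
    by (auto intro!: bcontfun_eqI simp: apply_recip[OF assms])
qed

lemma continuous_on_recip:
  fixes g :: "'a::t2_space \<Rightarrow> real \<Rightarrow>\<^sub>C real"
  assumes "m > 0" "\<And>z x. z \<in> S \<Longrightarrow> m \<le> apply_bcontfun (g z) x" and g: "continuous_on S g"
  shows "continuous_on S (\<lambda>z. recip (g z))"
  unfolding continuous_on_eq_continuous_within
proof
  fix z assume z: "z \<in> S"
  show "continuous (at z within S) (\<lambda>z. recip (g z))"
  proof (rule continuous_within_compose3[where g = recip and f = g])
    show "isCont recip (g z)"
      by (rule has_derivative_continuous[OF has_derivative_recip[OF assms(1) assms(2)[OF z]]])
    show "continuous (at z within S) g" using g z by (simp add: continuous_on_eq_continuous_within)
  qed
qed

text \<open>A function \<open>g = 1 + \<integral> W\<close> is recovered from its logarithmic derivative: by the product rule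
  \<open>exp (- \<integral> W / g) * g\<close> is constant.\<close>

lemma Eta_act_recip:
  assumes m: "m > 0" "\<And>x. m \<le> apply_bcontfun (1 + prim W) x"
  shows "Eta (act (recip (1 + prim W)) W) = 1 + prim W"
proof -
  define g where "g = 1 + prim W"
  define c where "c = act (recip g) W"
  define E where "E = exp (- prim c)"
  define A where "A = act E (- c)"
  have gc: "act g c = W" using recip_mult[of m g] m by (simp add: c_def act_act g_def)
  have E: "E = 1 + prim A"
    using exp_primitive[of "- c" one_L2] by (simp add: E_def A_def primitive.minus_left)
  \<comment> \<open>This is the integrand of the product rule for \<open>E * g\<close>; it vanishes
    because \<open>A\<close> is minus \<open>E\<close> times the logarithmic derivative
    \<open>W / g\<close>.\<close>
  have "act g A + act E W = 0"
  proof -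
    have "act g A = - act E (act g c)" by (simp add: A_def act_act act.minus_right mult.commute)
    then show ?thesis by (simp add: gc)
  qed
  moreover have "E * g = 1 + prim A + prim W + prim A * prim W"
    unfolding E g_def by (simp add: distrib_left distrib_right add_ac)
  moreover have "prim A * prim W = prim (act g A - A) + prim (act E W - W)"
    unfolding primitive_times_primitive
    by (simp add: E g_def act.add_left)
  ultimately have "E * g = 1"
    by (simp add: primitive.diff_left primitive.zero_left flip: primitive.add_left)
  then have "exp (prim c) * (E * g) = exp (prim c)" by simp
  then have "g = exp (prim c)"
    using exp_minus_inverse[of "prim c"] by (simp add: E_def mult.assoc[symmetric])
  then show ?thesis by (simp add: Eta_def c_def g_def)
qed

lemma has_vector_derivative_act_recip:
  assumes m: "m > 0" "\<And>x. m \<le> apply_bcontfun (g t) x"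
    and g: "(g has_vector_derivative g') (at t within S)" and W: "(W has_vector_derivative W') (at t within S)"
  shows "((\<lambda>t. act (recip (g t)) (W t)) has_vector_derivative
    act (recip (g t)) W' + act (- (recip (g t) * recip (g t) * g')) (W t)) (at t within S)"
  by (rule act.has_vector_derivative[OF has_vector_derivative_compose[where F = recip and g = g, OF has_derivative_recip[OF m] g] W])

text \<open>Serves both orders of the mixed derivative: \<open>k\<close> is the time derivative of
  \<open>g\<close> when \<open>ct\<close> is differentiated in \<open>s\<close>, and the parameter
  derivative when \<open>cs\<close> is differentiated in \<open>t\<close>.\<close>

lemma has_vector_derivative_act_recip2:
  assumes m: "m > 0" "\<And>x. m \<le> apply_bcontfun (g t) x"
    and g: "(g has_vector_derivative g') (at t within S)" and W: "(W has_vector_derivative W') (at t within S)"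
    and k: "(k has_vector_derivative k') (at t within S)"
  shows "((\<lambda>t. act (- (recip (g t) * recip (g t) * k t)) (W t)) has_vector_derivative
    act (- (recip (g t) * recip (g t) * k t)) W' +
    act (- (recip (g t) * recip (g t) * k' - 2 * (recip (g t) * recip (g t) * recip (g t) * g' * k t))) (W t)) (at t within S)"
proof -
  have r: "((\<lambda>t. recip (g t)) has_vector_derivative - (recip (g t) * recip (g t) * g')) (at t within S)"
    by (rule has_vector_derivative_compose[where F = recip and g = g, OF has_derivative_recip[OF m] g])
  have "recip (g t) * recip (g t) * k' + (recip (g t) * - (recip (g t) * recip (g t) * g') + - (recip (g t) * recip (g t) * g') * recip (g t)) * k t
    = recip (g t) * recip (g t) * k' - 2 * (recip (g t) * recip (g t) * recip (g t) * g' * k t)"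
    by (simp add: algebra_simps)
  with act.has_vector_derivative[OF has_vector_derivative_minus[OF has_vector_derivative_mult[OF has_vector_derivative_mult[OF r r] k]] W]
  show ?thesis by (simp only:)
qed

text \<open>\<eta> is perturbed to \<open>g = Eta (q t) + s f h\<close> with
  \<open>h = prim w\<close>, and \<open>c\<close> is the logarithmic derivative of \<open>g\<close>.
  The two conditions on \<open>w\<close> say that \<open>h\<close> vanishes at 1 and has mean 0,
  which keeps \<open>c\<close> in \<open>Q\<close>; the zeros of \<open>f\<close> fix the end
  points.\<close>

lemma exists_variation:
  fixes q v :: "real \<Rightarrow> L2"
  assumes t: "t0 < t1"
    and q: "\<And>t. t \<in> {t0..t1} \<Longrightarrow> (q has_vector_derivative v t) (at t within {t0..t1})"
    and v: "continuous_on {t0..t1} v" and Q: "\<And>t. t \<in> {t0..t1} \<Longrightarrow> q t \<in> Q"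
    and w: "inner w one_L2 = 0" "inner (cls (prim w)) one_L2 = 0"
    and f: "\<And>t. (f has_real_derivative f' t) (at t)" "continuous_on UNIV f'" "f t0 = 0" "f t1 = 0"
  obtains \<delta> and c cs ct cst :: "real \<Rightarrow> real \<Rightarrow> L2" where "\<delta> > 0"
    "\<And>s. s \<in> {-\<delta><..<\<delta>} \<Longrightarrow> c s t0 = c 0 t0 \<and> c s t1 = c 0 t1"
    "\<And>s t. s \<in> {-\<delta><..<\<delta>} \<Longrightarrow> t \<in> {t0..t1} \<Longrightarrow> c s t \<in> Q"
    "\<And>s t. s \<in> {-\<delta><..<\<delta>} \<Longrightarrow> t \<in> {t0..t1} \<Longrightarrow> ((\<lambda>s. c s t) has_vector_derivative cs s t) (at s)"
    "\<And>s t. s \<in> {-\<delta><..<\<delta>} \<Longrightarrow> t \<in> {t0..t1} \<Longrightarrow> (c s has_vector_derivative ct s t) (at t within {t0..t1})"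
    "\<And>s t. s \<in> {-\<delta><..<\<delta>} \<Longrightarrow> t \<in> {t0..t1} \<Longrightarrow> ((\<lambda>s. ct s t) has_vector_derivative cst s t) (at s)"
    "\<And>s t. s \<in> {-\<delta><..<\<delta>} \<Longrightarrow> t \<in> {t0..t1} \<Longrightarrow> (cs s has_vector_derivative cst s t) (at t within {t0..t1})"
    "continuous_on ({-\<delta><..<\<delta>} \<times> {t0..t1}) (\<lambda>(s, t). cs s t)"
    "continuous_on ({-\<delta><..<\<delta>} \<times> {t0..t1}) (\<lambda>(s, t). ct s t)"
    "continuous_on ({-\<delta><..<\<delta>} \<times> {t0..t1}) (\<lambda>(s, t). cst s t)"
    "\<And>t. t \<in> {t0..t1} \<Longrightarrow> c 0 t = q t"
    "\<And>t. t \<in> {t0..t1} \<Longrightarrow> cs 0 t = f t *\<^sub>R (act (exp (- prim (q t))) w - act (exp (- prim (q t)) * prim w) (q t))"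
proof -
  define h where "h = prim w"
  have qc: "continuous_on {t0..t1} q" using q by (rule continuous_on_vector_derivative)
  have fc: "continuous_on UNIV f" using f(1) by (rule DERIV_continuous_on[OF has_field_derivative_at_within])
  have "bounded ((\<lambda>t. prim (q t)) ` {t0..t1})"
    by (intro compact_imp_bounded compact_continuous_image continuous_on_prim qc) auto
  then obtain M where M: "\<And>t. t \<in> {t0..t1} \<Longrightarrow> norm (prim (q t)) \<le> M" unfolding bounded_iff by force
  have "bounded (f ` {t0..t1})"
    by (intro compact_imp_bounded compact_continuous_image continuous_on_subset[OF fc]) auto
  then obtain F where F: "\<And>t. t \<in> {t0..t1} \<Longrightarrow> \<bar>f t\<bar> \<le> F" unfolding bounded_iff by force
  have F0: "0 \<le> F" using F[of t0] t by auto
  \<comment> \<open>Half of a lower bound for all \<open>Eta (q t)\<close>: the other half is left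
    to the perturbation, which \<open>\<delta>\<close> keeps below \<open>m\<close>. The summand 1
    in the denominator of \<open>\<delta>\<close> keeps it positive.\<close>
  define m where "m = exp (- M) / 2"
  have m: "m > 0" by (simp add: m_def)
  define \<delta> where "\<delta> = m / (F * norm h + 1)"
  have Fh: "0 \<le> F * norm h" using F0 by simp
  have \<delta>: "\<delta> > 0" using m Fh by (simp add: \<delta>_def add_nonneg_pos)
  have Eta_ge: "2 * m \<le> apply_bcontfun (Eta (q t)) x" if "t \<in> {t0..t1}" for t x
    using norm_bounded[of "prim (q t)" x] M[OF that] by (simp add: Eta_def m_def)
  define g where "g s t = Eta (q t) + (s * f t) *\<^sub>R h" for s t
  \<comment> \<open>The space derivative of \<open>g s t\<close>, since \<eta>' = \<eta> q and
    \<open>h\<close> is the primitive of \<open>w\<close>.\<close>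
  define W where "W s t = act (Eta (q t)) (q t) + (s * f t) *\<^sub>R w" for s t
  define gt where "gt s t = Eta (q t) * prim (v t) + (s * f' t) *\<^sub>R h" for s t
  define Wt where "Wt s t = act (Eta (q t)) (v t) + act (Eta (q t) * prim (v t)) (q t) + (s * f' t) *\<^sub>R w" for s t
  have g_ge: "m \<le> apply_bcontfun (g s t) x" if "s \<in> {-\<delta><..<\<delta>}" "t \<in> {t0..t1}" for s t x
  proof -
    have "\<bar>s * f t * apply_bcontfun h x\<bar> \<le> \<delta> * (F * norm h)"
      unfolding abs_mult mult.assoc using that F[OF that(2)] norm_bounded[of h x] \<delta> F0
      by (intro mult_mono) auto
    also have "\<dots> \<le> m"
      using m Fh unfolding \<delta>_def by (simp add: divide_simps mult_left_le add_nonneg_pos)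
    finally show ?thesis using Eta_ge[OF that(2), of x] by (simp add: g_def)
  qed
  have gs: "((\<lambda>s. g s t) has_vector_derivative f t *\<^sub>R h) (at s)" for s t
    unfolding g_def by (auto intro!: derivative_eq_intros simp: has_vector_derivative_def)
  have Ws: "((\<lambda>s. W s t) has_vector_derivative f t *\<^sub>R w) (at s)" for s t
    unfolding W_def by (auto intro!: derivative_eq_intros simp: has_vector_derivative_def)
  have gts: "((\<lambda>s. gt s t) has_vector_derivative f' t *\<^sub>R h) (at s)" for s t
    unfolding gt_def by (auto intro!: derivative_eq_intros simp: has_vector_derivative_def)
  have Wts: "((\<lambda>s. Wt s t) has_vector_derivative f' t *\<^sub>R w) (at s)" for s t
    unfolding Wt_def by (auto intro!: derivative_eq_intros simp: has_vector_derivative_def)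
  have fR: "((\<lambda>t. (s * f t) *\<^sub>R y) has_vector_derivative (s * f' t) *\<^sub>R y) (at t within S)"
    for s t S and y :: "'b::real_normed_vector"
    using has_vector_derivative_scaleR[OF DERIV_cmult[OF has_field_derivative_at_within[OF f(1)]] has_vector_derivative_const]
    by simp
  have fR1: "((\<lambda>t. f t *\<^sub>R y) has_vector_derivative f' t *\<^sub>R y) (at t within S)"
    for t S and y :: "'b::real_normed_vector"
    using fR[of 1 y t S] by simp
  have gt: "(g s has_vector_derivative gt s t) (at t within {t0..t1})" if "t \<in> {t0..t1}" for s t
    unfolding g_def gt_def by (intro has_vector_derivative_add has_vector_derivative_Eta q that fR)
  have Wt: "(W s has_vector_derivative Wt s t) (at t within {t0..t1})" if "t \<in> {t0..t1}" for s t
    unfolding W_def Wt_def by (intro has_vector_derivative_add act.has_vector_derivative has_vector_derivative_Eta q that fR)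
  define r where "r s t = recip (g s t)" for s t
  define c where "c s t = act (r s t) (W s t)" for s t
  define cs where "cs s t = act (r s t) (f t *\<^sub>R w) + act (- (r s t * r s t * (f t *\<^sub>R h))) (W s t)" for s t
  define ct where "ct s t = act (r s t) (Wt s t) + act (- (r s t * r s t * gt s t)) (W s t)" for s t
  define cst where "cst s t = (act (r s t) (f' t *\<^sub>R w) + act (- (r s t * r s t * (f t *\<^sub>R h))) (Wt s t)) +
     (act (- (r s t * r s t * gt s t)) (f t *\<^sub>R w) +
      act (- (r s t * r s t * (f' t *\<^sub>R h) - 2 * (r s t * r s t * r s t * (f t *\<^sub>R h) * gt s t))) (W s t))" for s t
  have g1: "g s t = 1 + prim (W s t)" for s t
  proof -
    have "prim (W s t) = prim (act (Eta (q t)) (q t)) + (s * f t) *\<^sub>R h"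
      by (simp only: W_def h_def primitive.add_left primitive.scaleR_left)
    then show ?thesis unfolding g_def using Eta_eq[of "q t"] by (metis add.assoc)
  qed
  show ?thesis
  proof (rule that[of \<delta> c cs ct cst])
    fix s t assume s: "s \<in> {-\<delta><..<\<delta>}" and tt: "t \<in> {t0..t1}"
    note gm = m g_ge[OF s tt]
    have Eta_c: "Eta (c s t) = g s t"
      using Eta_act_recip[OF m, of "W s t"] g_ge[OF s tt] by (simp add: g1 c_def r_def)
    \<comment> \<open>The mean of \<open>c\<close> is the logarithm of \<open>g\<close> at 1, and
      this value stays 1 because \<open>w\<close> has mean 0.\<close>
    have "exp (inner (c s t) one_L2) = apply_bcontfun (Eta (c s t)) 1" by (simp add: Eta_def primitive_1)
    also have "\<dots> = exp (inner (q t) one_L2) + s * f t * inner w one_L2"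
      unfolding Eta_c g_def by (simp add: Eta_def h_def primitive_1)
    also have "\<dots> = 1" using Q[OF tt] w by (simp add: Q_iff)
    finally have "inner (c s t) one_L2 = 0" by simp
    moreover have "inner (cls (Eta (c s t))) one_L2 = 1"
      unfolding Eta_c g_def using Q[OF tt] w by (simp add: Q_iff h_def act.add_left act.scaleR_left inner_add_left)
    ultimately show "c s t \<in> Q" by (simp add: Q_iff)
    show "((\<lambda>s. c s t) has_vector_derivative cs s t) (at s)"
      unfolding c_def cs_def r_def by (rule has_vector_derivative_act_recip[OF gm gs Ws])
    show "(c s has_vector_derivative ct s t) (at t within {t0..t1})"
      unfolding c_def ct_def r_def by (rule has_vector_derivative_act_recip[OF gm gt[OF tt] Wt[OF tt]])
    show "((\<lambda>s. ct s t) has_vector_derivative cst s t) (at s)"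
      unfolding ct_def cst_def r_def
      by (intro has_vector_derivative_add has_vector_derivative_act_recip[OF gm gs Wts]
          has_vector_derivative_act_recip2[OF gm gs Ws gts])
    have "(cs s has_vector_derivative
      (act (r s t) (f' t *\<^sub>R w) + act (- (r s t * r s t * gt s t)) (f t *\<^sub>R w)) +
      (act (- (r s t * r s t * (f t *\<^sub>R h))) (Wt s t) +
       act (- (r s t * r s t * (f' t *\<^sub>R h) - 2 * (r s t * r s t * r s t * gt s t * (f t *\<^sub>R h)))) (W s t))) (at t within {t0..t1})"
      unfolding cs_def r_def
      by (intro has_vector_derivative_add has_vector_derivative_act_recip[OF gm gt[OF tt] fR1]
          has_vector_derivative_act_recip2[OF gm gt[OF tt] Wt[OF tt] fR1])
    \<comment> \<open>The two orders of differentiation agree up to commuting factors and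
      summands.\<close>
    moreover have "r s t * r s t * r s t * gt s t * (f t *\<^sub>R h) = r s t * r s t * r s t * (f t *\<^sub>R h) * gt s t"
      by (simp only: mult_ac)
    ultimately show "(cs s has_vector_derivative cst s t) (at t within {t0..t1})"
      unfolding cst_def by (simp only: add_ac)
  next
    let ?D = "{-\<delta><..<\<delta>} \<times> {t0..t1}"
    have C: "continuous_on ?D (\<lambda>z. q (snd z))" "continuous_on ?D (\<lambda>z. v (snd z))"
      "continuous_on ?D (\<lambda>z. f (snd z))" "continuous_on ?D (\<lambda>z. f' (snd z))"
      by (rule continuous_on_compose2[OF qc] continuous_on_compose2[OF v] continuous_on_compose2[OF fc]
          continuous_on_compose2[OF f(2)], intro continuous_on_snd continuous_on_id, force)+
    have gc: "continuous_on ?D (\<lambda>z. g (fst z) (snd z))" "continuous_on ?D (\<lambda>z. W (fst z) (snd z))"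
      "continuous_on ?D (\<lambda>z. gt (fst z) (snd z))" "continuous_on ?D (\<lambda>z. Wt (fst z) (snd z))"
      unfolding g_def W_def gt_def Wt_def
      by (intro continuous_on_add continuous_on_scaleR continuous_on_mult continuous_on_act continuous_on_Eta continuous_on_prim
          continuous_on_const continuous_on_fst continuous_on_id C)+
    have rc: "continuous_on ?D (\<lambda>z. r (fst z) (snd z))"
      unfolding r_def using g_ge by (intro continuous_on_recip[OF m] gc) auto
    note I = continuous_on_add continuous_on_minus continuous_on_diff continuous_on_scaleR continuous_on_mult continuous_on_act
      continuous_on_const gc rc C
    show "continuous_on ?D (\<lambda>(s, t). cs s t)" unfolding cs_def split_beta by (intro I)
    show "continuous_on ?D (\<lambda>(s, t). ct s t)" unfolding ct_def split_beta by (intro I)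
    show "continuous_on ?D (\<lambda>(s, t). cst s t)" unfolding cst_def split_beta by (intro I)
  next
    show "\<delta> > 0" by fact
    show "c s t0 = c 0 t0 \<and> c s t1 = c 0 t1" for s
      by (simp add: c_def r_def g_def W_def f)
  next
    fix t assume tt: "t \<in> {t0..t1}"
    have E: "recip (Eta (q t)) = exp (- prim (q t))"
      by (rule bcontfun_eqI) (use apply_recip[OF _ Eta_ge[OF tt]] m in \<open>simp add: Eta_def exp_minus\<close>)
    then show "c 0 t = q t" by (simp add: c_def r_def g_def W_def Eta_def)
    have "act (exp (- prim (q t)) * exp (- prim (q t)) * (f t *\<^sub>R h)) (act (Eta (q t)) (q t)) =
      act (f t *\<^sub>R (exp (- prim (q t)) * h)) (act (exp (- prim (q t))) (act (Eta (q t)) (q t)))"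
      by (simp add: act_act mult_ac)
    then show "cs 0 t = f t *\<^sub>R (act (exp (- prim (q t))) w - act (exp (- prim (q t)) * prim w) (q t))"
      using E by (simp add: cs_def r_def g_def W_def h_def[symmetric] act.scaleR_right act.scaleR_left act.minus_left
          scaleR_right_diff_distrib) (simp add: Eta_def)
  qed
qed

subsection \<open>Geodesics and the first-order system\<close>

lemma momentum_velocity: "momentum q (velocity q p) = p"
  by (simp add: velocity_eq momentum_eq Eta_def)

lemma nontrivial_within_Icc:
  fixes t :: real
  assumes "t0 < t1" "t \<in> {t0..t1}"
  shows "at t within {t0..t1} \<noteq> bot"
  using assms by (simp add: trivial_limit_within islimpt_Icc)

text \<open>Differentiating \<eta> p along the system yields the second derivative of
  \<open>q\<close>. As the derivative of \<open>p\<close> is the force, the integrand of the first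
  variation vanishes identically.\<close>

lemma solution_imp_geodesic:
  assumes t: "t0 < t1" and sol: "solves_system_on t0 t1 q p"
  shows "geodesic_on t0 t1 q"
    and "\<forall>t\<in>{t0..t1}. p t = momentum (q t) (vector_derivative q (at t within {t0..t1}))"
proof -
  let ?T = "{t0..t1}"
  have Q: "q t \<in> Q" and cot: "p t \<in> cotangent_Q (q t)"
    and dq: "(q has_vector_derivative velocity (q t) (p t)) (at t within ?T)"
    and dp: "(p has_vector_derivative force (q t) (p t)) (at t within ?T)" if "t \<in> ?T" for t
    using sol that by (auto simp: solves_system_on_def cotangent_bundle_def)
  have qc: "continuous_on ?T q" using dq by (rule continuous_on_vector_derivative)
  have pc: "continuous_on ?T p" using dp by (rule continuous_on_vector_derivative)
  have vd: "vector_derivative q (at t within ?T) = velocity (q t) (p t)" if "t \<in> ?T" for t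
    using vector_derivative_within_cbox[of t0 t1 t q] dq[OF that] t that by simp
  then show "\<forall>t\<in>?T. p t = momentum (q t) (vector_derivative q (at t within ?T))"
    by (simp add: momentum_velocity)
  have "C2_curve_on t0 t1 q"
    unfolding C2_curve_on_def
  proof (intro exI conjI ballI)
    show "(q has_vector_derivative velocity (q t) (p t)) (at t within ?T)" if "t \<in> ?T" for t
      by (rule dq[OF that])
    show "((\<lambda>t. velocity (q t) (p t)) has_vector_derivative act (Eta (q t)) (force (q t) (p t)) +
        act (Eta (q t) * prim (velocity (q t) (p t))) (p t)) (at t within ?T)" if "t \<in> ?T" for t
      unfolding velocity_eq
      using act.has_vector_derivative[OF has_vector_derivative_Eta[OF dq[OF that]] dp[OF that]]
      by (simp only: velocity_eq)
    show "continuous_on ?T (\<lambda>t. act (Eta (q t)) (force (q t) (p t)) +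
        act (Eta (q t) * prim (velocity (q t) (p t))) (p t))"
      unfolding velocity_eq
      by (intro continuous_on_add continuous_on_mult continuous_on_act continuous_on_Eta continuous_on_prim
          continuous_on_force qc pc Q)
  qed
  moreover have "((\<lambda>s. energy t0 t1 (c s)) has_real_derivative 0) (at 0)"
    if var: "proper_variation Q t0 t1 q c" for c
  proof -
    obtain \<delta> cs ct cst where \<delta>: "\<delta> > 0" and c0: "\<forall>t\<in>?T. c 0 t = q t"
      and ends: "\<forall>s\<in>{-\<delta><..<\<delta>}. c s t0 = q t0 \<and> c s t1 = q t1"
      and cQ: "\<forall>s\<in>{-\<delta><..<\<delta>}. \<forall>t\<in>?T. c s t \<in> Q"
      and d: "\<forall>s\<in>{-\<delta><..<\<delta>}. \<forall>t\<in>?T.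
              ((\<lambda>s. c s t) has_vector_derivative cs s t) (at s) \<and>
              ((\<lambda>t. c s t) has_vector_derivative ct s t) (at t within ?T) \<and>
              ((\<lambda>s. ct s t) has_vector_derivative cst s t) (at s) \<and>
              ((\<lambda>t. cs s t) has_vector_derivative cst s t) (at t within ?T)"
      and cont: "continuous_on ({-\<delta><..<\<delta>} \<times> ?T) (\<lambda>(s, t). cs s t)"
        "continuous_on ({-\<delta><..<\<delta>} \<times> ?T) (\<lambda>(s, t). ct s t)"
        "continuous_on ({-\<delta><..<\<delta>} \<times> ?T) (\<lambda>(s, t). cst s t)"
      using var unfolding proper_variation_def by (elim conjE exE)
    have zero: "0 \<in> {-\<delta><..<\<delta>}" using \<delta> by simp
    \<comment> \<open>\<open>c 0\<close> and \<open>q\<close> agree on the interval only, so their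
      derivatives are compared within it; they are unique there as \<open>t0 < t1\<close>.\<close>
    have ct0: "ct 0 t = velocity (q t) (p t)" if tt: "t \<in> ?T" for t
    proof (rule vector_derivative_unique_within[OF nontrivial_within_Icc[OF t tt]])
      have "(c 0 has_vector_derivative ct 0 t) (at t within ?T)" using d zero tt by blast
      then show "(q has_vector_derivative ct 0 t) (at t within ?T)"
        by (rule has_vector_derivative_transform[OF tt, rotated]) (use c0 in simp)
    qed (rule dq[OF tt])
    have "((\<lambda>s. energy t0 t1 (c s)) has_real_derivative
        integral ?T (\<lambda>t. inner (cs 0 t) (force (c 0 t) (p t) - force (q t) (p t)))) (at 0)"
    proof (rule first_variation[OF t \<delta> _ _ _ _ _ _ cont])
      fix s assume s: "s \<in> {-\<delta><..<\<delta>}"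
      show "c s t0 = c 0 t0 \<and> c s t1 = c 0 t1"
        using bspec[OF ends s] bspec[OF ends zero] by metis
      fix t assume tt: "t \<in> ?T"
      show "c s t \<in> Q" using cQ s tt by blast
      show "((\<lambda>s. c s t) has_vector_derivative cs s t) (at s)"
        "(c s has_vector_derivative ct s t) (at t within ?T)"
        "((\<lambda>s. ct s t) has_vector_derivative cst s t) (at s)"
        "(cs s has_vector_derivative cst s t) (at t within ?T)"
        using d s tt by blast+
    next
      fix t assume tt: "t \<in> ?T"
      show "p t = momentum (c 0 t) (ct 0 t)"
        using c0 tt by (simp add: ct0 momentum_velocity)
      show "(p has_vector_derivative force (q t) (p t)) (at t within ?T)" by (rule dp[OF tt])
    qed
    moreover have "integral ?T (\<lambda>t. inner (cs 0 t) (force (c 0 t) (p t) - force (q t) (p t))) = integral ?T (\<lambda>t. 0)"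
      by (rule Henstock_Kurzweil_Integration.integral_cong) (use c0 in simp)
    ultimately show ?thesis by simp
  qed
  ultimately show "geodesic_on t0 t1 q" unfolding geodesic_on_def using Q by blast
qed

text \<open>Product rule: \<eta> times the primitive of \<open>X\<close> has derivative \<eta> X +
  \<eta> q \<open>prim X\<close>. The right side is how \<eta> moves when \<open>q\<close> moves
  along \<open>X\<close>.\<close>

lemma prim_act_Eta: "prim (act (Eta q) (X + act (prim X) q)) = Eta q * prim X"
proof -
  define E where "E = Eta q"
  have E: "E = 1 + prim (act E q)" unfolding E_def by (rule Eta_eq)
  have e1: "prim (act E q) = E - 1" using E by (metis add_diff_cancel_left')
  have "(E - 1) * prim X = prim (act (prim X) (act E q)) + prim (act E X - X)"
    using primitive_times_primitive[of "act E q" one_L2 X one_L2]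
    by (simp only: e1 act.diff_left act_one)
  then have "E * prim X = prim (act (prim X) (act E q)) + prim (act E X)"
    by (simp add: left_diff_distrib primitive.diff_left)
  then show ?thesis
    by (simp add: E_def act.add_right primitive.add_left act_act mult.commute add.commute)
qed

text \<open>The vectors (q', p') and (velocity, force) are both tangent to the cotangent bundle and
  have the same first component. In their difference the linearised constraints therefore reduce to
  the equations of \<open>cotangent_Q\<close> for \<open>Y\<close>, which makes \<eta> Y an
  admissible direction.\<close>

lemma geodesic_imp_solution:
  assumes t: "t0 < t1" and geo: "geodesic_on t0 t1 q"
    and mom: "\<And>t. t \<in> {t0..t1} \<Longrightarrow> p t = momentum (q t) (vector_derivative q (at t within {t0..t1}))"
  shows "solves_system_on t0 t1 q p"
proof -
  let ?T = "{t0..t1}"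
  obtain v a where dq: "\<And>t. t \<in> ?T \<Longrightarrow> (q has_vector_derivative v t) (at t within ?T)"
    and dv: "\<And>t. t \<in> ?T \<Longrightarrow> (v has_vector_derivative a t) (at t within ?T)"
    and ac: "continuous_on ?T a"
    using geo unfolding geodesic_on_def C2_curve_on_def by blast
  have Q: "q t \<in> Q" if "t \<in> ?T" for t using geo that by (simp add: geodesic_on_def)
  have stat: "((\<lambda>s. energy t0 t1 (c s)) has_real_derivative 0) (at 0)" if "proper_variation Q t0 t1 q c" for c
    using geo that by (simp add: geodesic_on_def)
  have vd: "vector_derivative q (at t within ?T) = v t" if "t \<in> ?T" for t
    using vector_derivative_within_cbox[of t0 t1 t q] dq[OF that] t that by simp
  have p: "p t = momentum (q t) (v t)" if "t \<in> ?T" for t using mom[OF that] vd[OF that] by simp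
  have vel: "velocity (q t) (p t) = v t" if "t \<in> ?T" for t using p[OF that] by (simp add: velocity_momentum)
  \<comment> \<open>The quotient rule for p = v / \<eta>.\<close>
  define pd where "pd t = act (exp (- prim (q t))) (a t) + act (exp (- prim (q t)) * - prim (v t)) (v t)" for t
  have dp: "(p has_vector_derivative pd t) (at t within ?T)" if tt: "t \<in> ?T" for t
  proof (rule has_vector_derivative_transform[OF tt])
    show "((\<lambda>t. act (exp (- prim (q t))) (v t)) has_vector_derivative pd t) (at t within ?T)"
      unfolding pd_def
      by (intro act.has_vector_derivative has_vector_derivative_exp_bcontfun has_vector_derivative_minus
          bounded_linear.has_vector_derivative[OF primitive.bounded_linear_left] dq dv tt)
    show "p u = act (exp (- prim (q u))) (v u)" if "u \<in> ?T" for u using p[OF that] by (simp add: momentum_eq)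
  qed
  have qc: "continuous_on ?T q" using dq by (rule continuous_on_vector_derivative)
  have vc: "continuous_on ?T v" using dv by (rule continuous_on_vector_derivative)
  have pc: "continuous_on ?T p" using dp by (rule continuous_on_vector_derivative)
  have ec: "continuous_on ?T (\<lambda>t. exp (- prim (q t)))"
    by (intro continuous_on_exp_bcontfun continuous_on_minus continuous_on_prim qc)
  define Y where "Y t = pd t - force (q t) (p t)" for t
  have Yc: "continuous_on ?T Y"
    unfolding Y_def pd_def
    by (intro continuous_on_diff continuous_on_add continuous_on_act continuous_on_mult continuous_on_minus continuous_on_prim
        continuous_on_force ec qc vc ac pc Q)
  have tan: "v t \<in> tangent_Q (q t)" if "t \<in> ?T" for t
    by (rule tangent_Q_curve[OF dq[OF that] Q that nontrivial_within_Icc[OF t that]])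
  have cot: "p t \<in> cotangent_Q (q t)" if "t \<in> ?T" for t
    using momentum_cotangent[OF tan[OF that]] p[OF that] by simp
  have Ycot: "Y t \<in> cotangent_Q (q t)" if tt: "t \<in> ?T" for t
  proof -
    have "d_constraint1 (q t) (p t) (velocity (q t) (p t)) (pd t) = 0" "d_constraint2 (q t) (p t) (velocity (q t) (p t)) (pd t) = 0"
      using cotangent_curve[OF dq[OF tt] dp[OF tt] cot tt nontrivial_within_Icc[OF t tt]] by (simp_all add: vel[OF tt])
    then show ?thesis
      using d_constraint_velocity[OF Q[OF tt] cot[OF tt]] force_moments[OF Q[OF tt], of "p t"]
      by (simp add: cotangent_Q_iff Y_def inner_diff_left)
  qed
  have "Y t = 0" if tt: "t \<in> ?T" for t
  proof -
    define X where "X = velocity (q t) (Y t)"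
    \<comment> \<open>Chosen so that \<open>prim w\<close> is the derivative of \<open>Eta\<close>
      at \<open>q t\<close> along \<open>X\<close>; tangency of \<open>X\<close> then gives the two
      conditions on \<open>w\<close>.\<close>
    define w where "w = act (Eta (q t)) (X + act (prim X) (q t))"
    have X: "X \<in> tangent_Q (q t)" using Ycot[OF tt] by (simp add: X_def velocity_tangent_iff)
    have pw: "prim w = Eta (q t) * prim X" unfolding w_def by (rule prim_act_Eta)
    have "inner w one_L2 = apply_bcontfun (Eta (q t)) 1 * inner X one_L2"
      using arg_cong[OF pw, of "\<lambda>f. apply_bcontfun f 1"] by (simp add: primitive_1)
    then have w: "inner w one_L2 = 0" "inner (cls (prim w)) one_L2 = 0"
      using X inner_cls_Eta_prim[OF Q[OF tt], of X] by (simp_all add: tangent_Q_iff pw)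
    \<comment> \<open>The variation field before scaling by \<open>f\<close>. As \<open>w\<close>
      belongs to the fixed time \<open>t\<close>, the field is claimed to equal \<open>X\<close>
      only at \<open>u = t\<close>.\<close>
    define Z where "Z u = act (exp (- prim (q u))) w - act (exp (- prim (q u)) * prim w) (q u)" for u
    have Zc: "continuous_on ?T Z"
      unfolding Z_def
      by (intro continuous_on_diff continuous_on_act continuous_on_mult continuous_on_const ec qc)
    have "inner (Z t) (Y t) = 0"
    proof (rule fundamental_lemma_variations[where m = "\<lambda>u. inner (Z u) (Y u)", OF t _ _ tt])
      show "continuous_on ?T (\<lambda>u. inner (Z u) (Y u))" by (intro continuous_on_inner Zc Yc)
      fix f f' :: "real \<Rightarrow> real"
      assume f: "\<And>t. (f has_real_derivative f' t) (at t)" "continuous_on UNIV f'" "f t0 = 0" "f t1 = 0"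
      show "integral ?T (\<lambda>u. f u * inner (Z u) (Y u)) = 0"
      proof (rule exists_variation[OF t dq vc Q w f])
        fix \<delta> and c cs ct cst :: "real \<Rightarrow> real \<Rightarrow> L2"
        assume \<delta>: "\<delta> > 0"
          and ends: "\<And>s. s \<in> {-\<delta><..<\<delta>} \<Longrightarrow> c s t0 = c 0 t0 \<and> c s t1 = c 0 t1"
          and cQ: "\<And>s t. s \<in> {-\<delta><..<\<delta>} \<Longrightarrow> t \<in> {t0..t1} \<Longrightarrow> c s t \<in> Q"
          and d: "\<And>s t. s \<in> {-\<delta><..<\<delta>} \<Longrightarrow> t \<in> {t0..t1} \<Longrightarrow> ((\<lambda>s. c s t) has_vector_derivative cs s t) (at s)"
            "\<And>s t. s \<in> {-\<delta><..<\<delta>} \<Longrightarrow> t \<in> {t0..t1} \<Longrightarrow> (c s has_vector_derivative ct s t) (at t within {t0..t1})"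
            "\<And>s t. s \<in> {-\<delta><..<\<delta>} \<Longrightarrow> t \<in> {t0..t1} \<Longrightarrow> ((\<lambda>s. ct s t) has_vector_derivative cst s t) (at s)"
            "\<And>s t. s \<in> {-\<delta><..<\<delta>} \<Longrightarrow> t \<in> {t0..t1} \<Longrightarrow> (cs s has_vector_derivative cst s t) (at t within {t0..t1})"
          and cont: "continuous_on ({-\<delta><..<\<delta>} \<times> {t0..t1}) (\<lambda>(s, t). cs s t)"
            "continuous_on ({-\<delta><..<\<delta>} \<times> {t0..t1}) (\<lambda>(s, t). ct s t)"
            "continuous_on ({-\<delta><..<\<delta>} \<times> {t0..t1}) (\<lambda>(s, t). cst s t)"
          and c0: "\<And>t. t \<in> {t0..t1} \<Longrightarrow> c 0 t = q t"
          and "\<And>t. t \<in> {t0..t1} \<Longrightarrow> cs 0 t = f t *\<^sub>R (act (exp (- prim (q t))) w - act (exp (- prim (q t)) * prim w) (q t))"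
        then have cs0: "\<And>t. t \<in> {t0..t1} \<Longrightarrow> cs 0 t = f t *\<^sub>R Z t" by (simp add: Z_def)
        have zero: "0 \<in> {-\<delta><..<\<delta>}" using \<delta> by simp
        have ct0: "ct 0 u = v u" if u: "u \<in> ?T" for u
        proof (rule vector_derivative_unique_within[OF nontrivial_within_Icc[OF t u]])
          show "(q has_vector_derivative ct 0 u) (at u within ?T)"
            by (rule has_vector_derivative_transform[OF u _ d(2)[OF zero u]]) (simp add: c0)
        qed (rule dq[OF u])
        have "proper_variation Q t0 t1 q c"
          unfolding proper_variation_def
        proof (intro conjI exI[of _ \<delta>] ballI)
          show "c s t0 = q t0" "c s t1 = q t1" if "s \<in> {-\<delta><..<\<delta>}" for s
            using ends[OF that] c0[of t0] c0[of t1] t by auto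
          show "c 0 u = q u" if "u \<in> ?T" for u by (rule c0[OF that])
          show "\<delta> > 0" by (rule \<delta>)
          show "c s u \<in> Q" if "s \<in> {-\<delta><..<\<delta>}" "u \<in> ?T" for s u by (rule cQ[OF that])
        qed (rule exI[of _ cs], rule exI[of _ ct], rule exI[of _ cst], intro conjI ballI, (fact d cont)+)
        from stat[OF this] have "((\<lambda>s. energy t0 t1 (c s)) has_real_derivative 0) (at 0)" .
        moreover have "((\<lambda>s. energy t0 t1 (c s)) has_real_derivative
            integral ?T (\<lambda>u. inner (cs 0 u) (force (c 0 u) (p u) - pd u))) (at 0)"
          by (rule first_variation[OF t \<delta> ends cQ d cont _ dp]) (simp_all add: p c0 ct0)
        ultimately have "integral ?T (\<lambda>u. inner (cs 0 u) (force (c 0 u) (p u) - pd u)) = 0"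
          by (metis DERIV_unique)
        moreover have "integral ?T (\<lambda>u. inner (cs 0 u) (force (c 0 u) (p u) - pd u)) = integral ?T (\<lambda>u. - (f u * inner (Z u) (Y u)))"
          by (rule Henstock_Kurzweil_Integration.integral_cong) (simp add: cs0 c0 Y_def inner_diff_right algebra_simps)
        ultimately show "integral ?T (\<lambda>u. f u * inner (Z u) (Y u)) = 0" by simp
      qed
    qed
    \<comment> \<open>At time \<open>t\<close> the weights \<eta> and 1/\<eta> cancel, and the two
      terms with \<open>prim X\<close> times \<open>q\<close> drop out.\<close>
    moreover have "Z t = X"
    proof -
      have "act (exp (- prim (q t))) w = X + act (prim X) (q t)" by (simp add: w_def Eta_def)
      moreover have "act (exp (- prim (q t)) * prim w) (q t) = act (prim X) (q t)"
        unfolding pw using act_exp_cancel(2)[of "prim (q t)" "act (prim X) (q t)"]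
        by (simp add: act_act Eta_def mult.assoc)
      ultimately show ?thesis by (simp add: Z_def)
    qed
    ultimately have "inner (act (exp (prim (q t))) (Y t)) (Y t) = 0" by (simp add: X_def velocity_eq Eta_def)
    then show ?thesis by (rule inner_act_exp_eq_0)
  qed
  then have "pd t = force (q t) (p t)" if "t \<in> ?T" for t using that by (simp add: Y_def)
  then show ?thesis
    unfolding solves_system_on_def cotangent_bundle_def using Q cot dq dp vel by simp
qed

theorem theorem4p13:
  shows "(\<forall>t0 t1 (q :: real \<Rightarrow> L2) (p :: real \<Rightarrow> L2). t0 < t1 \<longrightarrow>
            (geodesic_on t0 t1 q \<and>
             (\<forall>t\<in>{t0..t1}. p t = momentum (q t) (vector_derivative q (at t within {t0..t1})))
             \<longleftrightarrow> solves_system_on t0 t1 q p)) \<and>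
         (\<forall>(q, p)\<in>cotangent_bundle. \<forall>V.
            is_hamiltonian_vector q p V \<longleftrightarrow> V = (velocity q p, force q p))"
proof (intro conjI allI impI)
  fix t0 t1 :: real and q p :: "real \<Rightarrow> L2"
  assume "t0 < t1"
  then show "geodesic_on t0 t1 q \<and>
      (\<forall>t\<in>{t0..t1}. p t = momentum (q t) (vector_derivative q (at t within {t0..t1})))
      \<longleftrightarrow> solves_system_on t0 t1 q p"
    using solution_imp_geodesic geodesic_imp_solution by blast
next
  show "\<forall>(q, p)\<in>cotangent_bundle. \<forall>V. is_hamiltonian_vector q p V \<longleftrightarrow> V = (velocity q p, force q p)"
    using hamiltonian_vector_iff by (auto simp: cotangent_bundle_def)
qed

end
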